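(* Let $n\ge 2$ and let $\ell,k\in[n-1]$. The geometric $R$-matrix $R:\mathbb X_\ell\times\mathbb X_k\to\mathbb X_k\times\mathbb X_\ell$ is positive; that is, the rational map $$(\Theta_k^{-1}\times\Theta_\ell^{-1})\circ R\circ(\Theta_\ell\times\Theta_k):\ \mathbb T_{n-\ell}\times\mathbb T_{n-k}\to\mathbb T_{n-k}\times\mathbb T_{n-\ell}$$ is defined and each of its components is a positive rational function.
   Context: Notation. Fix $n\ge2$; $[m]=\{1,\dots,m\}$, $[i,j]=\{m\in\mathbb Z: i\le m\le j\}$. For $k\in[n-1]$, $\mathbb X_k=\mathrm{Gr}(k,n)\times\mathbb C^\times$, with points written $N|t$. A subspace $N\in\mathrm{Gr}(k,n)$ is the column span of a full-rank $n\times k$ matrix, and $P_J(N)$ is the maximal minor of that matrix with row set $J$ (rows in increasing order), defined up to a common nonzero scalar. Index sets of integers are reduced modulo $n$ to subsets of $[n]$, and $P_I:=0$ if the reduced set does not have exactly $k$ elements. The map $g$. $\lambda$ is an indeterminate. $g(N|t)$ is the $n\times n$ matrix with entries $g(N|t)_{ij}=c_{ij}\,P_{[j-k+1,j-1]\cup\{i\}}(N)/P_{[j-k,j-1]}(N)$, where $c_{ij}=1$ if $j\le k$; $c_{ij}=t$ if $j>k$ and $i\ge j$; $c_{ij}=\lambda$ if $j>k$ and $i<j$. On products, $g(x_1,\dots,x_d)=g(x_1)\cdots g(x_d)$. The geometric $R$-matrix. For $z\in\mathbb C^\times$ and an $n\times n$ matrix $A$ over $\mathbb C[\lambda,\lambda^{-1}]$,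 $\pi^k_z(A)=N|z$ where $N$ is the span of the first $k$ columns of $A|_{\lambda=(-1)^{k-1}z}$ (defined when these columns are linearly independent). Let $\mathrm{fl}(A)_{ij}=A_{n-j+1,n-i+1}$. Define $S:\mathbb X_k\to\mathbb X_k$ by $S(N|t)=\pi^k_t(\mathrm{fl}(g(N|t)))$, and on products $S(x_1,\dots,x_d)=(S(x_d),\dots,S(x_1))$. Define $\Psi_{k,\ell}:\mathbb X_\ell\times\mathbb X_k\to\mathbb X_k$ by $\Psi_{k,\ell}(M|s,N|t)=\pi^k_t(g(M|s)g(N|t))$. The geometric $R$-matrix is the rational map $R=(\Psi_{k,\ell},\ S\circ\Psi_{\ell,k}\circ S):\mathbb X_\ell\times\mathbb X_k\to\mathbb X_k\times\mathbb X_\ell$. Parametrization. For $m\in[n-1]$ let $\mathcal R_m=\{(i,j):1\le i\le m,\ i\le j\le i+n-m-1\}$ and $\mathbb T_m=(\mathbb C^\times)^{\mathcal R_m}\times\mathbb C^\times$, with points $(X_{ij},t)$. Put $x_{ij}=X_{ij}/X_{i,j-1}$ for $1\le i\le m$, $i\le j\le i+n-m$, where $X_{i,i-1}:=1$ and $X_{i,i+n-m}:=t$. For $1\le a\le b\le n$ let $M_{[a,b]}(z_a,\dots,z_b)=\sum_{i\in[a,b]}z_iE_{ii}+\sum_{i\notin[a,b]}E_{ii}+\sum_{i\in[a+1,b]}E_{i,i-1}$ ($E_{ij}$ are the $n\times n$ matrix units). Let $\Phi_m(X_{ij},t)=\prod_{i=m}^{1}M_{[i,i+n-m]}(x_{ii},\dots,x_{i,i+n-m})$,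 factors ordered left to right in decreasing order of $i$. Then $\Theta_k:\mathbb T_{n-k}\to\mathbb X_k$ sends $(X_{ij},t)$ to $N|t$, where $N$ is the span of the first $k$ columns of $\Phi_{n-k}(X_{ij},t)$; it is a birational isomorphism. A rational function in variables $z_1,\dots,z_d$ is positive if it can be written as a ratio of two nonzero polynomials whose coefficients are positive integers. *)

theory Defs
  imports
    "Jordan_Normal_Form.DL_Rank"
    "Jordan_Normal_Form.DL_Submatrix"
    "Jordan_Normal_Form.Determinant"
    "HOL-Library.Poly_Mapping"
    "HOL-Library.FuncSet"
    "HOL-Library.Monad_Syntax"
begin

text \<open>
  Rational maps are modelled as partial functions on points, defined wherever every step of their
  construction is defined; statements about them are then made generically, that is, off the zero
  locus of a nonzero polynomial. All row, column and variable indices are 1-based as in the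
  mathematical text; the shift to the 0-based indices of matrices is made explicitly.
\<close>

subsection \<open>Grassmannians and Pluecker coordinates\<close>

definition full_rank_mats :: "nat \<Rightarrow> nat \<Rightarrow> complex mat set" where
  "full_rank_mats n k = {A \<in> carrier_mat n k. vec_space.rank n A = k}"

definition Gr :: "nat \<Rightarrow> nat \<Rightarrow> complex vec set set" where
  "Gr k n = vec_space.col_space n ` full_rank_mats n k"

type_synonym point = "complex vec set \<times> complex"

definition XX :: "nat \<Rightarrow> nat \<Rightarrow> point set" where
  "XX n k = Gr k n \<times> (UNIV - {0})"

text \<open>Row set of a matrix (0-based) determined by a set of integers (1-based) modulo \<open>n\<close>.\<close>
definition reduce :: "nat \<Rightarrow> int set \<Rightarrow> nat set" where
  "reduce n J = (\<lambda>m. nat ((m - 1) mod int n)) ` J"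

text \<open>
  Pluecker coordinates are defined up to a common scalar, so a representing matrix is chosen;
  only ratios of coordinates of the same subspace, and their vanishing, are used below.
\<close>
definition rep_mat :: "nat \<Rightarrow> nat \<Rightarrow> complex vec set \<Rightarrow> complex mat" where
  "rep_mat n k N = (SOME A. A \<in> full_rank_mats n k \<and> vec_space.col_space n A = N)"

definition plucker :: "nat \<Rightarrow> nat \<Rightarrow> complex vec set \<Rightarrow> int set \<Rightarrow> complex" where
  "plucker n k N J =
     (if card (reduce n J) = k then det (submatrix (rep_mat n k N) (reduce n J) UNIV) else 0)"

subsection \<open>The map \<open>g\<close>\<close>

text \<open>
  The indeterminate \<open>\<lambda>\<close> is \<open>[:0, 1:]\<close>. Only nonnegative powers of it occur in \<open>g\<close>, its products
  and its flips, so the entries are taken in the polynomial ring inside the Laurent polynomials.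
\<close>
definition c_coeff :: "nat \<Rightarrow> complex \<Rightarrow> nat \<Rightarrow> nat \<Rightarrow> complex poly" where
  "c_coeff k t i j = (if j \<le> k then 1 else if i \<ge> j then [:t:] else [:0, 1:])"

fun g_mat :: "nat \<Rightarrow> nat \<Rightarrow> point \<Rightarrow> complex poly mat option" where
  "g_mat n k (N, t) =
     (if (N, t) \<in> XX n k \<and>
         (\<forall>j\<in>{1..n}. plucker n k N {int j - int k..int j - 1} \<noteq> 0)
      then Some (mat n n (\<lambda>(i0, j0). let i = i0 + 1; j = j0 + 1 in
        Polynomial.smult (plucker n k N ({int j - int k + 1..int j - 1} \<union> {int i})
               / plucker n k N {int j - int k..int j - 1})
          (c_coeff k t i j)))
      else None)"

subsection \<open>The geometric R-matrix\<close>

definition first_cols :: "nat \<Rightarrow> nat \<Rightarrow> 'a mat \<Rightarrow> 'a mat" where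
  "first_cols n k A = mat n k (\<lambda>(i, j). A $$ (i, j))"

definition proj :: "nat \<Rightarrow> nat \<Rightarrow> complex \<Rightarrow> complex poly mat \<Rightarrow> point option" where
  "proj n k z A =
     (let B = first_cols n k (map_mat (\<lambda>p. poly p ((-1) ^ (k - 1) * z)) A)
      in if z \<noteq> 0 \<and> B \<in> full_rank_mats n k then Some (vec_space.col_space n B, z) else None)"

definition flip_mat :: "nat \<Rightarrow> 'a mat \<Rightarrow> 'a mat" where
  "flip_mat n A = mat n n (\<lambda>(i, j). A $$ (n - 1 - j, n - 1 - i))"

definition S1 :: "nat \<Rightarrow> nat \<Rightarrow> point \<Rightarrow> point option" where
  "S1 n k x = do { A \<leftarrow> g_mat n k x; proj n k (snd x) (flip_mat n A) }"

text \<open>\<open>S2 n l k\<close> is the map \<open>S\<close> from \<open>XX n l \<times> XX n k\<close> to \<open>XX n k \<times> XX n l\<close>.\<close>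
fun S2 :: "nat \<Rightarrow> nat \<Rightarrow> nat \<Rightarrow> point \<times> point \<Rightarrow> (point \<times> point) option" where
  "S2 n l k (x, y) = do { y' \<leftarrow> S1 n k y; x' \<leftarrow> S1 n l x; Some (y', x') }"

text \<open>\<open>Psi n k l\<close> is \<open>\<Psi>\<^sub>k\<^sub>,\<^sub>l\<close>, from \<open>XX n l \<times> XX n k\<close> to \<open>XX n k\<close>.\<close>
fun Psi :: "nat \<Rightarrow> nat \<Rightarrow> nat \<Rightarrow> point \<times> point \<Rightarrow> point option" where
  "Psi n k l (x, y) = do { A \<leftarrow> g_mat n l x; B \<leftarrow> g_mat n k y; proj n k (snd y) (A * B) }"

definition geomR :: "nat \<Rightarrow> nat \<Rightarrow> nat \<Rightarrow> point \<times> point \<Rightarrow> (point \<times> point) option" where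
  "geomR n l k p = do {
     u \<leftarrow> Psi n k l p;
     v \<leftarrow> map_comp (S1 n l) (map_comp (Psi n l k) (S2 n l k)) p;
     Some (u, v) }"

subsection \<open>The parametrization\<close>

definition RR :: "nat \<Rightarrow> nat \<Rightarrow> (nat \<times> nat) set" where
  "RR n m = {(i, j). 1 \<le> i \<and> i \<le> m \<and> i \<le> j \<and> j + m + 1 \<le> i + n}"

type_synonym tpoint = "(nat \<times> nat \<Rightarrow> complex) \<times> complex"

definition TT :: "nat \<Rightarrow> nat \<Rightarrow> tpoint set" where
  "TT n m = (RR n m \<rightarrow>\<^sub>E (UNIV - {0})) \<times> (UNIV - {0})"

fun X_ext :: "nat \<Rightarrow> nat \<Rightarrow> tpoint \<Rightarrow> nat \<Rightarrow> nat \<Rightarrow> complex" where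
  "X_ext n m (X, t) i j = (if j + 1 = i then 1 else if j + m = i + n then t else X (i, j))"

definition x_coord :: "nat \<Rightarrow> nat \<Rightarrow> tpoint \<Rightarrow> nat \<Rightarrow> nat \<Rightarrow> complex" where
  "x_coord n m a i j = X_ext n m a i j / X_ext n m a i (j - 1)"

definition M_mat :: "nat \<Rightarrow> nat \<Rightarrow> nat \<Rightarrow> (nat \<Rightarrow> complex) \<Rightarrow> complex mat" where
  "M_mat n a b z = mat n n (\<lambda>(i0, j0). let i = i0 + 1; j = j0 + 1 in
     if i = j then (if i \<in> {a..b} then z i else 1)
     else if i \<in> {a + 1..b} \<and> j + 1 = i then 1 else 0)"

definition Phi :: "nat \<Rightarrow> nat \<Rightarrow> tpoint \<Rightarrow> complex mat" where
  "Phi n m a =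
     foldr (*) (map (\<lambda>i. M_mat n i (i + n - m) (x_coord n m a i)) (rev [1..<m + 1])) (1\<^sub>m n)"

definition Theta :: "nat \<Rightarrow> nat \<Rightarrow> tpoint \<Rightarrow> point" where
  "Theta n k a = (vec_space.col_space n (first_cols n k (Phi n (n - k) a)), snd a)"

text \<open>
  The inverse is defined only at points with exactly one preimage; on a dense open set this is
  the inverse of the birational map.
\<close>
definition Theta_inv :: "nat \<Rightarrow> nat \<Rightarrow> point \<Rightarrow> tpoint option" where
  "Theta_inv n k x =
     (if \<exists>!a. a \<in> TT n (n - k) \<and> Theta n k a = x
      then Some (THE a. a \<in> TT n (n - k) \<and> Theta n k a = x) else None)"

fun Theta_inv2 :: "nat \<Rightarrow> nat \<Rightarrow> nat \<Rightarrow> point \<times> point \<Rightarrow> (tpoint \<times> tpoint) option" where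
  "Theta_inv2 n k l (x, y) = do { a \<leftarrow> Theta_inv n k x; b \<leftarrow> Theta_inv n l y; Some (a, b) }"

definition R_torus :: "nat \<Rightarrow> nat \<Rightarrow> nat \<Rightarrow> tpoint \<times> tpoint \<Rightarrow> (tpoint \<times> tpoint) option" where
  "R_torus n l k p =
     map_comp (Theta_inv2 n k l) (geomR n l k) (map_prod (Theta n l) (Theta n k) p)"

subsection \<open>Rational functions on products of tori\<close>

datatype tvar = XVar nat nat | TVar

fun tcoord :: "tpoint \<Rightarrow> tvar \<Rightarrow> complex" where
  "tcoord (X, t) (XVar i j) = X (i, j)"
| "tcoord (X, t) TVar = t"

definition tvars :: "nat \<Rightarrow> nat \<Rightarrow> tvar set" where
  "tvars n m = (\<lambda>(i, j). XVar i j) ` RR n m \<union> {TVar}"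

fun tcoord2 :: "tpoint \<times> tpoint \<Rightarrow> tvar + tvar \<Rightarrow> complex" where
  "tcoord2 (a, b) (Inl v) = tcoord a v"
| "tcoord2 (a, b) (Inr v) = tcoord b v"

text \<open>Multivariate polynomials: finitely supported maps from exponent vectors to coefficients.\<close>
type_synonym 'v cpoly = "('v \<Rightarrow>\<^sub>0 nat) \<Rightarrow>\<^sub>0 complex"

definition polys_in :: "'v set \<Rightarrow> 'v cpoly set" where
  "polys_in V = {p. \<forall>m\<in>Poly_Mapping.keys p. Poly_Mapping.keys m \<subseteq> V}"

definition eval_poly :: "'v cpoly \<Rightarrow> ('v \<Rightarrow> complex) \<Rightarrow> complex" where
  "eval_poly p x =
     (\<Sum>m\<in>Poly_Mapping.keys p. Poly_Mapping.lookup p m *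
        (\<Prod>v\<in>Poly_Mapping.keys m. x v ^ Poly_Mapping.lookup m v))"

definition positive_polys_in :: "'v set \<Rightarrow> 'v cpoly set" where
  "positive_polys_in V = {p \<in> polys_in V. p \<noteq> 0 \<and>
     (\<forall>m\<in>Poly_Mapping.keys p. Poly_Mapping.lookup p m \<in> \<nat> - {0})}"

text \<open>Validity on a nonempty Zariski-open subset of \<open>TT n m \<times> TT n m'\<close>.\<close>
definition generically :: "nat \<Rightarrow> nat \<Rightarrow> nat \<Rightarrow> (tpoint \<times> tpoint \<Rightarrow> bool) \<Rightarrow> bool" where
  "generically n m m' P \<longleftrightarrow>
     (\<exists>D\<in>polys_in (tvars n m <+> tvars n m'). D \<noteq> 0 \<and>
        (\<forall>p\<in>TT n m \<times> TT n m'. eval_poly D (tcoord2 p) \<noteq> 0 \<longrightarrow> P p))"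

definition positive_rational_function ::
  "nat \<Rightarrow> nat \<Rightarrow> nat \<Rightarrow> (tpoint \<times> tpoint \<Rightarrow> complex option) \<Rightarrow> bool" where
  "positive_rational_function n m m' f \<longleftrightarrow>
     (\<exists>P\<in>positive_polys_in (tvars n m <+> tvars n m').
      \<exists>Q\<in>positive_polys_in (tvars n m <+> tvars n m').
        generically n m m' (\<lambda>p. eval_poly Q (tcoord2 p) \<noteq> 0 \<and>
          f p = Some (eval_poly P (tcoord2 p) / eval_poly Q (tcoord2 p))))"

end

theory Submission
  imports Defs "Jordan_Normal_Form.DL_Rank_Submatrix"
begin

text \<open>
  Everything is computed with maximal minors, and only with sums, products and quotients of them. The
  proof therefore works with an abstract notion of positive function, closed under these three
  operations, and is applied at the end to the positive rational functions on the torus.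

  A matrix is called positive here if all its maximal minors are positive functions. The matrix
  obtained from the parametrization is positive: it arises from the coordinate frame by row
  operations with positive coefficients, and every row set is reached by a chain of such operations
  (\<open>stage_posmat\<close>). Conversely, the coordinates are ratios of minors at particular row sets, so a
  matrix whose minors there are positive up to a common factor comes from a point with positive
  coordinates (\<open>stage_minor\<close>, \<open>pos_tpoint_of_minors\<close>). It is thus enough to show that each map in
  the construction of \<open>R\<close> carries positive matrices to matrices with minors that are positive up to
  a common factor.

  For \<open>\<Psi>(M|s, N|t)\<close>, note first that at the parameter where the product is evaluated the first \<open>k\<close>
  columns of \<open>g(N|t)\<close> span \<open>N\<close>; so the result is the image of \<open>N\<close> under \<open>g(M|s)\<close>. Up to a positive
  scaling of its columns, \<open>g(M|s)\<close> is a matrix of Pluecker coordinates of \<open>M\<close>. An elementary row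
  operation on \<open>N\<close> can be moved to the left of this matrix at the price of changing \<open>M\<close> by another
  row operation (\<open>plucker_mat_commute\<close>). This is a consequence of the three-term Pluecker relation.
  The change of \<open>M\<close> subtracts a multiple of one row from the next, but preserves positivity
  (\<open>mutation\<close>), because among all ratios of minors with one of the two rows exchanged for the other,
  the ratio that determines the multiple is the smallest (\<open>window_ratio_minimal\<close>). The row operation
  that comes out on the left acts positively on minors of size \<open>k\<close>: when it leads from the last row to
  the first one, the sign \<open>(-1)^(k-1)\<close> in the specialization of \<open>\<lambda>\<close> is cancelled by that of the cyclic
  rotation. After all row operations have been moved, there remains the image of the coordinate frame,
  that is, the span of the first \<open>k\<close> columns of \<open>g(M'|s)\<close>. Its minors are, up to a common factor,
  minors of \<open>M'\<close> or zero (\<open>minor_plucker_mat_frame\<close>), and together with the chains of operations they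
  make all minors of the image positive (\<open>plucker_mat_built\<close>, \<open>pos_tpoint_Psi\<close>).

  For \<open>S\<close>, the relevant minors of the flip of \<open>g(N|t)\<close> are minors of a matrix of rank \<open>k\<close> with columns
  in \<open>N\<close>. At a suitable row set they are block triangular, which makes them Laurent monomials in the
  minors of \<open>N\<close> (\<open>twisted_minor\<close>, \<open>pos_tpoint_S1\<close>).

  Genericity enters through a filter on the torus. The only degeneracy beyond the vanishing of positive
  functions is \<open>s = t\<close> or \<open>s = -t\<close>, one of which, depending on the parity of \<open>k + l\<close>, makes the rank
  of \<open>g(M|s)\<close> drop at the parameter in question.
\<close>

section \<open>Minors indexed by lists and by sets of rows\<close>

text \<open>
  Rows are given by lists in order to have the sign of a permutation of the rows available; sets, which
  stand for increasing lists, are what Pluecker coordinates are indexed by.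
\<close>
definition lminor :: "'a::comm_ring_1 mat \<Rightarrow> nat list \<Rightarrow> 'a" where
  "lminor A xs = det (mat (length xs) (length xs) (\<lambda>(i, j). A $$ (xs ! i, j)))"

definition pminor :: "'a::comm_ring_1 mat \<Rightarrow> nat set \<Rightarrow> 'a" where
  "pminor A J = (if card J = dim_col A then lminor A (sorted_list_of_set J) else 0)"

definition below :: "nat \<Rightarrow> nat set \<Rightarrow> nat" where
  "below a S = card {x \<in> S. x < a}"

text \<open>
  The coefficient of the entry in column \<open>c\<close> of one more row, put in front of the rows \<open>xs\<close>.
\<close>
definition lcof :: "'a::comm_ring_1 mat \<Rightarrow> nat list \<Rightarrow> nat \<Rightarrow> 'a" where
  "lcof A xs c = (-1) ^ c *
     det (mat (length xs) (length xs) (\<lambda>(i, j). A $$ (xs ! i, if j < c then j else Suc j)))"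

lemma lminor_Cons:
  "lminor A (x # xs) = (\<Sum>c<Suc (length xs). A $$ (x, c) * lcof A xs c)"
proof -
  let ?n = "Suc (length xs)"
  let ?B = "mat ?n ?n (\<lambda>(i, j). A $$ ((x # xs) ! i, j))"
  have "det ?B = (\<Sum>c<?n. ?B $$ (0, c) * cofactor ?B 0 c)"
    by (rule laplace_expansion_row) auto
  also have "\<dots> = (\<Sum>c<?n. A $$ (x, c) * lcof A xs c)"
  proof (rule sum.cong[OF refl])
    fix c assume "c \<in> {..<?n}"
    then have c: "c < ?n" by simp
    have "mat_delete ?B 0 c = mat (length xs) (length xs) (\<lambda>(i, j). A $$ (xs ! i, if j < c then j else Suc j))"
      unfolding mat_delete_def by (rule eq_matI) (use c in auto)
    then show "?B $$ (0, c) * cofactor ?B 0 c = A $$ (x, c) * lcof A xs c"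
      using c by (simp add: cofactor_def lcof_def)
  qed
  finally show ?thesis by (simp add: lminor_def)
qed

lemma lminor_repeated:
  assumes "i < length xs" "j < length xs" "i \<noteq> j" "xs ! i = xs ! j"
  shows "lminor A xs = 0"
  unfolding lminor_def
  by (rule det_identical_rows[of _ "length xs" i j]) (use assms in \<open>auto intro!: eq_vecI\<close>)

lemma lminor_Cons_mem: "x \<in> set xs \<Longrightarrow> lminor A (x # xs) = 0"
  by (auto simp: in_set_conv_nth intro!: lminor_repeated[where i = 0 and j = "Suc i" for i])

lemma lminor_swap: "lminor A (ys @ a # b # zs) = - lminor A (ys @ b # a # zs)"
proof -
  let ?n = "length (ys @ a # b # zs)" and ?m = "length ys"
  let ?B = "mat ?n ?n (\<lambda>(i, j). A $$ ((ys @ b # a # zs) ! i, j))"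
  have n: "?m < ?n" "Suc ?m < ?n" "length (ys @ b # a # zs) = ?n" by auto
  have "mat ?n ?n (\<lambda>(i, j). A $$ ((ys @ a # b # zs) ! i, j)) = swaprows ?m (Suc ?m) ?B"
  proof (rule eq_matI)
    fix i j assume "i < dim_row (swaprows ?m (Suc ?m) ?B)" "j < dim_col (swaprows ?m (Suc ?m) ?B)"
    then have ij: "i < ?n" "j < ?n" by (simp_all del: length_append)
    have "(ys @ a # b # zs) ! i = (ys @ b # a # zs) ! (if ?m = i then Suc ?m else if Suc ?m = i then ?m else i)"
      by (auto simp: nth_append nth_Cons')
    then show "mat ?n ?n (\<lambda>(i, j). A $$ ((ys @ a # b # zs) ! i, j)) $$ (i, j) = swaprows ?m (Suc ?m) ?B $$ (i, j)"
      using ij n by (simp del: length_append)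
  qed (simp_all del: length_append)
  moreover have "det (swaprows ?m (Suc ?m) ?B) = - det ?B"
    by (rule det_swaprows[where n = ?n]) auto
  ultimately show ?thesis by (simp add: lminor_def)
qed

lemma lminor_move: "lminor A (ys @ a # zs) = (-1) ^ length ys * lminor A (a # ys @ zs)"
proof (induction ys arbitrary: zs rule: rev_induct)
  case (snoc y ys)
  have "lminor A ((ys @ [y]) @ a # zs) = - lminor A (ys @ a # y # zs)"
    using lminor_swap[of A ys y a zs] by simp
  then show ?case by (simp add: snoc)
qed simp

lemma insort_split:
  assumes S: "finite S" "a \<notin> S"
  obtains ys zs where "insort a (sorted_list_of_set S) = ys @ a # zs"
    "sorted_list_of_set S = ys @ zs" "length ys = below a S"
proof -
  define xs where "xs = sorted_list_of_set S"
  have xs: "sorted xs" "distinct xs" "a \<notin> set xs" and set_xs: "set xs = S"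
    using S by (simp_all add: xs_def)
  define ys zs where "ys = filter (\<lambda>x. x < a) xs" and "zs = filter (\<lambda>x. \<not> x < a) xs"
  have "insort a xs = ys @ a # zs \<and> xs = ys @ zs"
    unfolding ys_def zs_def using xs
  proof (induction xs)
    case (Cons x xs)
    show ?case
    proof (cases "x < a")
      case False
      then have "\<forall>y\<in>set (x # xs). \<not> y < a" using Cons.prems by auto
      then have "filter (\<lambda>y. y < a) (x # xs) = []" "filter (\<lambda>y. \<not> y < a) (x # xs) = x # xs"
        by (auto simp: filter_empty_conv filter_id_conv)
      then show ?thesis using Cons.prems False by auto
    qed (use Cons in auto)
  qed simp
  moreover have "length ys = below a S"
    unfolding below_def ys_def set_xs[symmetric] using xs(2) by (simp add: distinct_length_filter Int_def conj_commute)
  ultimately show ?thesis using that unfolding xs_def by blast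
qed

lemma pminor_insert:
  assumes "finite S" "a \<notin> S" "dim_col A = Suc (card S)"
  shows "pminor A (insert a S) = (-1) ^ below a S * lminor A (a # sorted_list_of_set S)"
proof -
  obtain ys zs where "insort a (sorted_list_of_set S) = ys @ a # zs" "sorted_list_of_set S = ys @ zs"
    "length ys = below a S"
    by (rule insort_split[of S a]) (use assms in auto)
  then show ?thesis using assms lminor_move[of A ys a zs] by (simp add: pminor_def)
qed

lemma pminor_mem: "a \<in> S \<Longrightarrow> dim_col A = Suc (card S) \<Longrightarrow> pminor A (insert a S) = 0"
  by (simp add: pminor_def insert_absorb)

lemma pminor_insert_insert:
  assumes S: "finite S" "a \<notin> S" "b \<notin> S" "dim_col A = Suc (Suc (card S))" and ab: "a < b"
  shows "pminor A (insert a (insert b S)) =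
    (-1) ^ (below a S + below b S) * lminor A (a # b # sorted_list_of_set S)"
proof -
  have *: "below a (insert b S) = below a S"
    unfolding below_def by (rule arg_cong[where f = card]) (use ab in auto)
  let ?xs = "sorted_list_of_set S"
  obtain ys zs where yz: "insort b ?xs = ys @ b # zs" "?xs = ys @ zs" "length ys = below b S"
    by (rule insort_split[of S b]) (use S in auto)
  have "pminor A (insert a (insert b S)) = (-1) ^ below a S * lminor A (a # ys @ b # zs)"
    using pminor_insert[of "insert b S" a A] S ab * yz by simp
  also have "lminor A (a # ys @ b # zs) = (-1) ^ length (a # ys) * lminor A (b # a # ys @ zs)"
    using lminor_move[of A "a # ys" b zs] by simp
  also have "lminor A (b # a # ys @ zs) = - lminor A (a # b # ys @ zs)"
    by (rule lminor_swap[of A "[]", unfolded append_Nil])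
  finally show ?thesis using yz by (simp add: power_add)
qed

text \<open>
  The \<open>k + 1\<close> rows listed in \<open>xs\<close> live in a space of dimension \<open>k\<close>; this is the linear relation
  between them, obtained by expanding a determinant with a repeated column.
\<close>
lemma cramer_relation:
  assumes len: "length xs = Suc k" and c: "c < k"
  shows "(\<Sum>i<Suc k. (-1) ^ i * lminor A (take i xs @ drop (Suc i) xs) * A $$ (xs ! i, c)) = 0"
proof -
  let ?n = "Suc k"
  let ?B = "mat ?n ?n (\<lambda>(i, j). A $$ (xs ! i, if j = 0 then c else j - 1))"
  have "det ?B = 0"
    by (rule det_identical_columns[of _ ?n 0 "Suc c"]) (use c in \<open>auto intro!: eq_vecI\<close>)
  moreover have "det ?B = (\<Sum>i<?n. ?B $$ (i, 0) * cofactor ?B i 0)"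
    by (rule laplace_expansion_column) auto
  moreover have "?B $$ (i, 0) * cofactor ?B i 0 =
      (-1) ^ i * lminor A (take i xs @ drop (Suc i) xs) * A $$ (xs ! i, c)" if i: "i < ?n" for i
  proof -
    have "mat_delete ?B i 0 = mat k k (\<lambda>(r, j). A $$ ((take i xs @ drop (Suc i) xs) ! r, j))"
      unfolding mat_delete_def by (rule eq_matI) (use i len in \<open>auto simp: nth_append min_def\<close>)
    moreover have "length (take i xs @ drop (Suc i) xs) = k" using i len by simp
    ultimately show ?thesis using i by (simp add: cofactor_def lminor_def del: length_append)
  qed
  ultimately show ?thesis by simp
qed

lemma cramer_relation_lminor:
  assumes len: "length xs = Suc k" and T: "Suc (length T) = k"
  shows "(\<Sum>i<Suc k. (-1) ^ i * lminor A (take i xs @ drop (Suc i) xs) * lminor A (xs ! i # T)) = 0"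
proof -
  have "(\<Sum>i<Suc k. (-1) ^ i * lminor A (take i xs @ drop (Suc i) xs) * lminor A (xs ! i # T)) =
    (\<Sum>i<Suc k. \<Sum>c<k. (-1) ^ i * lminor A (take i xs @ drop (Suc i) xs) * A $$ (xs ! i, c) * lcof A T c)"
    using T by (simp add: lminor_Cons sum_distrib_left mult.assoc del: sum.lessThan_Suc)
  also have "\<dots> = (\<Sum>c<k. (\<Sum>i<Suc k. (-1) ^ i * lminor A (take i xs @ drop (Suc i) xs) * A $$ (xs ! i, c)) * lcof A T c)"
    by (subst sum.swap) (simp add: sum_distrib_right del: sum.lessThan_Suc)
  also have "\<dots> = 0"
    by (rule sum.neutral) (use cramer_relation[OF len, of _ A] in \<open>auto simp del: sum.lessThan_Suc\<close>)
  finally show ?thesis .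
qed

text \<open>
  The linear relation between the rows \<open>a, c, d\<close> and those of \<open>S\<close> is paired with \<open>b\<close> and \<open>S\<close>. All
  terms vanish in which a row of \<open>S\<close> is repeated, and three are left.
\<close>
lemma lminor_plucker:
  "lminor A (a # b # S) * lminor A (c # d # S) + lminor A (a # d # S) * lminor A (b # c # S) =
   lminor A (a # c # S) * lminor A (b # d # S)"
proof -
  let ?xs = "a # c # d # S" and ?k = "Suc (Suc (length S))"
  let ?t = "\<lambda>i. (-1) ^ i * lminor A (take i ?xs @ drop (Suc i) ?xs) * lminor A (?xs ! i # b # S)"
  have "(\<Sum>i<Suc ?k. ?t i) = 0"
    by (rule cramer_relation_lminor) simp_all
  moreover have "(\<Sum>i<Suc ?k. ?t i) = (\<Sum>i<3. ?t i)"
  proof (rule sum.mono_neutral_right)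
    show "\<forall>i\<in>{..<Suc ?k} - {..<3}. ?t i = 0"
    proof
      fix i assume i: "i \<in> {..<Suc ?k} - {..<3}"
      then obtain r where r: "i = r + 3" by (auto dest: le_Suc_ex simp: not_less add.commute)
      then have "?xs ! i = S ! r" "r < length S" using i by (auto simp: nth_Cons' numeral_3_eq_3)
      then have "lminor A (?xs ! i # b # S) = 0" by (intro lminor_Cons_mem) auto
      then show "?t i = 0" by simp
    qed
  qed auto
  moreover have "(\<Sum>i<3. ?t i) = lminor A (c # d # S) * lminor A (a # b # S)
      - lminor A (a # d # S) * lminor A (c # b # S) + lminor A (a # c # S) * lminor A (d # b # S)"
    by (simp add: numeral_3_eq_3)
  moreover have "lminor A (c # b # S) = - lminor A (b # c # S)" "lminor A (d # b # S) = - lminor A (b # d # S)"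
    by (rule lminor_swap[of A "[]", unfolded append_Nil])+
  ultimately show ?thesis by (simp add: algebra_simps)
qed

lemma pminor_plucker_sorted:
  assumes S: "finite S" "{a, b, c, d} \<inter> S = {}" "dim_col A = Suc (Suc (card S))"
    and "a < b" "b < c" "c < d"
  shows "pminor A (insert a (insert c S)) * pminor A (insert b (insert d S)) =
    pminor A (insert a (insert b S)) * pminor A (insert c (insert d S)) +
    pminor A (insert a (insert d S)) * pminor A (insert b (insert c S))"
proof -
  let ?e = "(-1) ^ (below a S + below b S + below c S + below d S) :: 'a"
  let ?xs = "sorted_list_of_set S"
  have "pminor A (insert a (insert c S)) * pminor A (insert b (insert d S)) =
      ?e * (lminor A (a # c # ?xs) * lminor A (b # d # ?xs))"
    "pminor A (insert a (insert b S)) * pminor A (insert c (insert d S)) =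
      ?e * (lminor A (a # b # ?xs) * lminor A (c # d # ?xs))"
    "pminor A (insert a (insert d S)) * pminor A (insert b (insert c S)) =
      ?e * (lminor A (a # d # ?xs) * lminor A (b # c # ?xs))"
    using assms by (simp_all add: pminor_insert_insert power_add mult_ac)
  then show ?thesis
    using lminor_plucker[of A a b ?xs c d] by (metis distrib_left)
qed

subsection \<open>Row operations and products\<close>

lemma lminor_cong:
  assumes "\<And>i j. i \<in> set xs \<Longrightarrow> j < length xs \<Longrightarrow> A $$ (i, j) = B $$ (i, j)"
  shows "lminor A xs = lminor B xs"
  unfolding lminor_def by (rule arg_cong[where f = det], rule eq_matI) (auto intro: assms)

lemma pminor_cong:
  assumes "finite J" "dim_col A = dim_col B" "\<And>i j. i \<in> J \<Longrightarrow> j < dim_col B \<Longrightarrow> A $$ (i, j) = B $$ (i, j)"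
  shows "pminor A J = pminor B J"
  using assms by (auto simp: pminor_def intro!: lminor_cong)

lemma lminor_mult:
  assumes A: "A \<in> carrier_mat n k" and C: "C \<in> carrier_mat k k" and xs: "length xs = k" "set xs \<subseteq> {..<n}"
  shows "lminor (A * C) xs = lminor A xs * det C"
proof -
  let ?M = "mat k k (\<lambda>(i, j). A $$ (xs ! i, j))"
  have "mat k k (\<lambda>(i, j). (A * C) $$ (xs ! i, j)) = ?M * C"
  proof (rule eq_matI)
    fix i j assume "i < dim_row (?M * C)" "j < dim_col (?M * C)"
    then have ij: "i < k" "j < k" using C by auto
    then have "xs ! i \<in> set xs" using xs by auto
    then have i': "xs ! i < n" using xs by blast
    have "row A (xs ! i) = row ?M i" using A ij i' by (intro eq_vecI) auto
    then show "mat k k (\<lambda>(i, j). (A * C) $$ (xs ! i, j)) $$ (i, j) = (?M * C) $$ (i, j)"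
      using A C ij i' by simp
  qed (use C in auto)
  then show ?thesis
    unfolding lminor_def xs(1) using det_mult[of ?M k C] C by simp
qed

lemma pminor_mult:
  assumes "A \<in> carrier_mat n k" "C \<in> carrier_mat k k" "J \<subseteq> {..<n}"
  shows "pminor (A * C) J = pminor A J * det C"
proof -
  have "finite J" using assms(3) finite_subset by blast
  then show ?thesis using assms lminor_mult[of A n k C "sorted_list_of_set J"]
    by (auto simp: pminor_def)
qed

text \<open>
  A minor is linear in its row \<open>u\<close>. Replacing \<open>u\<close> by \<open>v\<close> puts the new row into the wrong place of the
  list, and the sign brings it to its position.
\<close>
lemma pminor_addrow:
  assumes A: "A \<in> carrier_mat n k" and J: "J \<subseteq> {..<n}" and uv: "u < n" "v < n" "u \<noteq> v"
  shows "pminor (addrow \<alpha> u v A) J = pminor A J + (if u \<in> J \<and> v \<notin> J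
    then \<alpha> * (-1) ^ (below u (J - {u}) + below v (J - {u})) * pminor A (insert v (J - {u})) else 0)"
proof (cases "u \<in> J \<and> card J = k")
  case False
  have fin: "finite J" using J finite_subset by blast
  show ?thesis
  proof (cases "u \<in> J")
    case True
    then have "card J \<noteq> k" "v \<notin> J \<Longrightarrow> card (insert v (J - {u})) = card J"
      using False fin uv card_Suc_Diff1[OF fin True] by auto
    then show ?thesis using A by (auto simp: pminor_def)
  next
    case False
    then have "pminor (addrow \<alpha> u v A) J = pminor A J"
      by (intro pminor_cong) (use fin A J in auto)
    then show ?thesis using False by simp
  qed
next
  case True
  define S where "S = J - {u}"
  have fin: "finite S" using J finite_subset unfolding S_def by blast
  have S: "u \<notin> S" "J = insert u S" "k = Suc (card S)" using True card_Suc_Diff1[of J u] J finite_subset[OF J]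
    unfolding S_def by auto
  let ?xs = "sorted_list_of_set S"
  have xs: "set ?xs = S" "length ?xs = card S" using fin by auto
  have row: "\<And>j. j < k \<Longrightarrow> addrow \<alpha> u v A $$ (u, j) = \<alpha> * A $$ (v, j) + A $$ (u, j)"
    using A uv by simp
  have cof: "lcof (addrow \<alpha> u v A) ?xs c = lcof A ?xs c" if "c < k" for c
  proof -
    have "mat (length ?xs) (length ?xs) (\<lambda>(i, j). addrow \<alpha> u v A $$ (?xs ! i, if j < c then j else Suc j)) =
      mat (length ?xs) (length ?xs) (\<lambda>(i, j). A $$ (?xs ! i, if j < c then j else Suc j))"
    proof (rule eq_matI)
      fix i j assume "i < dim_row (mat (length ?xs) (length ?xs) (\<lambda>(i, j). A $$ (?xs ! i, if j < c then j else Suc j)))"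
        "j < dim_col (mat (length ?xs) (length ?xs) (\<lambda>(i, j). A $$ (?xs ! i, if j < c then j else Suc j)))"
      then have ij: "i < card S" "j < card S" using xs by auto
      then have "?xs ! i \<in> S" using xs nth_mem by metis
      then have "?xs ! i < n" "?xs ! i \<noteq> u" using J S by auto
      then show "mat (length ?xs) (length ?xs) (\<lambda>(i, j). addrow \<alpha> u v A $$ (?xs ! i, if j < c then j else Suc j)) $$ (i, j) =
        mat (length ?xs) (length ?xs) (\<lambda>(i, j). A $$ (?xs ! i, if j < c then j else Suc j)) $$ (i, j)"
        using ij xs A S(3) by auto
    qed auto
    then show ?thesis by (simp add: lcof_def)
  qed
  have "lminor (addrow \<alpha> u v A) (u # ?xs) = lminor A (u # ?xs) + \<alpha> * lminor A (v # ?xs)"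
  proof -
    have "lminor (addrow \<alpha> u v A) (u # ?xs) =
        (\<Sum>c<k. A $$ (u, c) * lcof A ?xs c + \<alpha> * (A $$ (v, c) * lcof A ?xs c))"
      unfolding lminor_Cons xs(2) S(3)[symmetric]
      by (rule sum.cong) (simp_all add: row cof distrib_right)
    then show ?thesis
      unfolding lminor_Cons xs(2) S(3)[symmetric] by (simp only: sum.distrib sum_distrib_left)
  qed
  moreover have "pminor A (insert v S) = (-1) ^ below v S * lminor A (v # ?xs)" if "v \<notin> J"
    by (rule pminor_insert) (use that fin S A in auto)
  moreover have "lminor A (v # ?xs) = 0" if "v \<in> J"
    by (rule lminor_Cons_mem) (use that xs S uv in auto)
  moreover have "pminor A J = (-1) ^ below u S * lminor A (u # ?xs)"
    "pminor (addrow \<alpha> u v A) J = (-1) ^ below u S * lminor (addrow \<alpha> u v A) (u # ?xs)"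
    unfolding S(2) by (rule pminor_insert; use fin S A in simp)+
  moreover have "(-1) ^ (below u S + below v S) * ((-1) ^ below v S * x) = (-1) ^ below u S * x" for x :: 'a
    by (simp add: power_add mult.assoc)
  ultimately show ?thesis using True
    by (cases "v \<in> J") (simp_all add: S_def[symmetric] distrib_left mult.assoc mult.left_commute[of _ \<alpha>])
qed

lemma pminor_multrow:
  assumes A: "A \<in> carrier_mat n k" and J: "J \<subseteq> {..<n}" and p: "p < n"
  shows "pminor (multrow p z A) J = (if p \<in> J then z else 1) * pminor A J"
proof (cases "p \<in> J \<and> card J = k")
  case False
  have fin: "finite J" using J finite_subset by blast
  show ?thesis
  proof (cases "p \<in> J")
    case True
    then show ?thesis using False A by (simp add: pminor_def)
  next
    case False
    have "pminor (multrow p z A) J = pminor A J"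
      by (rule pminor_cong) (use fin A J False in auto)
    then show ?thesis using False by simp
  qed
next
  case True
  have fin: "finite J" using J finite_subset by blast
  define xs where "xs = sorted_list_of_set J"
  have xs: "length xs = k" "set xs = J" "distinct xs" using True fin by (auto simp: xs_def)
  obtain i where i: "i < k" "xs ! i = p" using True xs by (metis in_set_conv_nth)
  let ?M = "mat k k (\<lambda>(i, j). A $$ (xs ! i, j))"
  have "mat k k (\<lambda>(i, j). multrow p z A $$ (xs ! i, j)) = multrow i z ?M"
  proof (rule eq_matI)
    fix r j assume "r < dim_row (multrow i z ?M)" "j < dim_col (multrow i z ?M)"
    then have rj: "r < k" "j < k" by auto
    moreover have "xs ! r < n" using J xs nth_mem rj(1) by blast
    moreover have "p = xs ! r \<longleftrightarrow> i = r" using xs rj i nth_eq_iff_index_eq by metis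
    ultimately show "mat k k (\<lambda>(i, j). multrow p z A $$ (xs ! i, j)) $$ (r, j) = multrow i z ?M $$ (r, j)"
      using A by auto
  qed auto
  moreover have "det (multrow i z ?M) = z * det ?M"
    by (rule det_multrow[of _ k]) (use i in auto)
  ultimately show ?thesis using True A xs by (simp add: pminor_def lminor_def xs_def[symmetric])
qed

lemma pick_eq_nth:
  assumes "finite J" "i < card J"
  shows "pick J i = sorted_list_of_set J ! i"
proof -
  define xs where "xs = sorted_list_of_set J"
  have xs: "sorted_wrt (<) xs" "set xs = J" "length xs = card J" using assms by (auto simp: xs_def strict_sorted_iff)
  have "{a \<in> J. a < xs ! i} = (!) xs ` {..<i}"
  proof (intro equalityI subsetI)
    fix a assume "a \<in> {a \<in> J. a < xs ! i}"
    then obtain r where "r < length xs" "a = xs ! r" "xs ! r < xs ! i" using xs by (auto simp: in_set_conv_nth)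
    moreover have "r < i"
    proof (rule ccontr)
      assume "\<not> r < i"
      then have "i = r \<or> xs ! i < xs ! r"
        using sorted_wrt_nth_less[OF xs(1), of i r] calculation(1) by linarith
      then show False using calculation by auto
    qed
    ultimately show "a \<in> (!) xs ` {..<i}" by auto
  qed (use sorted_wrt_nth_less[OF xs(1)] assms xs in auto)
  moreover have "inj_on ((!) xs) {..<i}"
    using xs assms xs(1)[unfolded strict_sorted_iff] by (auto simp: inj_on_def nth_eq_iff_index_eq)
  ultimately have "card {a \<in> J. a < xs ! i} = i" by (simp add: card_image)
  moreover have "xs ! i \<in> J" using xs assms by auto
  ultimately show ?thesis using pick_card_in_set[of "xs ! i" J] by (simp add: xs_def)
qed

lemma det_submatrix_eq_pminor:
  assumes A: "A \<in> carrier_mat n k" and J: "J \<subseteq> {..<n}" "card J = k"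
  shows "det (submatrix A J UNIV) = pminor A J"
proof -
  have fin: "finite J" using J finite_subset by blast
  have "{i. i < n \<and> i \<in> J} = J" using J by auto
  then have "submatrix A J UNIV = mat k k (\<lambda>(i, j). A $$ (sorted_list_of_set J ! i, j))"
    unfolding submatrix_def using A J fin by (intro eq_matI) (auto simp: pick_eq_nth pick_UNIV)
  then show ?thesis using A J fin by (simp add: pminor_def lminor_def)
qed

section \<open>Cyclic order and cyclic windows\<close>

text \<open>
  The number of steps from \<open>i\<close> up to \<open>j\<close> in the cyclic order of the rows.
\<close>
definition cyclic_dist :: "nat \<Rightarrow> nat \<Rightarrow> nat \<Rightarrow> nat" where
  "cyclic_dist n i j = (j + n - i) mod n"

lemma cyclic_dist_if: "i < n \<Longrightarrow> j < n \<Longrightarrow> cyclic_dist n i j = (if i \<le> j then j - i else j + n - i)"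
  by (auto simp: cyclic_dist_def mod_if)

text \<open>
  The three-term Pluecker relation does not see where the cyclic order is cut open: a product of
  two crossing pairs is the sum of the two products of non-crossing pairs.
\<close>
lemma pminor_plucker:
  assumes S: "finite S" "{a, b, c, d} \<inter> S = {}" "dim_col A = Suc (Suc (card S))"
    and n: "a < n" "b < n" "c < n" "d < n"
    and cyc: "0 < cyclic_dist n a b" "cyclic_dist n a b < cyclic_dist n a c" "cyclic_dist n a c < cyclic_dist n a d"
  shows "pminor A (insert a (insert c S)) * pminor A (insert b (insert d S)) =
    pminor A (insert a (insert b S)) * pminor A (insert c (insert d S)) +
    pminor A (insert a (insert d S)) * pminor A (insert b (insert c S))"
proof -
  have "(a < b \<and> b < c \<and> c < d) \<or> (b < c \<and> c < d \<and> d < a) \<or> (c < d \<and> d < a \<and> a < b) \<or> (d < a \<and> a < b \<and> b < c)"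
    using cyc n by (auto simp: cyclic_dist_if split: if_splits)
  then show ?thesis
    using pminor_plucker_sorted[of S a b c d A] pminor_plucker_sorted[of S b c d a A]
      pminor_plucker_sorted[of S c d a b A] pminor_plucker_sorted[of S d a b c A] S
    by (auto simp: insert_commute algebra_simps)
qed

definition rot_sign :: "nat \<Rightarrow> nat \<Rightarrow> nat \<Rightarrow> 'a::comm_ring_1" where
  "rot_sign n k q = (if Suc q = n then (-1) ^ (k - 1) else 1)"

text \<open>
  Moving the last row to the front of a minor of size \<open>k\<close> costs the sign \<open>(-1)^(k-1)\<close>; with it,
  the operation that adds a multiple of the last row to the first looks like all the others.
\<close>
lemma pminor_addrow_cyclic:
  assumes A: "A \<in> carrier_mat n k" and J: "J \<subseteq> {..<n}" and q: "q < n" "u = Suc q mod n" "2 \<le> n"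
  shows "pminor (addrow (\<alpha> * rot_sign n k q) u q A) J = pminor A J +
    (if u \<in> J \<and> q \<notin> J then \<alpha> * pminor A (insert q (J - {u})) else 0)"
proof -
  let ?K = "J - {u}"
  have fin: "finite J" using J finite_subset by blast
  have uq: "u < n" "u \<noteq> q" using q by (auto simp: mod_if split: if_splits)
  have "rot_sign n k q * (-1) ^ (below u ?K + below q ?K) * pminor A (insert q ?K) = pminor A (insert q ?K)"
    if uJ: "u \<in> J" "q \<notin> J"
  proof (cases "card J = k")
    case False
    then have "card (insert q ?K) \<noteq> k" using uJ fin card_Suc_Diff1[OF fin uJ(1)] by simp
    then show ?thesis using A by (simp add: pminor_def)
  next
    case True
    show ?thesis
    proof (cases "Suc q = n")
      case True
      then have u: "u = 0" using q by simp
      have "below u ?K = 0" "{x \<in> ?K. x < q} = ?K"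
        using u J uJ True by (auto simp: below_def) (metis less_SucE lessThan_iff subsetD)
      moreover have "card ?K = k - 1" using \<open>card J = k\<close> uJ fin by simp
      ultimately have "below u ?K + below q ?K = k - 1" by (simp add: below_def)
      then show ?thesis using True by (simp add: rot_sign_def flip: power_mult_distrib mult.assoc)
    next
      case False
      then have u: "u = Suc q" using q by simp
      have "{x \<in> ?K. x < u} = {x \<in> ?K. x < q}" using u uJ by (auto simp: less_Suc_eq)
      then show ?thesis using False by (simp add: rot_sign_def below_def flip: mult_2)
    qed
  qed
  then show ?thesis
    using pminor_addrow[OF A J uq(1) q(1) uq(2), of "\<alpha> * rot_sign n k q"] by (auto simp: mult.assoc)
qed

text \<open>
  The \<open>l - 1\<close> rows that precede \<open>j\<close> cyclically. Up to the coefficients \<open>1\<close>, \<open>t\<close> and \<open>\<lambda>\<close>, column \<open>j\<close> of \<open>g\<close>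
  consists of the minors of this window with one more row, divided by the minor of \<open>window n (Suc l) j\<close>.
\<close>
definition window :: "nat \<Rightarrow> nat \<Rightarrow> nat \<Rightarrow> nat set" where
  "window n l j = {i. i < n \<and> 0 < cyclic_dist n i j \<and> cyclic_dist n i j < l}"

lemma window_subset: "window n l j \<subseteq> {..<n}"
  by (auto simp: window_def)

lemma finite_window [simp]: "finite (window n l j)"
  by (rule finite_subset[OF window_subset]) simp

lemma shift_mod:
  fixes l :: nat
  assumes "l \<le> n" "j < n"
  shows "(j + n - l) mod n = (if j < l then j + n - l else j - l)"
proof (cases "j < l")
  case False
  then have "(j + n - l) mod n = (j - l + n) mod n" by simp
  also have "\<dots> = (j - l) mod n" by (rule mod_add_self2)
  finally show ?thesis using False assms by simp
qed (use assms in simp)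

lemma window_Suc:
  assumes "0 < l" "l < n" "j < n"
  shows "window n (Suc l) j = insert ((j + n - l) mod n) (window n l j)" "(j + n - l) mod n \<notin> window n l j"
proof -
  have q: "(j + n - l) mod n = (if j < l then j + n - l else j - l)"
    using assms by (intro shift_mod) auto
  show "(j + n - l) mod n \<notin> window n l j"
    unfolding q using assms by (auto simp: window_def cyclic_dist_if)
  show "window n (Suc l) j = insert ((j + n - l) mod n) (window n l j)"
    unfolding q window_def using assms by (auto simp: cyclic_dist_if split: if_splits)
qed

lemma card_window: "0 < l \<Longrightarrow> l \<le> n \<Longrightarrow> j < n \<Longrightarrow> card (window n l j) = l - 1"
proof (induction l)
  case (Suc l)
  show ?case
  proof (cases "l = 0")
    case True
    then show ?thesis by (auto simp: window_def)
  next
    case False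
    then show ?thesis using Suc window_Suc[of l n j] by simp
  qed
qed simp

text \<open>
  The matrix \<open>g\<close> evaluated at \<open>\<lambda> = \<mu>\<close>, with the factors that depend on the column only collected in
  \<open>\<delta>\<close>. Leaving \<open>\<delta>\<close> free lets row scalings of the right factor be absorbed.
\<close>
definition plucker_mat :: "nat \<Rightarrow> nat \<Rightarrow> 'a::field \<Rightarrow> 'a \<Rightarrow> (nat \<Rightarrow> 'a) \<Rightarrow> 'a mat \<Rightarrow> 'a mat" where
  "plucker_mat n l s \<mu> \<delta> M = mat n n (\<lambda>(i, j). (if j \<le> i then s else \<mu>) * pminor M (insert i (window n l j)) * \<delta> j)"

lemma plucker_mat_carrier [simp]: "plucker_mat n l s \<mu> \<delta> M \<in> carrier_mat n n"
  by (simp add: plucker_mat_def)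

text \<open>
  The next four identities are the scalar content of \<open>plucker_mat_commute_entry\<close>, one for each of the
  shapes that its entries take.
\<close>
lemma mult_split: "y * p = y * (p - a * x) + c * (z * x)" if "c * z = a * y" for y p z x c a :: "'a::field"
proof -
  have "c * (z * x) = (c * z) * x" by simp
  also have "\<dots> = a * y * x" unfolding that ..
  finally have *: "c * (z * x) = a * y * x" .
  show ?thesis unfolding * by (simp add: algebra_simps)
qed

lemma mult_absorb: "y * (k * PU) = g * (c * (z * PV))" if "c * z = a * y" "g * a * PV = k * PU" for c y z g a k PU PV :: "'a::field"
proof -
  have "g * (c * (z * PV)) = (c * z) * g * PV" by (simp only: mult_ac)
  also have "\<dots> = y * (g * a * PV)" unfolding that(1) by (simp only: mult_ac)
  finally show ?thesis unfolding that(2) by simp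
qed

lemma mult_split_diag: "s * PU + k * (m * PU) = g * (s * (PU - a * PV) + c * (z * PV))"
  if "c * z = a * m" "g * a * PV = k * PU" "g = 1 + k" for c z s m g a k PU PV :: "'a::field"
proof -
  have "g * (s * (PU - a * PV) + c * (z * PV)) = g * s * PU - s * (g * a * PV) + g * (c * (z * PV))"
    by (simp add: algebra_simps)
  also have "\<dots> = g * s * PU - s * (k * PU) + m * (k * PU)"
    using mult_absorb[OF that(1,2)] that(2) by simp
  finally show ?thesis using that(3) by (simp add: algebra_simps)
qed

lemma mult_eliminate: "PV * (g * (x - a * y)) = x * (PV + k * PQ) - (k * PU) * y"
  if "g * a * PV = k * PU" "g * PV = PV + k * PQ" for x y g a k PU PQ PV :: "'a::field"
proof -
  have "PV * (g * (x - a * y)) = x * (g * PV) - (g * a * PV) * y" by (simp add: algebra_simps)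
  then show ?thesis using that by simp
qed

lemma if_scale: "A = B + (if P then c * D else 0) \<Longrightarrow> A * x = B * x + (if P then c * (D * x) else 0)"
  for x :: "'a::field"
  by (simp add: algebra_simps)

lemma if_scale': "A = g * (B + (if P then c * D else 0)) \<Longrightarrow>
    A * x = B * (x * g) + (if P then c * (D * (x * g)) else 0)"
  for x :: "'a::field"
  by (simp add: algebra_simps)

text \<open>
  On the left, column \<open>Suc j\<close> is added to column \<open>j\<close>. If \<open>l \<ge> 2\<close>, the windows of these two columns differ only
  in that \<open>u\<close> is replaced by \<open>j\<close>, and \<open>q\<close> is the row before \<open>u\<close>. The coefficient \<open>a\<close> and the factor in \<open>\<delta>'\<close> are
  determined by the entries in rows \<open>u\<close> and \<open>q\<close>; in the other rows of column \<open>j\<close> the identity is then the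
  three-term relation. Every other column has a window that contains \<open>q\<close> whenever it contains \<open>u\<close>, and is
  changed in row \<open>u\<close> only.
\<close>
lemma plucker_mat_commute_entry:
  fixes M :: "'a::field mat"
  assumes M: "M \<in> carrier_mat n l" and l: "0 < l" "l < n" and j: "Suc j < n"
    and q: "q = (j + n - l) mod n" and u: "u = Suc q mod n"
    and s: "s \<noteq> 0" and \<delta>: "\<delta> j \<noteq> 0"
    and \<kappa>: "\<kappa> = \<epsilon> * \<delta> (Suc j) / \<delta> j"
    and PV: "PV = pminor M (insert q (window n l j))" "PV \<noteq> 0"
    and PQ: "PQ = pminor M (insert q (window n l (Suc j)))"
    and PU: "PU = pminor M (insert u (window n l (Suc j)))"
    and den: "PV + \<kappa> * PQ \<noteq> 0"
    and a: "a = \<kappa> * PU / (PV + \<kappa> * PQ)"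
    and M': "M' = addrow (- a * rot_sign n l q) u q M"
    and \<delta>': "\<delta>' = \<delta>(j := \<delta> j * (1 + \<kappa> * PQ / PV))"
    and ij: "i < n" "j' < n"
  shows "plucker_mat n l s \<mu> \<delta> M $$ (i, j') + (if j' = j then \<epsilon> * plucker_mat n l s \<mu> \<delta> M $$ (i, Suc j) else 0) =
    plucker_mat n l s \<mu> \<delta>' M' $$ (i, j') +
    (if i = u then a * (if Suc q = n then \<mu> / s else 1) * plucker_mat n l s \<mu> \<delta>' M' $$ (q, j') else 0)"
proof -
  let ?W = "window n l"
  let ?p = "\<lambda>i j. pminor M (insert i (?W j))"
  let ?p' = "\<lambda>i j. pminor M' (insert i (?W j))"
  let ?d = "\<lambda>i j. if j \<le> i then s else \<mu>"
  let ?c = "a * (if Suc q = n then \<mu> / s else 1)"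
  define \<gamma> where "\<gamma> = 1 + \<kappa> * PQ / PV"
  have qe: "q = (if j < l then j + n - l else j - l)" unfolding q by (rule shift_mod) (use l j in auto)
  have q_less: "q < n" unfolding q using j by simp
  have u_if: "u = (if Suc q = n then 0 else Suc q)" unfolding u using q_less by simp
  have ue: "u = (if Suc j < l then Suc j + n - l else Suc j - l)" unfolding u_if using qe l j by auto
  have qu: "q < n" "u < n" "q \<noteq> u" using q_less u_if j by auto
  have wrap: "Suc q = n \<longleftrightarrow> u = 0" "u \<noteq> 0 \<Longrightarrow> u = Suc q" using u_if by auto
  have f': "pminor M' J = pminor M J - (if u \<in> J \<and> q \<notin> J then a * pminor M (insert q (J - {u})) else 0)"
    if "J \<subseteq> {..<n}" for J
    unfolding M' using pminor_addrow_cyclic[OF M that qu(1) u, of "- a"] j by auto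
  have sub: "insert i (?W j') \<subseteq> {..<n}" if "i < n" for i j' using that window_subset by auto
  have cardW: "card (?W j') = l - 1" if "j' < n" for j' using card_window that l by simp
  have zero: "?p i j' = 0" "?p' i j' = 0" if "i \<in> ?W j'" "j' < n" for i j'
    using that pminor_mem[of i "?W j'" M] pminor_mem[of i "?W j'" M'] M cardW l by (auto simp: M')
  have pq: "?p' q j' = ?p q j'" for j' using f'[OF sub[OF qu(1)]] by simp
  have qW: "q \<notin> ?W j" using window_Suc l j q by simp
  have mem: "i \<in> ?W j' \<longleftrightarrow> 0 < cyclic_dist n i j' \<and> cyclic_dist n i j' < l" if "i < n" for i j'
    using that by (simp add: window_def)
  have uq_W: "q \<in> ?W j'" if "u \<in> ?W j'" "j' < n" "j' \<noteq> j" for j'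
    using that l j qu mem[OF qu(1), of j'] mem[OF qu(2), of j'] unfolding qe ue
    by (auto simp: cyclic_dist_if split: if_splits)
  have \<gamma>PV: "\<gamma> * PV = PV + \<kappa> * PQ" using PV(2) by (simp add: \<gamma>_def field_simps)
  have "\<gamma> * a * PV = (\<gamma> * PV) * a" by simp
  also have "\<dots> = \<kappa> * PU" unfolding \<gamma>PV a using den by simp
  finally have \<gamma>a: "\<gamma> * a * PV = \<kappa> * PU" "\<gamma> * PV = PV + \<kappa> * PQ" using \<gamma>PV by auto
  have bm: "plucker_mat n l s \<mu> \<delta> M $$ (i, j') = ?d i j' * ?p i j' * \<delta> j'" if "i < n" "j' < n" for i j'
    using that by (simp add: plucker_mat_def)
  have bm': "plucker_mat n l s \<mu> \<delta>' M' $$ (i, j') = ?d i j' * ?p' i j' * \<delta>' j'" if "i < n" "j' < n" for i j'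
    using that by (simp add: plucker_mat_def)
  show ?thesis
  proof (cases "j' = j")
    case False
    have main: "?d i j' * ?p i j' = ?d i j' * ?p' i j' + (if i = u then ?c * (?d q j' * ?p' q j') else 0)"
    proof (cases "i = u")
      case False
      have "u \<in> insert i (?W j') \<Longrightarrow> q \<in> insert i (?W j')"
        using uq_W[of j'] False \<open>j' \<noteq> j\<close> ij by auto
      then have "?p' i j' = ?p i j'" using f'[OF sub[OF ij(1), of j']] by auto
      then show ?thesis using False by simp
    next
      case iu: True
      show ?thesis
      proof (cases "u \<in> ?W j'")
        case True
        then have "q \<in> ?W j'" using uq_W False ij by blast
        then show ?thesis using zero[of _ j'] True ij iu by simp
      next
        case uW: False
        show ?thesis
        proof (cases "q \<in> ?W j'")
          case True
          then have "?p' u j' = ?p u j'" using f'[OF sub[OF qu(2), of j']] by simp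
          then show ?thesis using zero(2)[OF True ij(2)] iu by simp
        next
          case qW': False
          have "insert u (?W j') - {u} = ?W j'" using uW by auto
          then have e: "?p' u j' = ?p u j' - a * ?p q j'"
            using f'[OF sub[OF qu(2), of j']] qW' qu by simp
          have j'u: "j' \<noteq> u"
          proof
            assume ju: "j' = u"
            have "cyclic_dist n q u = 1" using qu wrap by (cases "u = 0") (auto simp: cyclic_dist_if)
            then have "l = 1" using qW' l mem[OF qu(1), of u] ju by auto
            then show False using ju ue \<open>j' \<noteq> j\<close> by simp
          qed
          have "?c * ?d q j' = a * ?d u j'"
            using j'u wrap s qu ij by (cases "u = 0") auto
          from mult_split[OF this] show ?thesis unfolding iu e pq by simp
        qed
      qed
    qed
    have "\<delta>' j' = \<delta> j'" using False by (simp add: \<delta>')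
    then show ?thesis
      unfolding bm[OF ij] bm'[OF ij] bm'[OF qu(1) ij(2)] if_not_P[OF False] add_0_right
      using if_scale[OF main, of "\<delta> j'"] by (simp only:)
  next
    case True
    have key: "?d i j * ?p i j + \<kappa> * (?d i (Suc j) * ?p i (Suc j)) =
        \<gamma> * (?d i j * ?p' i j + (if i = u then ?c * (?d q j * PV) else 0))"
    \<comment> \<open>For \<open>l = 1\<close> the windows are empty and \<open>u = j\<close>: row \<open>u\<close> is then the one
      where the two columns have different coefficients \<open>s\<close> and \<open>\<mu>\<close>.\<close>
    proof (cases "l = 1")
      case l1: True
      have W: "?W j' = {}" for j' using l1 by (auto simp: window_def)
      have uj: "u = j" using ue l1 by simp
      have PQV: "PQ = PV" "PU = pminor M {u}" using PV PQ PU W by auto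
      have \<gamma>: "\<gamma> = 1 + \<kappa>" using PV PQV by (simp add: \<gamma>_def)
      show ?thesis
      proof (cases "i = u")
        case False
        then have "?p' i j = ?p i j" using f'[OF sub[OF ij(1), of j]] W by auto
        moreover have "?d i j = ?d i (Suc j)" using False uj by auto
        ultimately show ?thesis using False \<gamma> W by (simp add: algebra_simps)
      next
        case iu: True
        have e: "?p' u j = ?p u j - a * PV" using f'[OF sub[OF qu(2), of j]] W qu PV by simp
        have cz: "?c * ?d q j = a * \<mu>" using wrap s qu uj by (cases "u = 0") auto
        have d: "?d i j = s" "?d i (Suc j) = \<mu>" using iu uj by auto
        have p: "?p i j = PU" "?p i (Suc j) = PU" "?p' i j = PU - a * PV"
          using iu e PQV W by auto
        show ?thesis unfolding d p if_P[OF iu] by (rule mult_split_diag[OF cz \<gamma>a(1) \<gamma>])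
      qed
    next
      case l2: False
      define S where "S = window n (l - 1) j"
      have l2': "2 \<le> l" using l l2 by simp
      have "j < l - 1 \<longleftrightarrow> Suc j < l" "j + n - (l - 1) = Suc j + n - l" "j - (l - 1) = Suc j - l"
        using l2' l by linarith+
      then have u': "(j + n - (l - 1)) mod n = u"
        unfolding ue using shift_mod[of "l - 1" n j] l2' l j by simp
      have Wj: "?W j = insert u S" "u \<notin> S"
        using window_Suc[of "l - 1" n j, unfolded u'] l2' l j unfolding S_def by simp_all
      have Wj': "?W (Suc j) = insert j S" "j \<notin> S"
        unfolding S_def window_def using l2' l j by (auto simp: cyclic_dist_if split: if_splits)
      have S: "finite S" "S \<subseteq> {..<n}" using window_subset by (auto simp: S_def)
      have cS: "card S = l - 2" using card_window[of "l - 1" n j] l2' l j by (simp add: S_def)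
      have qS: "q \<notin> S" using qW Wj by auto
      have uj: "u \<noteq> j" "q \<noteq> j" using l2' l j ue qe by auto
      have PV': "PV = pminor M (insert q (insert u S))" and PQ': "PQ = pminor M (insert q (insert j S))"
        and PU': "PU = pminor M (insert u (insert j S))" using PV PQ PU Wj Wj' by auto
      have dd: "?d i j * ?p i j + \<kappa> * (?d i (Suc j) * ?p i (Suc j)) = ?d i j * (?p i j + \<kappa> * ?p i (Suc j))"
      proof (cases "i = j")
        case True
        then have "?p i (Suc j) = 0" using zero(1)[of i "Suc j"] Wj' j by simp
        then show ?thesis by simp
      next
        case False
        then have "?d i j = ?d i (Suc j)" by auto
        then show ?thesis by (simp add: distrib_left mult.left_commute)
      qed
      show ?thesis
      proof (cases "i = u")
        case iu: True
        have p: "?p i j = 0" "?p' i j = 0" "?p i (Suc j) = PU" using zero[of u j] Wj j PU iu by auto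
        have cz: "?c * ?d q j = a * ?d i j" using wrap s qu uj j iu by (cases "u = 0") auto
        show ?thesis unfolding dd unfolding p if_P[OF iu] add_0_left mult_zero_right
          by (rule mult_absorb[OF cz \<gamma>a(1)])
      next
        case iu: False
        have "?p i j + \<kappa> * ?p i (Suc j) = \<gamma> * ?p' i j"
        proof (cases "i = q")
          case True
          then show ?thesis using pq[of j] \<gamma>a(2) PV PQ by simp
        next
          case iq: False
          show ?thesis
          proof (cases "i \<in> S")
            case True
            then show ?thesis using zero[of i j] zero[of i "Suc j"] Wj Wj' j by simp
          next
            case iS: False
            have "insert i (?W j) - {u} = insert i S" using Wj iu by auto
            then have e: "?p' i j = ?p i j - a * pminor M (insert q (insert i S))"
              using f'[OF sub[OF ij(1), of j]] Wj qS iq qu by simp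
            have "PV * (?p i j + \<kappa> * ?p i (Suc j)) = PV * (\<gamma> * ?p' i j)"
            proof (cases "i = j")
              case True
              have "?p i (Suc j) = 0" using zero(1)[of i "Suc j"] Wj' j True by simp
              moreover have "?p i j = PU" using True Wj PU' by (simp add: insert_commute)
              moreover have "pminor M (insert q (insert i S)) = PQ" using True PQ' by simp
              moreover have "PV * PU = PV * (\<gamma> * (PU - a * PQ))"
                unfolding mult_eliminate[OF \<gamma>a] by (simp add: algebra_simps)
              ultimately show ?thesis using e by simp
            next
              case ij': False
              have "cyclic_dist n q u = 1" "cyclic_dist n q j = l" using qu wrap l j unfolding qe ue
                by (auto simp: cyclic_dist_if)
              moreover have "l < cyclic_dist n q i"
              proof -
                have "i \<notin> ?W j" "i \<noteq> j" using Wj iS iu ij' by auto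
                then show ?thesis using mem[OF ij(1), of j] iq ij l j qu unfolding qe
                  by (auto simp: cyclic_dist_if split: if_splits)
              qed
              \<comment> \<open>The rows \<open>q, u, j, i\<close> are in cyclic order, so that \<open>{q, j}\<close> and \<open>{u, i}\<close> cross.\<close>
              ultimately have "pminor M (insert q (insert j S)) * pminor M (insert u (insert i S)) =
                  pminor M (insert q (insert u S)) * pminor M (insert j (insert i S)) +
                  pminor M (insert q (insert i S)) * pminor M (insert u (insert j S))"
                by (intro pminor_plucker[where n = n])
                  (use S cS M l2' qS Wj(2) Wj'(2) iS qu ij j in auto)
              moreover have p: "?p i j = pminor M (insert u (insert i S))" "?p i (Suc j) = pminor M (insert j (insert i S))"
                using Wj Wj' by (simp_all add: insert_commute)
              ultimately have pl: "PQ * ?p i j = PV * ?p i (Suc j) + pminor M (insert q (insert i S)) * PU"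
                unfolding PV' PQ' PU' p by simp
              have "PV * (\<gamma> * ?p' i j) = ?p i j * (PV + \<kappa> * PQ) - \<kappa> * PU * pminor M (insert q (insert i S))"
                unfolding e by (rule mult_eliminate[OF \<gamma>a])
              also have "\<dots> = PV * ?p i j + \<kappa> * (PQ * ?p i j) - \<kappa> * PU * pminor M (insert q (insert i S))"
                by (simp add: algebra_simps)
              also have "\<dots> = PV * (?p i j + \<kappa> * ?p i (Suc j))"
                unfolding pl by (simp add: algebra_simps)
              finally show ?thesis by (rule sym)
            qed
            then show ?thesis using PV(2) by simp
          qed
        qed
        then show ?thesis unfolding dd if_not_P[OF iu] by (simp only: add_0_right mult.left_commute)
      qed
    qed
    have "(?d i j * ?p i j + \<kappa> * (?d i (Suc j) * ?p i (Suc j))) * \<delta> j =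
        ?d i j * ?p i j * \<delta> j + \<epsilon> * (?d i (Suc j) * ?p i (Suc j) * \<delta> (Suc j))"
      using \<delta> by (simp add: \<kappa> field_simps)
    moreover have "\<delta>' j = \<delta> j * \<gamma>" by (simp add: \<delta>' \<gamma>_def)
    moreover have "?p' q j = PV" using pq PV by simp
    moreover have "j < n" using j by simp
    ultimately show ?thesis
      unfolding True bm[OF ij(1) \<open>j < n\<close>] bm[OF ij(1) j] bm'[OF ij(1) \<open>j < n\<close>] bm'[OF qu(1) \<open>j < n\<close>]
      using if_scale'[OF key, of "\<delta> j"] by (simp only: if_True refl)
  qed
qed

text \<open>
  If \<open>q\<close> is the last row, the operation on the left leads from row \<open>n - 1\<close> to row \<open>0\<close>, and
  off the diagonal these rows carry the coefficients \<open>s\<close> and \<open>\<mu>\<close>; hence the quotient \<open>\<mu> / s\<close>.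
\<close>
lemma plucker_mat_commute:
  fixes M :: "'a::field mat"
  assumes M: "M \<in> carrier_mat n l" and l: "0 < l" "l < n" and j: "Suc j < n"
    and q: "q = (j + n - l) mod n" and u: "u = Suc q mod n"
    and s: "s \<noteq> 0" and \<delta>: "\<delta> j \<noteq> 0"
    and \<kappa>: "\<kappa> = \<epsilon> * \<delta> (Suc j) / \<delta> j"
    and PV: "PV = pminor M (insert q (window n l j))" "PV \<noteq> 0"
    and PQ: "PQ = pminor M (insert q (window n l (Suc j)))"
    and PU: "PU = pminor M (insert u (window n l (Suc j)))"
    and den: "PV + \<kappa> * PQ \<noteq> 0"
    and a: "a = \<kappa> * PU / (PV + \<kappa> * PQ)"
    and M': "M' = addrow (- a * rot_sign n l q) u q M"
    and \<delta>': "\<delta>' = \<delta>(j := \<delta> j * (1 + \<kappa> * PQ / PV))"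
    and N: "N \<in> carrier_mat n k"
  shows "plucker_mat n l s \<mu> \<delta> M * addrow \<epsilon> (Suc j) j N =
    addrow (a * (if Suc q = n then \<mu> / s else 1)) u q (plucker_mat n l s \<mu> \<delta>' M' * N)"
proof (rule eq_matI)
  let ?A = "plucker_mat n l s \<mu> \<delta> M" and ?A' = "plucker_mat n l s \<mu> \<delta>' M'"
  let ?c = "a * (if Suc q = n then \<mu> / s else 1)"
  have qn: "q < n" unfolding q using j by simp
  fix i c assume "i < dim_row (addrow ?c u q (?A' * N))" "c < dim_col (addrow ?c u q (?A' * N))"
  then have ic: "i < n" "c < k" using N plucker_mat_carrier[of n l s \<mu> \<delta>' M'] by auto
  have prod: "(B * X) $$ (r, c) = (\<Sum>p<n. B $$ (r, p) * X $$ (p, c))"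
    if "B \<in> carrier_mat n n" "X \<in> carrier_mat n k" "r < n" for B X :: "'a mat" and r
    using that ic by (auto simp: scalar_prod_def lessThan_atLeast0 intro!: sum.cong)
  have "(?A * addrow \<epsilon> (Suc j) j N) $$ (i, c) =
      (\<Sum>p<n. ?A $$ (i, p) * (N $$ (p, c) + (if p = Suc j then \<epsilon> * N $$ (j, c) else 0)))"
    by (subst prod) (use N ic j in \<open>auto intro!: sum.cong\<close>)
  also have "\<dots> = (\<Sum>p<n. ?A $$ (i, p) * N $$ (p, c)) + ?A $$ (i, Suc j) * (\<epsilon> * N $$ (j, c))"
    using j by (simp add: distrib_left sum.distrib if_distrib[of "(*) _"] cong: if_cong)
  also have "\<dots> = (\<Sum>p<n. (?A $$ (i, p) + (if p = j then \<epsilon> * ?A $$ (i, Suc j) else 0)) * N $$ (p, c))"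
    using j by (simp add: distrib_right sum.distrib if_distrib[of "\<lambda>x. x * _"] cong: if_cong)
  also have "\<dots> = (\<Sum>p<n. (?A' $$ (i, p) + (if i = u then ?c * ?A' $$ (q, p) else 0)) * N $$ (p, c))"
    by (rule sum.cong[OF refl])
      (use plucker_mat_commute_entry[OF M l j q u s \<delta> \<kappa> PV PQ PU den a M' \<delta>' ic(1)] in simp)
  also have "\<dots> = (\<Sum>p<n. ?A' $$ (i, p) * N $$ (p, c)) +
      (if i = u then ?c * (\<Sum>p<n. ?A' $$ (q, p) * N $$ (p, c)) else 0)"
    by (simp add: distrib_right sum.distrib sum_distrib_left mult.assoc)
  also have "\<dots> = addrow ?c u q (?A' * N) $$ (i, c)"
    using ic qn N prod[OF plucker_mat_carrier N] by (auto simp: carrier_matD[OF plucker_mat_carrier])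
  finally show "(?A * addrow \<epsilon> (Suc j) j N) $$ (i, c) = addrow ?c u q (?A' * N) $$ (i, c)" .
qed (use N in \<open>auto simp: carrier_matD[OF plucker_mat_carrier]\<close>)

section \<open>Positive functions\<close>

text \<open>
  The filter stands for validity at generic points. No subtraction is available: whenever a difference is
  to be shown positive, it has to be rewritten without one.
\<close>
locale positive_functions =
  fixes F :: "'x filter" and pos :: "('x \<Rightarrow> complex) \<Rightarrow> bool"
  assumes pos_one: "pos (\<lambda>x. 1)"
    and pos_add: "pos f \<Longrightarrow> pos g \<Longrightarrow> pos (\<lambda>x. f x + g x)"
    and pos_mult: "pos f \<Longrightarrow> pos g \<Longrightarrow> pos (\<lambda>x. f x * g x)"
    and pos_inverse: "pos f \<Longrightarrow> pos (\<lambda>x. inverse (f x))"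
    and pos_cong: "pos f \<Longrightarrow> (\<forall>\<^sub>F x in F. g x = f x) \<Longrightarrow> pos g"
    and pos_nonzero: "pos f \<Longrightarrow> \<forall>\<^sub>F x in F. f x \<noteq> 0"
begin

text \<open>
  A minor may vanish identically as long as the row operations have not reached its row set.
\<close>
definition pos0 :: "('x \<Rightarrow> complex) \<Rightarrow> bool" where
  "pos0 f \<longleftrightarrow> pos f \<or> (\<forall>\<^sub>F x in F. f x = 0)"

lemma pos_divide: "pos f \<Longrightarrow> pos g \<Longrightarrow> pos (\<lambda>x. f x / g x)"
  using pos_mult[OF _ pos_inverse, of f g] by (simp add: field_class.field_divide_inverse)

lemma pos_prod: "finite A \<Longrightarrow> (\<And>i. i \<in> A \<Longrightarrow> pos (f i)) \<Longrightarrow> pos (\<lambda>x. \<Prod>i\<in>A. f i x)"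
  by (induction A rule: finite_induct) (auto intro: pos_one pos_mult)

lemma pos0I: "pos f \<Longrightarrow> pos0 f"
  by (simp add: pos0_def)

lemma pos0_zero: "pos0 (\<lambda>x. 0)"
  by (simp add: pos0_def)

lemma pos0_cong:
  assumes "pos0 f" "\<forall>\<^sub>F x in F. g x = f x"
  shows "pos0 g"
proof (cases "pos f")
  case True
  then show ?thesis using pos_cong assms(2) pos0I by blast
next
  case False
  then have "\<forall>\<^sub>F x in F. f x = 0" using assms(1) by (simp add: pos0_def)
  with assms(2) have "\<forall>\<^sub>F x in F. g x = 0" by eventually_elim simp
  then show ?thesis by (simp add: pos0_def)
qed

lemma pos_add_pos0:
  assumes "pos f" "pos0 g"
  shows "pos (\<lambda>x. f x + g x)"
proof (cases "pos g")
  case False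
  then have "\<forall>\<^sub>F x in F. g x = 0" using assms(2) by (simp add: pos0_def)
  then have "\<forall>\<^sub>F x in F. f x + g x = f x" by eventually_elim simp
  then show ?thesis by (rule pos_cong[OF assms(1)])
qed (use assms pos_add in blast)

lemma pos0_add_pos: "pos0 f \<Longrightarrow> pos g \<Longrightarrow> pos (\<lambda>x. f x + g x)"
  using pos_add_pos0[of g f] by (simp add: add.commute)

lemma pos0_add:
  assumes "pos0 f" "pos0 g"
  shows "pos0 (\<lambda>x. f x + g x)"
proof (cases "pos f")
  case False
  then have "\<forall>\<^sub>F x in F. f x = 0" using assms(1) by (simp add: pos0_def)
  then have "\<forall>\<^sub>F x in F. f x + g x = g x" by eventually_elim simp
  then show ?thesis by (rule pos0_cong[OF assms(2)])
qed (use assms pos_add_pos0 pos0I in blast)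

lemma pos0_mult:
  assumes "pos0 f" "pos0 g"
  shows "pos0 (\<lambda>x. f x * g x)"
proof -
  have "pos0 (\<lambda>x. f x * g x)" if "(\<forall>\<^sub>F x in F. f x = 0) \<or> (\<forall>\<^sub>F x in F. g x = 0)"
  proof -
    have "\<forall>\<^sub>F x in F. f x * g x = 0"
      using that by (auto elim: eventually_mono)
    then show ?thesis by (simp add: pos0_def)
  qed
  then show ?thesis using assms pos_mult unfolding pos0_def by blast
qed

lemma pos0_divide: "pos0 f \<Longrightarrow> pos g \<Longrightarrow> pos0 (\<lambda>x. f x / g x)"
  using pos0_mult[OF _ pos0I[OF pos_inverse], of f g] by (simp add: field_class.field_divide_inverse)

definition posmat :: "nat \<Rightarrow> nat \<Rightarrow> ('x \<Rightarrow> complex mat) \<Rightarrow> bool" where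
  "posmat n l M \<longleftrightarrow> (\<forall>x. M x \<in> carrier_mat n l) \<and>
     (\<forall>J. J \<subseteq> {..<n} \<longrightarrow> card J = l \<longrightarrow> pos (\<lambda>x. pminor (M x) J))"

lemma posmat_carrier: "posmat n l M \<Longrightarrow> M x \<in> carrier_mat n l"
  by (simp add: posmat_def)

lemma posmat_pos: "posmat n l M \<Longrightarrow> J \<subseteq> {..<n} \<Longrightarrow> card J = l \<Longrightarrow> pos (\<lambda>x. pminor (M x) J)"
  by (simp add: posmat_def)

text \<open>
  Among all the ratios of a minor containing row \<open>u\<close> to the one with \<open>u\<close> replaced by its cyclic
  predecessor \<open>q\<close>, the ratio at the window \<open>W\<close> of rows following \<open>u\<close> is the smallest. Exchanging an
  element outside \<open>W\<close> for one inside decreases the ratio, by the three-term relation.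
\<close>
lemma window_ratio_minimal:
  assumes M: "posmat n l M" and l: "0 < l" "l < n" and q: "q < n" and u: "u = Suc q mod n"
    and W: "W = {w. w < n \<and> 1 < cyclic_dist n q w \<and> cyclic_dist n q w \<le> l}" "card W = l - 1"
    and K: "K \<subseteq> {..<n}" "u \<notin> K" "q \<notin> K" "card K = l - 1"
  shows "pos0 (\<lambda>x. pminor (M x) (insert u K) * pminor (M x) (insert q W) -
    pminor (M x) (insert u W) * pminor (M x) (insert q K))"
  using K
proof (induction "card (K - W)" arbitrary: K)
  case 0
  have fin: "finite K" "finite W" using 0 finite_subset W by auto
  then have "K \<subseteq> W" using 0 by auto
  then have "K = W" using fin 0 W card_subset_eq by metis
  then show ?case by (simp add: pos0_zero mult.commute)
next
  case (Suc d)
  have fin: "finite K" "finite W" using Suc finite_subset W by auto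
  have u_if: "u = (if Suc q = n then 0 else Suc q)" unfolding u using q by simp
  have qu: "u < n" "u \<noteq> q" "cyclic_dist n q u = 1"
    using q u l by (auto simp: cyclic_dist_if) (cases "Suc q = n"; auto simp: cyclic_dist_if)+
  have quW: "q \<notin> W" "u \<notin> W" using qu q unfolding W by (auto simp: cyclic_dist_if)
  have "card (K - W) \<noteq> 0" using Suc(2) by simp
  then have "K - W \<noteq> {}" by (metis card.empty)
  then obtain x where x: "x \<in> K" "x \<notin> W" by blast
  have "card (W - K) = card (K - W)"
    using card_Diff_subset_Int[of W K] card_Diff_subset_Int[of K W] fin Suc W by (simp add: Int_commute)
  then have "W - K \<noteq> {}" using \<open>card (K - W) \<noteq> 0\<close> by (metis card.empty)
  then obtain w where w: "w \<in> W" "w \<notin> K" by blast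
  define S where "S = K - {x}"
  have S: "finite S" "x \<notin> S" "w \<notin> S" "q \<notin> S" "u \<notin> S" "K = insert x S" "S \<subseteq> {..<n}"
    using fin x w Suc.prems by (auto simp: S_def)
  have l2: "2 \<le> l" using W fin w by (cases l) (auto simp: card_gt_0_iff)
  have cS: "card S = l - 2" unfolding S_def using x fin Suc.prems(4) by simp
  let ?K' = "insert w S"
  have lt: "x < n" "w < n" "w \<noteq> x" using x w Suc.prems W by auto
  have "?K' - W = K - W - {x}" using w by (auto simp: S_def)
  then have "card (?K' - W) = d" using Suc(2) fin x by simp
  moreover have K': "?K' \<subseteq> {..<n}" "u \<notin> ?K'" "q \<notin> ?K'" "card ?K' = l - 1"
    using S lt w quW cS l2 by auto
  ultimately have IH: "pos0 (\<lambda>y. pminor (M y) (insert u ?K') * pminor (M y) (insert q W) -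
      pminor (M y) (insert u W) * pminor (M y) (insert q ?K'))"
    using Suc(1)[of ?K'] by blast
  have p: "pos (\<lambda>y. pminor (M y) J)" if "J \<subseteq> {..<n}" "card J = l" for J
    using posmat_pos[OF M that] .
  have ins: "pos (\<lambda>y. pminor (M y) (insert a (insert b S)))" if "a < n" "b < n" "a \<notin> S" "b \<notin> S" "a \<noteq> b" for a b
    by (rule p) (use that S cS l2 in auto)
  have pW: "pos (\<lambda>y. pminor (M y) (insert a W))" if "a < n" "a \<notin> W" for a
    by (rule p) (use that W fin l2 in auto)
  have x_ne: "x \<noteq> q" "x \<noteq> u" "w \<noteq> q" "w \<noteq> u" using x w quW Suc.prems by auto
  have cyc: "1 < cyclic_dist n q w" "cyclic_dist n q w \<le> l" "l < cyclic_dist n q x"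
  proof -
    show "1 < cyclic_dist n q w" "cyclic_dist n q w \<le> l" using w W by auto
    have "cyclic_dist n q x \<noteq> 0" using lt q x_ne by (auto simp: cyclic_dist_if)
    moreover have "cyclic_dist n q x \<noteq> 1" using lt q x_ne u_if by (auto simp: cyclic_dist_if split: if_splits)
    ultimately show "l < cyclic_dist n q x" using x lt W by force
  qed
  \<comment> \<open>The rows \<open>q, u, w, x\<close> are in cyclic order, as \<open>w\<close> lies in the window and \<open>x\<close> beyond it.\<close>
  have rel: "pminor (M y) (insert u K) * pminor (M y) (insert q ?K') =
      pminor (M y) (insert q (insert u S)) * pminor (M y) (insert w (insert x S)) +
      pminor (M y) (insert q K) * pminor (M y) (insert u ?K')" for y
    using pminor_plucker[of S q u w x "M y" n] S(1-5) x_ne lt qu q cyc cS l2 posmat_carrier[OF M, of y]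
    by (simp add: S(6) mult.commute)
  let ?num = "\<lambda>y. pminor (M y) (insert q W) * (pminor (M y) (insert q (insert u S)) * pminor (M y) (insert w (insert x S))) +
      pminor (M y) (insert q K) * (pminor (M y) (insert u ?K') * pminor (M y) (insert q W) -
      pminor (M y) (insert u W) * pminor (M y) (insert q ?K'))"
  have "pos0 (\<lambda>y. ?num y / pminor (M y) (insert q ?K'))"
    by (intro pos0_divide pos0_add pos0_mult IH pos0I ins pW)
      (use S x_ne lt qu q quW ins[of q x] in auto)
  moreover have "\<forall>\<^sub>F y in F. pminor (M y) (insert q ?K') \<noteq> 0"
    by (rule pos_nonzero, rule ins) (use S x_ne lt q in auto)
  then have "\<forall>\<^sub>F y in F. pminor (M y) (insert u K) * pminor (M y) (insert q W) -
      pminor (M y) (insert u W) * pminor (M y) (insert q K) = ?num y / pminor (M y) (insert q ?K')"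
  proof eventually_elim
    case (elim y)
    have "(pminor (M y) (insert u K) * pminor (M y) (insert q W) -
      pminor (M y) (insert u W) * pminor (M y) (insert q K)) * pminor (M y) (insert q ?K') =
      (pminor (M y) (insert u K) * pminor (M y) (insert q ?K')) * pminor (M y) (insert q W) -
      pminor (M y) (insert u W) * pminor (M y) (insert q K) * pminor (M y) (insert q ?K')"
      by (simp add: algebra_simps)
    also have "\<dots> = ?num y" unfolding rel by (simp add: algebra_simps)
    finally show ?case using elim by (simp add: eq_divide_eq)
  qed
  ultimately show ?case by (rule pos0_cong)
qed

end

section \<open>Determinants of triangular and block triangular arrays\<close>

lemma prod_list_upt: "prod_list (map g [0..<n]) = (\<Prod>i<n. g i)" for g :: "nat \<Rightarrow> 'a::comm_monoid_mult"
  by (induction n) (simp_all add: mult.commute)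

lemma det_lower_triangular_fun:
  fixes f :: "nat \<times> nat \<Rightarrow> 'a::comm_ring_1"
  assumes "\<And>i j. i < j \<Longrightarrow> j < n \<Longrightarrow> f (i, j) = 0"
  shows "det (mat n n f) = (\<Prod>i<n. f (i, i))"
proof -
  have "det (mat n n f) = prod_list (diag_mat (mat n n f))"
    by (rule det_lower_triangular[of n]) (use assms in auto)
  also have "diag_mat (mat n n f) = map (\<lambda>i. f (i, i)) [0..<n]"
    by (auto simp: diag_mat_def)
  finally show ?thesis by (simp add: prod_list_upt)
qed

lemma det_upper_triangular_fun:
  fixes f :: "nat \<times> nat \<Rightarrow> 'a::comm_ring_1"
  assumes "\<And>i j. j < i \<Longrightarrow> i < n \<Longrightarrow> f (i, j) = 0"
  shows "det (mat n n f) = (\<Prod>i<n. f (i, i))"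
proof -
  have "det (mat n n f) = prod_list (diag_mat (mat n n f))"
    by (rule det_upper_triangular[of _ n]) (use assms in auto)
  also have "diag_mat (mat n n f) = map (\<lambda>i. f (i, i)) [0..<n]"
    by (auto simp: diag_mat_def)
  finally show ?thesis by (simp add: prod_list_upt)
qed

lemma det_block_lower_zero:
  fixes f :: "nat \<times> nat \<Rightarrow> 'a::idom"
  assumes "\<And>i j. a \<le> i \<Longrightarrow> i < a + b \<Longrightarrow> j < a \<Longrightarrow> f (i, j) = 0"
  shows "det (mat (a + b) (a + b) f) = det (mat a a f) * det (mat b b (\<lambda>(i, j). f (a + i, a + j)))"
proof -
  have "mat (a + b) (a + b) f = four_block_mat (mat a a f) (mat a b (\<lambda>(i, j). f (i, a + j)))
      (0\<^sub>m b a) (mat b b (\<lambda>(i, j). f (a + i, a + j)))"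
    by (rule eq_matI) (use assms in auto)
  then show ?thesis
    using det_four_block_mat_lower_left_zero[of "mat a a f" a "mat a b (\<lambda>(i, j). f (i, a + j))" b "0\<^sub>m b a"
        "mat b b (\<lambda>(i, j). f (a + i, a + j))"] by simp
qed

lemma det_block_upper_zero:
  fixes f :: "nat \<times> nat \<Rightarrow> 'a::idom"
  assumes "\<And>i j. i < a \<Longrightarrow> a \<le> j \<Longrightarrow> j < a + b \<Longrightarrow> f (i, j) = 0"
  shows "det (mat (a + b) (a + b) f) = det (mat a a f) * det (mat b b (\<lambda>(i, j). f (a + i, a + j)))"
proof -
  have "mat (a + b) (a + b) f = four_block_mat (mat a a f) (0\<^sub>m a b)
      (mat b a (\<lambda>(i, j). f (a + i, j))) (mat b b (\<lambda>(i, j). f (a + i, a + j)))"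
    by (rule eq_matI) (use assms in auto)
  then show ?thesis
    using det_four_block_mat_upper_right_zero[of "mat a a f" a "0\<^sub>m a b" b "mat b a (\<lambda>(i, j). f (a + i, j))"
        "mat b b (\<lambda>(i, j). f (a + i, a + j))"] by simp
qed

lemma det_zero_row:
  fixes f :: "nat \<times> nat \<Rightarrow> 'a::comm_ring_1"
  assumes "r < n" "\<And>j. j < n \<Longrightarrow> f (r, j) = 0"
  shows "det (mat n n f) = 0"
  using laplace_expansion_row[of "mat n n f" n r] assms by simp

lemma det_zero_col:
  fixes f :: "nat \<times> nat \<Rightarrow> 'a::comm_ring_1"
  assumes "c < n" "\<And>i. i < n \<Longrightarrow> f (i, c) = 0"
  shows "det (mat n n f) = 0"
  using laplace_expansion_column[of "mat n n f" n c] assms by simp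

lemma lminor_append_lower_zero:
  fixes A :: "'a::idom mat"
  assumes "\<And>i j. i \<in> set ys \<Longrightarrow> j < length xs \<Longrightarrow> A $$ (i, j) = 0"
  shows "lminor A (xs @ ys) = lminor A xs *
    det (mat (length ys) (length ys) (\<lambda>(i, j). A $$ (ys ! i, length xs + j)))"
proof -
  have "lminor A (xs @ ys) = det (mat (length xs) (length xs) (\<lambda>(i, j). A $$ ((xs @ ys) ! i, j))) *
      det (mat (length ys) (length ys) (\<lambda>(i, j). (\<lambda>(i, j). A $$ ((xs @ ys) ! i, j)) (length xs + i, length xs + j)))"
    unfolding lminor_def length_append
    by (rule det_block_lower_zero) (auto simp: nth_append intro!: assms)
  also have "mat (length xs) (length xs) (\<lambda>(i, j). A $$ ((xs @ ys) ! i, j)) =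
      mat (length xs) (length xs) (\<lambda>(i, j). A $$ (xs ! i, j))"
    by (rule eq_matI) (auto simp: nth_append)
  finally show ?thesis by (simp add: lminor_def)
qed

lemma sorted_list_of_set_append:
  assumes "finite A" "finite B" "\<And>a b. a \<in> A \<Longrightarrow> b \<in> B \<Longrightarrow> a < (b::nat)"
  shows "sorted_list_of_set (A \<union> B) = sorted_list_of_set A @ sorted_list_of_set B"
proof -
  let ?xs = "sorted_list_of_set A @ sorted_list_of_set B"
  have "sorted ?xs" "distinct ?xs" "set ?xs = A \<union> B"
    using assms by (fastforce simp: sorted_append)+
  then show ?thesis
    using sorted_list_of_set.idem_if_sorted_distinct[of ?xs] by simp
qed

section \<open>The matrix of rank \<open>l\<close> behind \<open>g\<close>\<close>

text \<open>
  At a special value of the spectral parameter, \<open>g\<close> has rank \<open>l\<close> and its columns lie in the column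
  space of \<open>M\<close>. The product of \<open>M\<close> with the following cofactors makes this visible: up to a sign above
  the diagonal, its entries are the numerators of \<open>g\<close>.
\<close>
definition window_cofactors :: "nat \<Rightarrow> nat \<Rightarrow> 'a::field mat \<Rightarrow> 'a mat" where
  "window_cofactors n l M = mat l n (\<lambda>(c, j). (-1) ^ below j (window n l j) * lcof M (sorted_list_of_set (window n l j)) c)"

definition low_rank_mat :: "nat \<Rightarrow> nat \<Rightarrow> 'a::field mat \<Rightarrow> 'a mat" where
  "low_rank_mat n l M = M * window_cofactors n l M"

lemma window_cofactors_carrier [simp]: "window_cofactors n l M \<in> carrier_mat l n"
  by (simp add: window_cofactors_def)

lemma low_rank_mat_carrier: "M \<in> carrier_mat n l \<Longrightarrow> low_rank_mat n l M \<in> carrier_mat n n"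
  by (simp add: low_rank_mat_def)

text \<open>
  For a row \<open>i\<close> above the diagonal and outside the window, the whole window lies between \<open>i\<close> and \<open>j\<close>; passing
  over it is the origin of the sign \<open>(-1)^(l-1)\<close>.
\<close>
lemma window_above:
  assumes "i < n" "j < n" "i \<notin> window n l j" "l \<le> n" "0 < l"
  shows "below i (window n l j) = (if j \<le> i then below j (window n l j) else 0)"
    "\<not> j \<le> i \<Longrightarrow> below j (window n l j) = l - 1"
proof -
  have mem: "w \<in> window n l j \<longleftrightarrow> w < n \<and> (if w \<le> j then 0 < j - w \<and> j - w < l else j + n - w < l)" for w
    using assms(2) by (auto simp: window_def cyclic_dist_if split: if_splits)
  show "below i (window n l j) = (if j \<le> i then below j (window n l j) else 0)"
  proof (cases "j \<le> i")
    case True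
    have "{w \<in> window n l j. w < i} = {w \<in> window n l j. w < j}"
      using True assms by (auto simp: mem split: if_splits)
    then show ?thesis using True by (simp add: below_def)
  next
    case False
    have "{w \<in> window n l j. w < i} = {}"
      using False assms by (auto simp: mem split: if_splits)
    then show ?thesis using False by (simp only: below_def card.empty if_False)
  qed
  assume "\<not> j \<le> i"
  then have "{w \<in> window n l j. w < j} = window n l j"
    using assms by (auto simp: mem split: if_splits)
  then show "below j (window n l j) = l - 1" using card_window[of l n j] assms by (simp add: below_def)
qed

lemma low_rank_mat_entry:
  assumes M: "M \<in> carrier_mat n l" and l: "0 < l" "l \<le> n" and ij: "i < n" "j < n"
  shows "low_rank_mat n l M $$ (i, j) =
    (if j \<le> i then 1 else (-1) ^ (l - 1)) * pminor M (insert i (window n l j))"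
proof -
  let ?W = "window n l j" and ?xs = "sorted_list_of_set (window n l j)"
  have len: "Suc (length ?xs) = l" "card ?W = l - 1" using card_window[OF l ij(2)] l by simp_all
  have "low_rank_mat n l M $$ (i, j) = (\<Sum>c<l. M $$ (i, c) * ((-1) ^ below j ?W * lcof M ?xs c))"
    using M ij by (auto simp: low_rank_mat_def window_cofactors_def scalar_prod_def lessThan_atLeast0 intro!: sum.cong)
  also have "\<dots> = (-1) ^ below j ?W * lminor M (i # ?xs)"
    unfolding lminor_Cons len by (simp add: sum_distrib_left mult.left_commute)
  finally have eq: "low_rank_mat n l M $$ (i, j) = (-1) ^ below j ?W * lminor M (i # ?xs)" .
  show ?thesis
  proof (cases "i \<in> ?W")
    case True
    then have "lminor M (i # ?xs) = 0" by (intro lminor_Cons_mem) simp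
    moreover have "pminor M (insert i ?W) = 0" by (rule pminor_mem) (use True M len in auto)
    ultimately show ?thesis using eq by simp
  next
    case False
    have "pminor M (insert i ?W) = (-1) ^ below i ?W * lminor M (i # ?xs)"
      by (rule pminor_insert) (use False M len in auto)
    then show ?thesis using eq window_above[OF ij False l(2,1)] by auto
  qed
qed

lemma low_rank_mat_zero:
  assumes M: "M \<in> carrier_mat n l" and l: "0 < l" "l \<le> n" and ij: "i < n" "j < n" and W: "i \<in> window n l j"
  shows "low_rank_mat n l M $$ (i, j) = 0"
  using low_rank_mat_entry[OF M l ij] pminor_mem[OF W, of M] card_window[OF l ij(2)] M l by simp

text \<open>
  The correction above the diagonal disappears when \<open>\<mu> (-1)^(l-1) = s\<close>.
\<close>
lemma plucker_mat_low_rank_mat: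
  assumes M: "M \<in> carrier_mat n l" and l: "0 < l" "l \<le> n" and ij: "i < n" "j < n"
  shows "plucker_mat n l s \<mu> \<delta> M $$ (i, j) =
    (s * low_rank_mat n l M $$ (i, j) + (if i < j then (\<mu> * (-1) ^ (l - 1) - s) * low_rank_mat n l M $$ (i, j) else 0)) * \<delta> j"
proof (cases "j \<le> i")
  case False
  have "((-1) ^ (l - 1) * (-1) ^ (l - 1) :: 'a) = 1" by (simp flip: power_mult_distrib)
  then have "\<mu> * ((-1) ^ (l - 1) * ((-1) ^ (l - 1) * x)) = \<mu> * x" for x :: 'a by (simp flip: mult.assoc)
  then show ?thesis using False ij by (simp add: plucker_mat_def low_rank_mat_entry[OF M l ij] algebra_simps)
qed (use ij in \<open>simp add: plucker_mat_def low_rank_mat_entry[OF M l ij]\<close>)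

definition select_cols :: "'a mat \<Rightarrow> nat list \<Rightarrow> 'a mat" where
  "select_cols A cs = mat (dim_row A) (length cs) (\<lambda>(i, j). A $$ (i, cs ! j))"

lemma select_cols_carrier [simp]: "A \<in> carrier_mat n m \<Longrightarrow> select_cols A cs \<in> carrier_mat n (length cs)"
  by (simp add: select_cols_def)

lemma select_cols_mult:
  assumes "M \<in> carrier_mat n l" "X \<in> carrier_mat l m" "set cs \<subseteq> {..<m}"
  shows "select_cols (M * X) cs = M * select_cols X cs"
proof (rule eq_matI)
  fix i j assume "i < dim_row (M * select_cols X cs)" "j < dim_col (M * select_cols X cs)"
  then have "i < n" "j < length cs" using assms by (auto simp: select_cols_def)
  moreover from this have "cs ! j < m" using assms(3) nth_mem by blast
  ultimately show "select_cols (M * X) cs $$ (i, j) = (M * select_cols X cs) $$ (i, j)"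
    using assms by (auto simp: select_cols_def scalar_prod_def intro!: sum.cong)
qed (use assms in \<open>auto simp: select_cols_def\<close>)

lemma pminor_low_rank_mat:
  assumes M: "M \<in> carrier_mat n l" and cs: "length cs = l" "set cs \<subseteq> {..<n}" and J: "J \<subseteq> {..<n}"
  shows "pminor (select_cols (low_rank_mat n l M) cs) J = pminor M J * det (select_cols (window_cofactors n l M) cs)"
  unfolding low_rank_mat_def select_cols_mult[OF M window_cofactors_carrier cs(2)]
proof (rule pminor_mult[OF M _ J])
  have "select_cols (window_cofactors n l M) cs \<in> carrier_mat l (length cs)"
    by (rule select_cols_carrier[OF window_cofactors_carrier])
  then show "select_cols (window_cofactors n l M) cs \<in> carrier_mat l l" using cs by simp
qed

lemma det_window_cofactors_first_nonzero:
  assumes M: "M \<in> carrier_mat n l" and l: "0 < l" "l \<le> n"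
    and nz: "\<And>j. j < n \<Longrightarrow> pminor M (insert j (window n l j)) \<noteq> 0"
  shows "det (select_cols (window_cofactors n l M) [0..<l]) \<noteq> 0"
proof -
  let ?D = "select_cols (low_rank_mat n l M) [0..<l]"
  have D: "?D $$ (i, j) = low_rank_mat n l M $$ (i, j)" if "i < n" "j < l" for i j
    using that low_rank_mat_carrier[OF M] by (simp add: select_cols_def)
  have "pminor ?D {0..<l} = det (mat l l (\<lambda>(i, j). ?D $$ (i, j)))"
  proof -
    have "pminor ?D {0..<l} = lminor ?D [0..<l]"
      by (simp add: pminor_def select_cols_def)
    also have "\<dots> = det (mat l l (\<lambda>(i, j). ?D $$ (i, j)))"
      unfolding lminor_def by (rule arg_cong[where f = det], rule eq_matI) auto
    finally show ?thesis .
  qed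
  also have "\<dots> = (\<Prod>i<l. ?D $$ (i, i))"
    by (subst det_lower_triangular_fun)
      (use l in \<open>auto simp: D window_def cyclic_dist_if intro!: low_rank_mat_zero[OF M l]\<close>)
  also have "\<dots> \<noteq> 0"
    using nz l by (auto simp: D low_rank_mat_entry[OF M l])
  finally have "pminor ?D {0..<l} \<noteq> 0" .
  moreover have "set [0..<l] \<subseteq> {..<n}" "{0..<l} \<subseteq> {..<n}" using l by auto
  ultimately show ?thesis using pminor_low_rank_mat[OF M, of "[0..<l]" "{0..<l}"] by auto
qed

text \<open>
  The last \<open>l - k\<close> rows lie in the windows of the first \<open>k \<le> l\<close> columns. These columns therefore span the
  subspace of the column space of \<open>M\<close> on which the last \<open>l - k\<close> coordinates vanish, and the minors
  of such a subspace are minors of \<open>M\<close> with those rows adjoined.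
\<close>
lemma minor_first_cols:
  assumes M: "M \<in> carrier_mat n l" and l: "0 < l" "l \<le> n" and k: "k \<le> l"
    and nz: "\<And>j. j < n \<Longrightarrow> pminor M (insert j (window n l j)) \<noteq> 0"
    and nzK: "pminor M ({0..<k} \<union> {n - (l - k)..<n}) \<noteq> 0"
  obtains f where "f \<noteq> 0" "\<And>J. J \<subseteq> {..<n} \<Longrightarrow> card J = k \<Longrightarrow>
    pminor (select_cols (low_rank_mat n l M) [0..<k]) J =
      (if J \<inter> {n - (l - k)..<n} = {} then f * pminor M (J \<union> {n - (l - k)..<n}) else 0)"
proof -
  let ?B = "{n - (l - k)..<n}" and ?D = "select_cols (low_rank_mat n l M) [0..<l]"
  let ?E = "select_cols (low_rank_mat n l M) [0..<k]"
  define F where "F = det (select_cols (window_cofactors n l M) [0..<l])"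
  have F: "F \<noteq> 0" unfolding F_def by (rule det_window_cofactors_first_nonzero[OF M l nz])
  have D: "?D $$ (i, j) = low_rank_mat n l M $$ (i, j)" if "i < n" "j < l" for i j
    using that low_rank_mat_carrier[OF M] by (simp add: select_cols_def)
  have E: "?E $$ (i, j) = low_rank_mat n l M $$ (i, j)" if "i < n" "j < k" for i j
    using that low_rank_mat_carrier[OF M] by (simp add: select_cols_def)
  have dE: "dim_col ?E = k" "dim_col ?D = l" by (simp_all add: select_cols_def)
  have zero: "low_rank_mat n l M $$ (i, j) = 0" if "i \<in> ?B" "j < k" for i j
    by (rule low_rank_mat_zero[OF M l]) (use that k l in \<open>auto simp: window_def cyclic_dist_if\<close>)
  define Y where "Y = det (mat (l - k) (l - k) (\<lambda>(i, j). ?D $$ ([n - (l - k)..<n] ! i, k + j)))"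
  have main: "pminor M (J \<union> ?B) * F = pminor ?E J * Y"
    if J: "J \<subseteq> {..<n}" "card J = k" "J \<inter> ?B = {}" for J
  proof -
    have fin: "finite J" using J finite_subset by blast
    have lt: "a < b" if "a \<in> J" "b \<in> ?B" for a b
      using that J by (metis IntI atLeastLessThan_iff empty_iff lessThan_iff not_le_imp_less order_less_le_trans subsetD)
    have srt: "sorted_list_of_set (J \<union> ?B) = sorted_list_of_set J @ [n - (l - k)..<n]"
      using sorted_list_of_set_append[OF fin _ lt, of ?B] by (simp add: sorted_list_of_set_range)
    have "card (J \<union> ?B) = l" using J fin k l by (simp add: card_Un_disjoint)
    then have "pminor ?D (J \<union> ?B) = lminor ?D (sorted_list_of_set J @ [n - (l - k)..<n])"
      by (simp add: pminor_def dE srt)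
    also have "\<dots> = lminor ?D (sorted_list_of_set J) * Y"
      using lminor_append_lower_zero[of "[n - (l - k)..<n]" "sorted_list_of_set J" ?D] zero k l J fin
      by (simp add: Y_def D)
    also have "lminor ?D (sorted_list_of_set J) = lminor ?E (sorted_list_of_set J)"
    proof (rule lminor_cong)
      fix i j assume "i \<in> set (sorted_list_of_set J)" "j < length (sorted_list_of_set J)"
      then have "i < n" "j < k" using J fin by auto
      then show "?D $$ (i, j) = ?E $$ (i, j)" using D E k by simp
    qed
    finally have "pminor ?D (J \<union> ?B) = pminor ?E J * Y" using J(2) by (simp add: pminor_def dE)
    moreover have "pminor ?D (J \<union> ?B) = pminor M (J \<union> ?B) * F"
      unfolding F_def by (rule pminor_low_rank_mat[OF M]) (use J l in auto)
    ultimately show ?thesis by simp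
  qed
  have K: "{0..<k} \<subseteq> {..<n}" "{0..<k} \<inter> ?B = {}" using k l by auto
  have Y: "Y \<noteq> 0"
  proof
    assume "Y = 0"
    then have "pminor M ({0..<k} \<union> ?B) * F = 0" using main[OF K(1) _ K(2)] by simp
    then show False using nzK F by simp
  qed
  show ?thesis
  proof (rule that[of "F / Y"])
    show "F / Y \<noteq> 0" using F Y by simp
    fix J assume J: "J \<subseteq> {..<n}" "card J = k"
    show "pminor ?E J = (if J \<inter> ?B = {} then F / Y * pminor M (J \<union> ?B) else 0)"
    proof (cases "J \<inter> ?B = {}")
      case True
      then show ?thesis using main[OF J True] Y by (simp add: field_simps)
    next
      case False
      have fin: "finite J" using J finite_subset by blast
      obtain i where i: "i \<in> J" "i \<in> ?B" using False by blast
      then obtain r where r: "r < k" "sorted_list_of_set J ! r = i"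
        using fin J by (metis in_set_conv_nth length_sorted_list_of_set set_sorted_list_of_set)
      have "lminor ?E (sorted_list_of_set J) = 0"
        unfolding lminor_def using J fin
        by (intro det_zero_row[of r]) (use r i zero E in auto)
      then show ?thesis using False by (simp add: pminor_def)
    qed
  qed
qed

definition diagm :: "nat \<Rightarrow> (nat \<Rightarrow> 'a::zero) \<Rightarrow> 'a mat" where
  "diagm k w = mat k k (\<lambda>(i, j). if i = j then w j else 0)"

lemma diagm_carrier [simp]: "diagm k w \<in> carrier_mat k k"
  by (simp add: diagm_def)

lemma det_diagm: "det (diagm k w) = (\<Prod>i<k. w i)" for w :: "nat \<Rightarrow> 'a::comm_ring_1"
  unfolding diagm_def by (subst det_lower_triangular_fun) auto

lemma mult_diagm:
  fixes w :: "nat \<Rightarrow> 'a::comm_ring_1"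
  assumes "A \<in> carrier_mat n k" "i < n" "j < k"
  shows "(A * diagm k w) $$ (i, j) = A $$ (i, j) * w j"
proof -
  have "(A * diagm k w) $$ (i, j) = (\<Sum>c<k. A $$ (i, c) * (if c = j then w j else 0))"
    using assms by (auto simp: scalar_prod_def diagm_def lessThan_atLeast0 intro!: sum.cong)
  also have "\<dots> = A $$ (i, j) * w j"
    using assms by (simp add: if_distrib[of "(*) _"] cong: if_cong)
  finally show ?thesis .
qed

definition frame :: "nat \<Rightarrow> nat \<Rightarrow> 'a::{zero,one} mat" where
  "frame n k = mat n k (\<lambda>(i, j). if i = j then 1 else 0)"

lemma frame_carrier [simp]: "frame n k \<in> carrier_mat n k"
  by (simp add: frame_def)

lemma mult_frame:
  fixes A :: "'a::comm_ring_1 mat"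
  assumes "A \<in> carrier_mat m n" "k \<le> n"
  shows "A * frame n k = select_cols A [0..<k]"
proof (rule eq_matI)
  fix i j assume "i < dim_row (select_cols A [0..<k])" "j < dim_col (select_cols A [0..<k])"
  then have ij: "i < m" "j < k" using assms by (auto simp: select_cols_def)
  have "(A * frame n k) $$ (i, j) = (\<Sum>c<n. A $$ (i, c) * (if c = j then 1 else 0))"
    using assms ij by (auto simp: scalar_prod_def frame_def lessThan_atLeast0 intro!: sum.cong)
  also have "\<dots> = A $$ (i, j)"
    using assms ij by (simp add: if_distrib[of "(*) _"] cong: if_cong)
  finally show "(A * frame n k) $$ (i, j) = select_cols A [0..<k] $$ (i, j)"
    using assms ij by (simp add: select_cols_def)
qed (use assms in \<open>auto simp: select_cols_def frame_def\<close>)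

lemma sum_lessThan_add: "(\<Sum>c<d + l. f c) = (\<Sum>c<d. f c) + (\<Sum>c<l. f (d + c))"
  for f :: "nat \<Rightarrow> 'a::comm_monoid_add"
  by (induction l) (simp_all add: add.assoc)

text \<open>
  Modulo the column space of \<open>M\<close>, the first \<open>l + d\<close> columns of \<open>plucker_mat\<close> are supported above the diagonal, in
  the first \<open>d\<close> rows. Away from the special value of \<open>\<mu>\<close> they span the sum of the column space of \<open>M\<close> and
  the first \<open>d\<close> coordinate lines.
\<close>
lemma minor_more_cols:
  assumes M: "M \<in> carrier_mat n l" and l: "0 < l" "l + d \<le> n"
    and nz: "\<And>j. j < n \<Longrightarrow> pminor M (insert j (window n l j)) \<noteq> 0"
    and nzV: "\<And>j. j < n \<Longrightarrow> pminor M (window n (Suc l) j) \<noteq> 0"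
    and s: "s \<noteq> 0" and \<delta>: "\<And>j. j < n \<Longrightarrow> \<delta> j \<noteq> 0" and \<nu>: "\<mu> * (-1) ^ (l - 1) - s \<noteq> 0"
  obtains f where "f \<noteq> 0" "\<And>J. J \<subseteq> {..<n} \<Longrightarrow> card J = d + l \<Longrightarrow>
    pminor (select_cols (plucker_mat n l s \<mu> \<delta> M) [0..<d + l]) J =
      (if {..<d} \<subseteq> J then f * pminor M (J - {..<d}) else 0)"
proof -
  have ln: "l \<le> n" using l by simp
  let ?k = "d + l" and ?N = "low_rank_mat n l M" and ?F = "window_cofactors n l M"
  let ?A = "select_cols (plucker_mat n l s \<mu> \<delta> M) [0..<?k]"
  define \<nu>' where "\<nu>' = \<mu> * (-1) ^ (l - 1) - s"
  define G where "G = mat n ?k (\<lambda>(i, c). if c < d then (if i = c then 1 else 0) else M $$ (i, c - d))"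
  define T where "T = mat ?k ?k (\<lambda>(c, j). if c < d then (if c < j then \<nu>' * ?N $$ (c, j) * \<delta> j else 0)
    else s * ?F $$ (c - d, j) * \<delta> j)"
  have GT: "G \<in> carrier_mat n ?k" "T \<in> carrier_mat ?k ?k" by (simp_all add: G_def T_def)
  have zero: "?N $$ (i, j) = 0" if "i < j" "j < i + l" "j < n" for i j
    by (rule low_rank_mat_zero[OF M l(1) ln]) (use that in \<open>auto simp: window_def cyclic_dist_if\<close>)
  have "?A = G * T"
  proof (rule eq_matI)
    fix i j assume "i < dim_row (G * T)" "j < dim_col (G * T)"
    then have ij: "i < n" "j < ?k" "j < n" using GT l by auto
    have "(G * T) $$ (i, j) = (\<Sum>c<?k. G $$ (i, c) * T $$ (c, j))"
      using GT ij by (auto simp: scalar_prod_def lessThan_atLeast0 intro!: sum.cong)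
    also have "\<dots> = (\<Sum>c<d. G $$ (i, c) * T $$ (c, j)) + (\<Sum>c<l. G $$ (i, d + c) * T $$ (d + c, j))"
      by (rule sum_lessThan_add)
    also have "(\<Sum>c<d. G $$ (i, c) * T $$ (c, j)) = (\<Sum>c<d. (if c = i then 1 else 0) * T $$ (c, j))"
      by (rule sum.cong) (use ij in \<open>auto simp: G_def\<close>)
    also have "\<dots> = (if i < d then T $$ (i, j) else 0)"
      by (simp add: if_distrib[of "\<lambda>x. x * _"] cong: if_cong)
    also have "\<dots> = (if i < j then \<nu>' * ?N $$ (i, j) * \<delta> j else 0)"
      using ij zero[of i j] by (auto simp: T_def)
    also have "(\<Sum>c<l. G $$ (i, d + c) * T $$ (d + c, j)) = (\<Sum>c<l. s * (M $$ (i, c) * ?F $$ (c, j)) * \<delta> j)"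
      by (rule sum.cong) (use ij in \<open>auto simp: G_def T_def\<close>)
    also have "\<dots> = s * ?N $$ (i, j) * \<delta> j"
    proof -
      have "?N $$ (i, j) = (\<Sum>c<l. M $$ (i, c) * ?F $$ (c, j))"
        using M ij by (auto simp: low_rank_mat_def scalar_prod_def lessThan_atLeast0 carrier_matD[OF window_cofactors_carrier] intro!: sum.cong)
      then show ?thesis by (simp add: sum_distrib_left sum_distrib_right)
    qed
    finally have GTij: "(G * T) $$ (i, j) = (if i < j then \<nu>' * ?N $$ (i, j) * \<delta> j else 0) + s * ?N $$ (i, j) * \<delta> j" .
    have "?A $$ (i, j) = plucker_mat n l s \<mu> \<delta> M $$ (i, j)"
      using ij by (simp add: select_cols_def carrier_matD[OF plucker_mat_carrier])
    then show "?A $$ (i, j) = (G * T) $$ (i, j)"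
      unfolding GTij plucker_mat_low_rank_mat[OF M l(1) ln ij(1) ij(3)] \<nu>'_def by (simp add: distrib_right)
  qed (use GT in \<open>auto simp: select_cols_def carrier_matD[OF plucker_mat_carrier]\<close>)
  moreover have "det T \<noteq> 0"
  proof -
    let ?f = "\<lambda>(i, j). T $$ (i, if j < d then j + l else j - d)"
    have "det T = (-1) ^ (d * l) * det (mat (d + l) (d + l) ?f)"
      by (rule det_swap_cols[OF GT(2)])
    also have "det (mat (d + l) (d + l) ?f) = det (mat d d ?f) * det (mat l l (\<lambda>(i, j). ?f (d + i, d + j)))"
      by (rule det_block_upper_zero) (use l zero in \<open>auto simp: T_def\<close>)
    also have "det (mat d d ?f) = (\<Prod>i<d. ?f (i, i))"
      by (rule det_upper_triangular_fun) (use l zero in \<open>auto simp: T_def\<close>)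
    also have "mat l l (\<lambda>(i, j). ?f (d + i, d + j)) = select_cols ?F [0..<l] * diagm l (\<lambda>j. s * \<delta> j)"
    proof (rule eq_matI)
      fix i j assume "i < dim_row (select_cols ?F [0..<l] * diagm l (\<lambda>j. s * \<delta> j))"
        "j < dim_col (select_cols ?F [0..<l] * diagm l (\<lambda>j. s * \<delta> j))"
      then have ij: "i < l" "j < l" by (auto simp: select_cols_def window_cofactors_def diagm_def)
      have "select_cols ?F [0..<l] \<in> carrier_mat l l" by (simp add: select_cols_def window_cofactors_def)
      from mult_diagm[OF this ij, of "\<lambda>j. s * \<delta> j"] ij
      show "mat l l (\<lambda>(i, j). ?f (d + i, d + j)) $$ (i, j) = (select_cols ?F [0..<l] * diagm l (\<lambda>j. s * \<delta> j)) $$ (i, j)"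
        by (simp add: T_def select_cols_def carrier_matD[OF window_cofactors_carrier])
    qed (auto simp: select_cols_def window_cofactors_def diagm_def)
    also have "det (select_cols ?F [0..<l] * diagm l (\<lambda>j. s * \<delta> j)) = det (select_cols ?F [0..<l]) * (\<Prod>j<l. s * \<delta> j)"
      by (subst det_mult[of _ l]) (simp_all add: det_diagm select_cols_def window_cofactors_def)
    finally have "det T = (-1) ^ (d * l) * ((\<Prod>i<d. ?f (i, i)) * (det (select_cols ?F [0..<l]) * (\<Prod>j<l. s * \<delta> j)))" .
    moreover have "?f (i, i) \<noteq> 0" if i: "i < d" for i
    proof -
      have "(i + l + n - l) mod n = i" using i l by simp
      then have "insert i (window n l (i + l)) = window n (Suc l) (i + l)"
        using window_Suc(1)[of l n "i + l"] i l by simp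
      then have "?N $$ (i, i + l) \<noteq> 0"
        using nzV[of "i + l"] low_rank_mat_entry[OF M l(1) ln, of i "i + l"] i l by simp
      then show ?thesis using i l \<delta>[of "i + l"] \<nu> by (simp add: T_def \<nu>'_def)
    qed
    moreover have "det (select_cols ?F [0..<l]) \<noteq> 0" by (rule det_window_cofactors_first_nonzero[OF M l(1) ln nz])
    ultimately show ?thesis using s \<delta> l by auto
  qed
  moreover have "pminor G J = (if {..<d} \<subseteq> J then pminor M (J - {..<d}) else 0)"
    if J: "J \<subseteq> {..<n}" "card J = ?k" for J
  proof (cases "{..<d} \<subseteq> J")
    case True
    let ?ys = "sorted_list_of_set (J - {..<d})"
    have fin: "finite J" using J finite_subset by blast
    have "J = {0..<d} \<union> (J - {..<d})" using True by auto
    then have srt: "sorted_list_of_set J = [0..<d] @ ?ys"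
      using sorted_list_of_set_append[of "{0..<d}" "J - {..<d}"] fin by force
    have card: "card (J - {..<d}) = l" using True J fin by (simp add: card_Diff_subset)
    have "pminor G J = lminor G ([0..<d] @ ?ys)" using J by (simp add: pminor_def srt G_def)
    also have "\<dots> = lminor G [0..<d] * det (mat l l (\<lambda>(i, j). G $$ (?ys ! i, d + j)))"
      using lminor_append_lower_zero[of ?ys "[0..<d]" G] fin J card by (force simp: G_def)
    also have "lminor G [0..<d] = det (mat d d (\<lambda>(i, j). G $$ (i, j)))"
      unfolding lminor_def by (rule arg_cong[where f = det], rule eq_matI) auto
    also have "\<dots> = 1"
      by (subst det_lower_triangular_fun) (use l in \<open>auto simp: G_def\<close>)
    also have "mat l l (\<lambda>(i, j). G $$ (?ys ! i, d + j)) = mat l l (\<lambda>(i, j). M $$ (?ys ! i, j))"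
    proof (rule eq_matI)
      fix i j assume "i < dim_row (mat l l (\<lambda>(i, j). M $$ (?ys ! i, j)))" "j < dim_col (mat l l (\<lambda>(i, j). M $$ (?ys ! i, j)))"
      then have ij: "i < l" "j < l" by auto
      then have "?ys ! i \<in> set ?ys" using card fin by (intro nth_mem) simp
      then have "?ys ! i < n" using J fin by auto
      then show "mat l l (\<lambda>(i, j). G $$ (?ys ! i, d + j)) $$ (i, j) = mat l l (\<lambda>(i, j). M $$ (?ys ! i, j)) $$ (i, j)"
        using ij by (simp add: G_def)
    qed auto
    finally show ?thesis using True card M by (simp add: pminor_def lminor_def)
  next
    case False
    then obtain c where c: "c < d" "c \<notin> J" by auto
    have fin: "finite J" using J finite_subset by blast
    have "lminor G (sorted_list_of_set J) = 0"
      unfolding lminor_def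
    proof (rule det_zero_col[of c])
      fix i assume i: "i < length (sorted_list_of_set J)"
      then have "sorted_list_of_set J ! i \<in> J" using fin by (metis nth_mem set_sorted_list_of_set)
      then show "(case (i, c) of (i, j) \<Rightarrow> G $$ (sorted_list_of_set J ! i, j)) = 0"
        using c J by (auto simp: G_def)
    qed (use c J fin in auto)
    then show ?thesis using False by (simp add: pminor_def)
  qed
  ultimately show ?thesis
    using that[of "det T"] pminor_mult[OF GT] by (simp add: mult.commute if_distrib[of "\<lambda>x. x * _"] cong: if_cong)
qed

text \<open>
  The minors of the span of the first \<open>k\<close> columns of \<open>plucker_mat\<close>, up to a common factor. For \<open>k \<le> l\<close> this is
  a subspace of the column space of \<open>M\<close>, otherwise the latter is enlarged by coordinate lines.
\<close>
definition base_minor :: "nat \<Rightarrow> nat \<Rightarrow> nat \<Rightarrow> 'a::field mat \<Rightarrow> nat set \<Rightarrow> 'a" where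
  "base_minor n l k M J =
     (if k \<le> l then if J \<inter> {n - (l - k)..<n} = {} then pminor M (J \<union> {n - (l - k)..<n}) else 0
      else if {..<k - l} \<subseteq> J then pminor M (J - {..<k - l}) else 0)"

lemma minor_plucker_mat_frame:
  assumes M: "M \<in> carrier_mat n l" and l: "0 < l" "l \<le> n" "k \<le> n"
    and nz: "\<And>J. J \<subseteq> {..<n} \<Longrightarrow> card J = l \<Longrightarrow> pminor M J \<noteq> 0" "l < n"
    and s: "s \<noteq> 0" and \<delta>: "\<And>j. j < n \<Longrightarrow> \<delta> j \<noteq> 0" and \<nu>: "\<mu> * (-1) ^ (l - 1) - s \<noteq> 0"
  obtains f where "f \<noteq> 0" "\<And>J. J \<subseteq> {..<n} \<Longrightarrow> card J = k \<Longrightarrow>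
    pminor (plucker_mat n l s \<mu> \<delta> M * frame n k) J = f * base_minor n l k M J"
proof -
  have cW: "card (window n l j) = l - 1" "card (window n (Suc l) j) = l" if "j < n" for j
    using card_window[of l n j] card_window[of "Suc l" n j] l nz that by auto
  have nz1: "pminor M (insert j (window n l j)) \<noteq> 0" if "j < n" for j
  proof (rule nz(1))
    have "j \<notin> window n l j" by (simp add: window_def cyclic_dist_def)
    then show "card (insert j (window n l j)) = l" using cW[OF that] l by simp
  qed (use that window_subset in auto)
  have nz2: "pminor M (window n (Suc l) j) \<noteq> 0" if "j < n" for j
    by (rule nz(1)[OF window_subset cW(2)[OF that]])
  have fr: "plucker_mat n l s \<mu> \<delta> M * frame n k = select_cols (plucker_mat n l s \<mu> \<delta> M) [0..<k]"
    by (rule mult_frame[OF plucker_mat_carrier l(3)])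
  show ?thesis
  proof (cases "k \<le> l")
    case True
    have "card ({0..<k} \<union> {n - (l - k)..<n}) = l"
      using True l by (subst card_Un_disjoint) auto
    then have nzK: "pminor M ({0..<k} \<union> {n - (l - k)..<n}) \<noteq> 0"
      by (intro nz(1)) (use True l in auto)
    obtain f where f: "f \<noteq> 0" "\<And>J. J \<subseteq> {..<n} \<Longrightarrow> card J = k \<Longrightarrow>
      pminor (select_cols (low_rank_mat n l M) [0..<k]) J =
      (if J \<inter> {n - (l - k)..<n} = {} then f * pminor M (J \<union> {n - (l - k)..<n}) else 0)"
      by (rule minor_first_cols[OF M l(1,2) True nz1 nzK]) (assumption | rule that)+
    have E: "select_cols (low_rank_mat n l M) [0..<k] \<in> carrier_mat n k"
      using low_rank_mat_carrier[OF M] by (simp add: select_cols_def)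
    have "select_cols (plucker_mat n l s \<mu> \<delta> M) [0..<k] = select_cols (low_rank_mat n l M) [0..<k] * diagm k (\<lambda>j. s * \<delta> j)"
    proof (rule eq_matI)
      fix i j assume "i < dim_row (select_cols (low_rank_mat n l M) [0..<k] * diagm k (\<lambda>j. s * \<delta> j))"
        "j < dim_col (select_cols (low_rank_mat n l M) [0..<k] * diagm k (\<lambda>j. s * \<delta> j))"
      then have ij: "i < n" "j < k" "j < n" using E l by (auto simp: diagm_def)
      have "i < j \<Longrightarrow> low_rank_mat n l M $$ (i, j) = 0"
        by (rule low_rank_mat_zero[OF M l(1,2)]) (use ij True in \<open>auto simp: window_def cyclic_dist_if\<close>)
      then have "plucker_mat n l s \<mu> \<delta> M $$ (i, j) = low_rank_mat n l M $$ (i, j) * (s * \<delta> j)"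
        unfolding plucker_mat_low_rank_mat[OF M l(1,2) ij(1,3)] by simp
      then show "select_cols (plucker_mat n l s \<mu> \<delta> M) [0..<k] $$ (i, j) =
          (select_cols (low_rank_mat n l M) [0..<k] * diagm k (\<lambda>j. s * \<delta> j)) $$ (i, j)"
        unfolding mult_diagm[OF E ij(1,2)]
        using ij low_rank_mat_carrier[OF M] by (simp add: select_cols_def carrier_matD[OF plucker_mat_carrier])
    qed (use E in \<open>auto simp: select_cols_def diagm_def carrier_matD[OF plucker_mat_carrier] low_rank_mat_carrier[OF M]\<close>)
    then have eq: "plucker_mat n l s \<mu> \<delta> M * frame n k = select_cols (low_rank_mat n l M) [0..<k] * diagm k (\<lambda>j. s * \<delta> j)"
      using fr by simp
    have "(\<Prod>j<k. s * \<delta> j) * f \<noteq> 0" using s \<delta> f l by auto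
    moreover have "pminor (plucker_mat n l s \<mu> \<delta> M * frame n k) J = (\<Prod>j<k. s * \<delta> j) * f * base_minor n l k M J"
      if J: "J \<subseteq> {..<n}" "card J = k" for J
      unfolding eq pminor_mult[OF E diagm_carrier J(1)] f(2)[OF J] det_diagm
      using True by (simp add: base_minor_def mult_ac)
    ultimately show ?thesis using that by blast
  next
    case False
    define d where "d = k - l"
    have k: "k = d + l" "l + d \<le> n" using False l by (auto simp: d_def)
    obtain f where f: "f \<noteq> 0" "\<And>J. J \<subseteq> {..<n} \<Longrightarrow> card J = d + l \<Longrightarrow>
      pminor (select_cols (plucker_mat n l s \<mu> \<delta> M) [0..<d + l]) J =
      (if {..<d} \<subseteq> J then f * pminor M (J - {..<d}) else 0)"
      by (rule minor_more_cols[OF M l(1) k(2) nz1 nz2 s \<delta> \<nu>]) (assumption | rule that)+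
    show ?thesis
      by (rule that[OF f(1)]) (use fr f(2) k False in \<open>auto simp: base_minor_def\<close>)
  qed
qed

section \<open>Multiplying a positive subspace by \<open>g\<close>\<close>

context positive_functions
begin

text \<open>
  The data that \<open>plucker_mat_commute\<close> produces are positive again. After clearing the
  denominator, a minor of the new \<open>M'\<close> that contains \<open>u\<close> but not \<open>q\<close> is a positive term plus a multiple of
  the difference in \<open>window_ratio_minimal\<close>.
\<close>
lemma mutation:
  assumes M: "posmat n l M" and l: "0 < l" "l < n" and j: "Suc j < n"
    and q: "q = (j + n - l) mod n" and u: "u = Suc q mod n"
    and s: "pos s" and \<delta>: "\<And>i. pos (\<lambda>x. \<delta> x i)" and \<epsilon>: "pos \<epsilon>"
  obtains a \<gamma> M' where "pos a" "pos \<gamma>" "posmat n l M'"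
    "\<forall>\<^sub>F x in F. \<forall>N k. N \<in> carrier_mat n k \<longrightarrow>
      plucker_mat n l (s x) (\<mu> x) (\<delta> x) (M x) * addrow (\<epsilon> x) (Suc j) j N =
      addrow (a x * (if Suc q = n then \<mu> x / s x else 1)) u q
        (plucker_mat n l (s x) (\<mu> x) ((\<delta> x)(j := \<delta> x j * \<gamma> x)) (M' x) * N)"
proof -
  have jn: "j < n" using j by simp
  have qe: "q = (if j < l then j + n - l else j - l)"
    unfolding q by (rule shift_mod) (use l jn in auto)
  have qn: "q < n" unfolding q using j by simp
  have u_if: "u = (if Suc q = n then 0 else Suc q)" unfolding u using qn by simp
  have ue: "u = (Suc j + n - l) mod n"
    using shift_mod[of l n "Suc j"] l j u_if qe by auto
  have un: "u < n" "u \<noteq> q" using u_if qn j by auto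
  define W where "W = window n l (Suc j)"
  have W: "W = {w. w < n \<and> 1 < cyclic_dist n q w \<and> cyclic_dist n q w \<le> l}" "card W = l - 1"
  proof -
    show "W = {w. w < n \<and> 1 < cyclic_dist n q w \<and> cyclic_dist n q w \<le> l}"
      unfolding W_def window_def qe using l j by (auto simp: cyclic_dist_if split: if_splits)
    show "card W = l - 1" unfolding W_def by (rule card_window) (use l j in auto)
  qed
  have fin: "finite W" "W \<subseteq> {..<n}" using W by auto
  have notin: "q \<notin> window n l j" "u \<notin> W" "q \<notin> W"
  proof -
    show "q \<notin> window n l j" unfolding q by (rule window_Suc(2)[OF l jn])
    show "u \<notin> W" unfolding ue W_def by (rule window_Suc(2)[OF l j])
    show "q \<notin> W" unfolding W(1) by (simp add: cyclic_dist_def)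
  qed
  define PV where "PV = (\<lambda>x. pminor (M x) (insert q (window n l j)))"
  define PQ where "PQ = (\<lambda>x. pminor (M x) (insert q W))"
  define PU where "PU = (\<lambda>x. pminor (M x) (insert u W))"
  define \<kappa> where "\<kappa> = (\<lambda>x. \<epsilon> x * \<delta> x (Suc j) / \<delta> x j)"
  have "pos PV" unfolding PV_def
    by (rule posmat_pos[OF M]) (use qn window_subset notin card_window[of l n j] l jn in auto)
  moreover have "pos PQ" "pos PU" unfolding PQ_def PU_def
    by (rule posmat_pos[OF M]; use qn un fin notin W l in auto)+
  moreover have "pos \<kappa>" unfolding \<kappa>_def
    by (intro pos_divide pos_mult \<epsilon> \<delta>)
  ultimately have pos: "pos PV" "pos PQ" "pos PU" "pos \<kappa>" by auto
  define den where "den = (\<lambda>x. PV x + \<kappa> x * PQ x)"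
  have den: "pos den" unfolding den_def by (intro pos_add pos_mult pos)
  define a where "a = (\<lambda>x. \<kappa> x * PU x / den x)"
  define \<gamma> where "\<gamma> = (\<lambda>x. 1 + \<kappa> x * PQ x / PV x)"
  define M' where "M' = (\<lambda>x. addrow (- a x * rot_sign n l q) u q (M x))"
  have a: "pos a" unfolding a_def by (intro pos_divide pos_mult pos den)
  have \<gamma>: "pos \<gamma>" unfolding \<gamma>_def by (intro pos_divide pos_mult pos_add pos_one pos)
  have "posmat n l M'"
    unfolding posmat_def
  proof (intro conjI allI impI)
    show "M' x \<in> carrier_mat n l" for x using posmat_carrier[OF M, of x] by (simp add: M'_def)
    fix J assume J: "J \<subseteq> {..<n}" "card J = l"
    have finJ: "finite J" using J finite_subset by blast
    have e: "pminor (M' x) J = pminor (M x) J - (if u \<in> J \<and> q \<notin> J then a x * pminor (M x) (insert q (J - {u})) else 0)" for x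
      unfolding M'_def
      using pminor_addrow_cyclic[OF posmat_carrier[OF M] J(1) qn u, of "- a x"] j by auto
    show "pos (\<lambda>x. pminor (M' x) J)"
    proof (cases "u \<in> J \<and> q \<notin> J")
      case False
      then show ?thesis using posmat_pos[OF M J] by (simp only: e if_not_P[OF False] if_False diff_zero)
    next
      case True
      define K where "K = J - {u}"
      have K: "K \<subseteq> {..<n}" "u \<notin> K" "q \<notin> K" "card K = l - 1" and JK: "J = insert u K"
        using True J finJ by (auto simp: K_def)
      let ?D = "\<lambda>x. pminor (M x) (insert u K) * pminor (M x) (insert q W) -
        pminor (M x) (insert u W) * pminor (M x) (insert q K)"
      have D: "pos0 ?D"
        by (rule window_ratio_minimal[OF M l qn u W K])
      have "pos (\<lambda>x. (pminor (M x) J * PV x + \<kappa> x * ?D x) / den x)"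
        by (intro pos_divide pos_add_pos0 pos_mult pos0_mult pos0I[OF pos(4)] D den pos posmat_pos[OF M J])
      moreover have "\<forall>\<^sub>F x in F. pminor (M' x) J = (pminor (M x) J * PV x + \<kappa> x * ?D x) / den x"
        using pos_nonzero[OF den]
      proof eventually_elim
        case (elim x)
        have "pminor (M' x) J = pminor (M x) J - a x * pminor (M x) (insert q K)"
          unfolding e K_def if_P[OF True] ..
        then have "pminor (M' x) J = pminor (M x) (insert u K) - \<kappa> x * PU x / den x * pminor (M x) (insert q K)"
          unfolding a_def JK .
        moreover have "(p - \<kappa> x * PU x / den x * r) = (p * den x - \<kappa> x * PU x * r) / den x" for p r
          using elim by (simp add: field_simps)
        moreover have "p * den x - \<kappa> x * PU x * r = p * PV x + \<kappa> x * (p * PQ x - PU x * r)" for p r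
          by (simp add: den_def algebra_simps)
        ultimately show ?case by (simp add: JK PQ_def PU_def)
      qed
      ultimately show ?thesis by (rule pos_cong)
    qed
  qed
  moreover have "\<forall>\<^sub>F x in F. \<forall>N k. N \<in> carrier_mat n k \<longrightarrow>
      plucker_mat n l (s x) (\<mu> x) (\<delta> x) (M x) * addrow (\<epsilon> x) (Suc j) j N =
      addrow (a x * (if Suc q = n then \<mu> x / s x else 1)) u q
        (plucker_mat n l (s x) (\<mu> x) ((\<delta> x)(j := \<delta> x j * \<gamma> x)) (M' x) * N)"
    using pos_nonzero[OF s] pos_nonzero[OF \<delta>[of j]] pos_nonzero[OF pos(1)] pos_nonzero[OF den]
  proof eventually_elim
    case (elim x)
    show ?case
    proof (intro allI impI)
      fix N :: "complex mat" and k assume N: "N \<in> carrier_mat n k"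
      show "plucker_mat n l (s x) (\<mu> x) (\<delta> x) (M x) * addrow (\<epsilon> x) (Suc j) j N =
        addrow (a x * (if Suc q = n then \<mu> x / s x else 1)) u q
          (plucker_mat n l (s x) (\<mu> x) ((\<delta> x)(j := \<delta> x j * \<gamma> x)) (M' x) * N)"
        by (rule plucker_mat_commute[where \<delta> = "\<delta> x" and PV = "PV x" and PQ = "PQ x" and PU = "PU x"
              and \<kappa> = "\<kappa> x" and \<epsilon> = "\<epsilon> x", OF posmat_carrier[OF M] l j q u elim(1,2)])
          (use N elim in \<open>simp_all add: \<kappa>_def PV_def PQ_def PU_def den_def a_def M'_def \<gamma>_def W_def\<close>)
    qed
  qed
  ultimately show ?thesis using that a \<gamma> by blast
qed

text \<open>
  Matrices obtained from the coordinate frame by positive row operations of the two kinds that make up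
  the parametrization. The set \<open>R\<close> records row sets whose minor is positive for the reason that a
  chain of such operations leads to it.
\<close>
inductive built :: "nat \<Rightarrow> nat \<Rightarrow> nat set set \<Rightarrow> ('x \<Rightarrow> complex mat) \<Rightarrow> bool" for n k where
  frame: "built n k {{..<k}} (\<lambda>x. frame n k)"
| add: "built n k R N \<Longrightarrow> pos \<epsilon> \<Longrightarrow> Suc j < n \<Longrightarrow>
    built n k (R \<union> {J. Suc j \<in> J \<and> j \<notin> J \<and> insert j (J - {Suc j}) \<in> R})
      (\<lambda>x. addrow (\<epsilon> x) (Suc j) j (N x))"
| scale: "built n k R N \<Longrightarrow> pos z \<Longrightarrow> p < n \<Longrightarrow> built n k R (\<lambda>x. multrow p (z x) (N x))"

lemma built_carrier: "built n k R N \<Longrightarrow> N x \<in> carrier_mat n k"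
  by (induction rule: built.induct) auto

lemma pminor_frame:
  assumes J: "J \<subseteq> {..<n}" "card J = k" "k \<le> n"
  shows "pminor (frame n k :: complex mat) J = (if J = {..<k} then 1 else 0)"
proof (cases "J = {..<k}")
  case True
  have "pminor (frame n k :: complex mat) {0..<k} = det (mat k k (\<lambda>(i, j). frame n k $$ ([0..<k] ! i, j)))"
    by (simp add: pminor_def lminor_def frame_def)
  also have "\<dots> = 1"
    by (subst det_lower_triangular_fun) (use J in \<open>auto simp: frame_def\<close>)
  finally show ?thesis using True by (simp add: lessThan_atLeast0)
next
  case False
  have fin: "finite J" using J finite_subset by blast
  have "\<not> J \<subseteq> {..<k}" using False J fin card_subset_eq[of "{..<k}" J] by auto
  then obtain i where i: "i \<in> J" "k \<le> i" by (meson lessThan_iff not_le_imp_less subsetI)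
  then obtain r where r: "r < k" "sorted_list_of_set J ! r = i"
    using fin J by (metis in_set_conv_nth length_sorted_list_of_set set_sorted_list_of_set)
  have "lminor (frame n k :: complex mat) (sorted_list_of_set J) = 0"
    unfolding lminor_def
    by (rule det_zero_row[of r]) (use r i J fin in \<open>auto simp: frame_def\<close>)
  then show ?thesis using False by (simp add: pminor_def)
qed

lemma built_minors:
  assumes "built n k R N" "k \<le> n" "J \<subseteq> {..<n}" "card J = k"
  shows "pos0 (\<lambda>x. pminor (N x) J) \<and> (J \<in> R \<longrightarrow> pos (\<lambda>x. pminor (N x) J))"
  using assms
proof (induction arbitrary: J rule: built.induct)
  case frame
  then show ?case by (auto simp: pminor_frame pos_one pos0_zero pos0I)
next
  case (add R N \<epsilon> j)
  let ?K = "insert j (J - {Suc j})"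
  have fin: "finite J" using add.prems finite_subset by blast
  have e: "pminor (addrow (\<epsilon> x) (Suc j) j (N x)) J = pminor (N x) J +
      (if Suc j \<in> J \<and> j \<notin> J then \<epsilon> x * pminor (N x) ?K else 0)" for x
    using pminor_addrow_cyclic[OF built_carrier[OF add.hyps(1)] add.prems(2), of j "Suc j" "\<epsilon> x"] add.hyps(3)
    by (simp add: rot_sign_def)
  have IH: "pos0 (\<lambda>x. pminor (N x) J)" "J \<in> R \<Longrightarrow> pos (\<lambda>x. pminor (N x) J)"
    using add.IH[OF add.prems] by auto
  show ?case
  proof (cases "Suc j \<in> J \<and> j \<notin> J")
    case False
    then show ?thesis using IH by (auto simp: e)
  next
    case True
    have "?K \<subseteq> {..<n}" "card ?K = k"
      using True add.prems add.hyps fin card_Suc_Diff1[of J "Suc j"] by auto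
    note IH' = add.IH[OF add.prems(1) this]
    have "pos0 (\<lambda>x. pminor (N x) J + \<epsilon> x * pminor (N x) ?K)"
      using IH IH' by (intro pos0_add pos0_mult pos0I[OF add.hyps(2)]) auto
    moreover have "pos (\<lambda>x. pminor (N x) J + \<epsilon> x * pminor (N x) ?K)" if "J \<in> R"
      using IH IH' that by (intro pos_add_pos0 pos0_mult pos0I[OF add.hyps(2)]) auto
    moreover have "pos (\<lambda>x. pminor (N x) J + \<epsilon> x * pminor (N x) ?K)" if "?K \<in> R"
      using IH IH' that by (intro pos0_add_pos pos_mult add.hyps(2)) auto
    ultimately show ?thesis using True by (auto simp: e)
  qed
next
  case (scale R N z p)
  have "pminor (multrow p (z x) (N x)) J = (if p \<in> J then z x else 1) * pminor (N x) J" for x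
    by (rule pminor_multrow[OF built_carrier[OF scale.hyps(1)]]) (use scale in auto)
  then show ?case using scale.IH[OF scale.prems] scale.hyps(2)
    by (cases "p \<in> J") (auto intro: pos_mult pos0_mult pos0I)
qed

lemma plucker_mat_multrow:
  assumes "N \<in> carrier_mat n k" "p < n"
  shows "plucker_mat n l s \<mu> \<delta> M * multrow p z N = plucker_mat n l s \<mu> (\<delta>(p := \<delta> p * z)) M * (N :: complex mat)"
proof (rule eq_matI)
  fix i c assume "i < dim_row (plucker_mat n l s \<mu> (\<delta>(p := \<delta> p * z)) M * N)"
    "c < dim_col (plucker_mat n l s \<mu> (\<delta>(p := \<delta> p * z)) M * N)"
  then have "i < n" "c < k" using assms plucker_mat_carrier[of n l s \<mu> "\<delta>(p := \<delta> p * z)" M] by auto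
  then show "(plucker_mat n l s \<mu> \<delta> M * multrow p z N) $$ (i, c) = (plucker_mat n l s \<mu> (\<delta>(p := \<delta> p * z)) M * N) $$ (i, c)"
    using assms by (auto simp: scalar_prod_def plucker_mat_def intro!: sum.cong)
qed (use assms in \<open>auto simp: carrier_matD[OF plucker_mat_carrier]\<close>)

text \<open>
  The row operations building \<open>N\<close> can be moved one after the other through the matrix of \<open>M\<close>; each
  of them changes \<open>M\<close> into another positive matrix and becomes a row operation whose effect on
  minors of size \<open>k\<close> is positive: the factor \<open>(-1)^(k-1)\<close> in \<open>\<mu>\<close> is cancelled by the sign of
  moving the last row to the front. In the end only the frame is left.

  The operation that adds row \<open>j\<close> of \<open>N\<close> to the next comes out as one that adds row \<open>q\<close> to the next, where
  \<open>q + l\<close> and \<open>j\<close> agree modulo \<open>n\<close>. So the chain of operations that reaches the shifted row set in \<open>N\<close>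
  reaches \<open>J\<close> in the product.
\<close>
lemma plucker_mat_built:
  assumes N: "built n k R N" and k: "k \<le> n" and l: "0 < l" "l < n" and s: "pos s" and t: "pos t"
    and \<mu>: "\<And>x. \<mu> x = (-1) ^ (k - 1) * t x"
    and \<nu>: "\<forall>\<^sub>F x in F. \<mu> x * (-1) ^ (l - 1) - s x \<noteq> 0"
    and M: "posmat n l M" and \<delta>: "\<And>i. pos (\<lambda>x. \<delta> x i)"
  shows "\<exists>\<kappa> h. (\<forall>\<^sub>F x in F. \<kappa> x \<noteq> 0) \<and>
    (\<forall>J. J \<subseteq> {..<n} \<longrightarrow> card J = k \<longrightarrow>
      pos0 (h J) \<and> ((\<lambda>i. (i + l) mod n) ` J \<in> R \<longrightarrow> pos (h J)) \<and>
      (\<forall>\<^sub>F x in F. pminor (plucker_mat n l (s x) (\<mu> x) (\<delta> x) (M x) * N x) J = \<kappa> x * h J x))"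
  using N M \<delta>
proof (induction arbitrary: M \<delta> rule: built.induct)
  case frame
  have finite_all: "\<forall>\<^sub>F x in F. \<forall>J\<in>{J. J \<subseteq> {..<n} \<and> card J = l}. pminor (M x) J \<noteq> 0"
    by (rule eventually_ball_finite) (use pos_nonzero[OF posmat_pos[OF frame(1)]] in auto)
  have "\<forall>\<^sub>F x in F. \<forall>i\<in>{..<n}. \<delta> x i \<noteq> 0"
    by (rule eventually_ball_finite) (use pos_nonzero[OF frame(2)] in auto)
  with finite_all pos_nonzero[OF s] \<nu>
  have "\<forall>\<^sub>F x in F. \<exists>f. f \<noteq> 0 \<and> (\<forall>J. J \<subseteq> {..<n} \<longrightarrow> card J = k \<longrightarrow>
    pminor (plucker_mat n l (s x) (\<mu> x) (\<delta> x) (M x) * frame n k) J = f * base_minor n l k (M x) J)"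
  proof eventually_elim
    case (elim x)
    have *: "l \<le> n" "\<And>J. J \<subseteq> {..<n} \<Longrightarrow> card J = l \<Longrightarrow> pminor (M x) J \<noteq> 0" "\<And>j. j < n \<Longrightarrow> \<delta> x j \<noteq> 0"
      using elim l by auto
    obtain f where "f \<noteq> 0" "\<And>J. J \<subseteq> {..<n} \<Longrightarrow> card J = k \<Longrightarrow>
        pminor (plucker_mat n l (s x) (\<mu> x) (\<delta> x) (M x) * frame n k) J = f * base_minor n l k (M x) J"
      by (rule minor_plucker_mat_frame[OF posmat_carrier[OF frame(1), of x] l(1) *(1) k *(2) l(2) elim(2) *(3) elim(3)])
        (assumption | rule that)+
    then show ?case by blast
  qed
  then obtain \<kappa> where \<kappa>: "\<forall>\<^sub>F x in F. \<kappa> x \<noteq> 0 \<and> (\<forall>J. J \<subseteq> {..<n} \<longrightarrow> card J = k \<longrightarrow>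
    pminor (plucker_mat n l (s x) (\<mu> x) (\<delta> x) (M x) * frame n k) J = \<kappa> x * base_minor n l k (M x) J)"
    unfolding eventually_ex by blast
  have 1: "pos0 (\<lambda>x. base_minor n l k (M x) J) \<and>
      ((\<lambda>i. (i + l) mod n) ` J = {..<k} \<longrightarrow> pos (\<lambda>x. base_minor n l k (M x) J))"
    if J: "J \<subseteq> {..<n}" "card J = k" for J
  proof -
    have fin: "finite J" using J finite_subset by blast
    show ?thesis
    proof (cases "k \<le> l")
      case kl: True
      let ?B = "{n - (l - k)..<n}"
      have p: "pos (\<lambda>x. pminor (M x) (J \<union> ?B))" if "J \<inter> ?B = {}"
        by (rule posmat_pos[OF frame(1)]) (use J fin kl l that in \<open>auto simp: card_Un_disjoint\<close>)
      have "J \<inter> ?B = {}" if "(\<lambda>i. (i + l) mod n) ` J = {..<k}"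
      proof (rule ccontr)
        assume "J \<inter> ?B \<noteq> {}"
        then obtain i where "i \<in> J" "i \<in> ?B" by blast
        then have i: "i \<in> J" "n - (l - k) \<le> i" "i < n" by simp_all
        then have "(i + l) mod n < k" using that by blast
        moreover have "(i + l) mod n = i + l - n"
          using i l kl by (simp add: mod_nat_eqI le_mod_geq)
        ultimately show False using i kl l by linarith
      qed
      then have disj: "J \<inter> ?B \<noteq> {} \<Longrightarrow> (\<lambda>i. (i + l) mod n) ` J \<noteq> {..<k}" by blast
      have bm: "base_minor n l k (M x) J = (if J \<inter> ?B = {} then pminor (M x) (J \<union> ?B) else 0)" for x
        unfolding base_minor_def if_P[OF kl] ..
      show ?thesis
      proof (cases "J \<inter> ?B = {}")
        case True
        show ?thesis unfolding bm if_P[OF True] using p[OF True] pos0I by blast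
      next
        case False
        show ?thesis unfolding bm if_not_P[OF False] using disj[OF False] pos0_zero by blast
      qed
    next
      case kl: False
      have p: "pos (\<lambda>x. pminor (M x) (J - {..<k - l}))" if "{..<k - l} \<subseteq> J"
        by (rule posmat_pos[OF frame(1)]) (use J fin kl that in \<open>auto simp: card_Diff_subset\<close>)
      have "{..<k - l} \<subseteq> J" if eq: "(\<lambda>i. (i + l) mod n) ` J = {..<k}"
      proof
        fix i assume i: "i \<in> {..<k - l}"
        then have "i + l \<in> (\<lambda>i. (i + l) mod n) ` J" unfolding eq by auto
        then obtain i' where i': "i' \<in> J" "(i' + l) mod n = i + l" by auto
        have "i' < n" using i' J by auto
        have "i' + l < n"
        proof (rule ccontr)
          assume "\<not> i' + l < n"
          then have "(i' + l) mod n = i' + l - n"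
            using \<open>i' < n\<close> l by (simp add: le_mod_geq)
          then show False using i' \<open>i' < n\<close> \<open>\<not> i' + l < n\<close> by linarith
        qed
        then show "i \<in> J" using i' by simp
      qed
      then have sub: "\<not> {..<k - l} \<subseteq> J \<Longrightarrow> (\<lambda>i. (i + l) mod n) ` J \<noteq> {..<k}" by blast
      have bm: "base_minor n l k (M x) J = (if {..<k - l} \<subseteq> J then pminor (M x) (J - {..<k - l}) else 0)" for x
        unfolding base_minor_def if_not_P[OF kl] ..
      show ?thesis
      proof (cases "{..<k - l} \<subseteq> J")
        case True
        show ?thesis unfolding bm if_P[OF True] using p[OF True] pos0I by blast
      next
        case False
        show ?thesis unfolding bm if_not_P[OF False] using sub[OF False] pos0_zero by blast
      qed
    qed
  qed
  show ?case
    by (rule exI[of _ \<kappa>], rule exI[of _ "\<lambda>J x. base_minor n l k (M x) J"])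
      (use \<kappa> 1 in \<open>auto elim!: eventually_mono\<close>)
next
  case (add R N \<epsilon> j)
  define q where "q = (j + n - l) mod n"
  define u where "u = Suc q mod n"
  obtain a \<gamma> M' where a: "pos a" and \<gamma>: "pos \<gamma>" and M': "posmat n l M'"
    and comm: "\<forall>\<^sub>F x in F. \<forall>N k. N \<in> carrier_mat n k \<longrightarrow>
      plucker_mat n l (s x) (\<mu> x) (\<delta> x) (M x) * addrow (\<epsilon> x) (Suc j) j N =
      addrow (a x * (if Suc q = n then \<mu> x / s x else 1)) u q
        (plucker_mat n l (s x) (\<mu> x) ((\<delta> x)(j := \<delta> x j * \<gamma> x)) (M' x) * N)"
    by (rule mutation[OF add.prems(1) l add.hyps(3) q_def u_def s add.prems(2) add.hyps(2)]) (rule that)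
  define \<delta>' where "\<delta>' = (\<lambda>x. (\<delta> x)(j := \<delta> x j * \<gamma> x))"
  have "pos (\<lambda>x. \<delta>' x i)" for i
    unfolding \<delta>'_def using add.prems(2) by (cases "i = j") (auto intro: pos_mult \<gamma>)
  from add.IH[where \<delta> = \<delta>', OF M' this] obtain \<kappa> h where \<kappa>h: "(\<forall>\<^sub>F x in F. \<kappa> x \<noteq> 0) \<and>
    (\<forall>J. J \<subseteq> {..<n} \<longrightarrow> card J = k \<longrightarrow>
      pos0 (h J) \<and> ((\<lambda>i. (i + l) mod n) ` J \<in> R \<longrightarrow> pos (h J)) \<and>
      (\<forall>\<^sub>F x in F. pminor (plucker_mat n l (s x) (\<mu> x) (\<delta>' x) (M' x) * N x) J = \<kappa> x * h J x))"
    by (elim exE) (rule that)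
  note \<kappa> = conjunct1[OF \<kappa>h] and h = conjunct2[OF \<kappa>h, rule_format]
  define \<alpha> where "\<alpha> = (\<lambda>x. a x * (if Suc q = n then t x / s x else 1))"
  have \<alpha>: "pos \<alpha>" unfolding \<alpha>_def using pos_mult[OF a pos_divide[OF t s]] a by (cases "Suc q = n") auto
  have qn: "q < n" "u < n" "2 \<le> n" unfolding q_def u_def using add.hyps(3) by auto
  have u_if: "u = (if Suc q = n then 0 else Suc q)" unfolding u_def using qn by simp
  have uq: "u \<noteq> q" using u_if qn by auto
  \<comment> \<open>This is where the two signs cancel.\<close>
  have coef: "a x * (if Suc q = n then \<mu> x / s x else 1) = \<alpha> x * rot_sign n k q" for x
    by (simp add: \<alpha>_def \<mu> rot_sign_def)
  let ?\<sigma> = "\<lambda>i. (i + l) mod n"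
  have \<sigma>q: "?\<sigma> q = j" "?\<sigma> u = Suc j"
  proof -
    have "j + n - l + l = j + n" using l by simp
    then show sq: "?\<sigma> q = j" unfolding q_def using add.hyps(3) by (simp add: mod_add_left_eq)
    have "?\<sigma> u = Suc (q + l) mod n" unfolding u_def by (simp add: mod_add_left_eq)
    also have "\<dots> = Suc (?\<sigma> q) mod n" by (simp add: mod_Suc_eq)
    finally show "?\<sigma> u = Suc j" using sq add.hyps(3) by simp
  qed
  have \<sigma>_inj: "i = i'" if "?\<sigma> i = ?\<sigma> i'" "i < n" "i' < n" for i i'
  proof -
    have "?\<sigma> i = (if i + l < n then i + l else i + l - n)" if "i < n" for i
      using that l by (simp add: le_mod_geq)
    then show ?thesis using that l by (simp split: if_splits)
  qed
  define h' where "h' = (\<lambda>J x. h J x + (if u \<in> J \<and> q \<notin> J then \<alpha> x * h (insert q (J - {u})) x else 0))"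
  have main: "pos0 (h' J) \<and> (?\<sigma> ` J \<in> R \<union> {J. Suc j \<in> J \<and> j \<notin> J \<and> insert j (J - {Suc j}) \<in> R} \<longrightarrow> pos (h' J)) \<and>
      (\<forall>\<^sub>F x in F. pminor (plucker_mat n l (s x) (\<mu> x) (\<delta> x) (M x) * addrow (\<epsilon> x) (Suc j) j (N x)) J = \<kappa> x * h' J x)"
    if J: "J \<subseteq> {..<n}" "card J = k" for J
  proof -
    have fin: "finite J" using J finite_subset by blast
    have mem: "u \<in> J \<longleftrightarrow> Suc j \<in> ?\<sigma> ` J" "q \<in> J \<longleftrightarrow> j \<in> ?\<sigma> ` J"
    proof -
      have "w \<in> J \<longleftrightarrow> ?\<sigma> w \<in> ?\<sigma> ` J" if "w < n" for w
      proof
        assume "?\<sigma> w \<in> ?\<sigma> ` J"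
        then obtain i where "i \<in> J" "?\<sigma> w = ?\<sigma> i" by blast
        then show "w \<in> J" using \<sigma>_inj[of w i] that J by auto
      qed (rule imageI)
      from this[OF qn(2)] this[OF qn(1)]
      show "u \<in> J \<longleftrightarrow> Suc j \<in> ?\<sigma> ` J" "q \<in> J \<longleftrightarrow> j \<in> ?\<sigma> ` J" unfolding \<sigma>q .
    qed
    let ?K = "insert q (J - {u})"
    have img: "?\<sigma> ` ?K = insert j (?\<sigma> ` J - {Suc j})"
    proof -
      have "?\<sigma> ` (J - {u}) = ?\<sigma> ` J - {Suc j}"
      proof -
        have inj: "inj_on ?\<sigma> {..<n}"
        proof (rule inj_onI)
          fix w w' assume "w \<in> {..<n}" "w' \<in> {..<n}" "?\<sigma> w = ?\<sigma> w'"
          then show "w = w'" using \<sigma>_inj[of w w'] by simp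
        qed
        have sub: "J - {u} \<subseteq> {..<n}" "{u} \<subseteq> {..<n}" using J qn by auto
        show ?thesis unfolding inj_on_image_set_diff[OF inj sub] image_insert image_empty \<sigma>q ..
      qed
      then show ?thesis using \<sigma>q by simp
    qed
    have K: "?K \<subseteq> {..<n}" "card ?K = k" if "u \<in> J" "q \<notin> J"
      using that J qn fin uq card_Suc_Diff1[of J u] by auto
    have ev: "\<forall>\<^sub>F x in F. pminor (plucker_mat n l (s x) (\<mu> x) (\<delta> x) (M x) * addrow (\<epsilon> x) (Suc j) j (N x)) J =
      pminor (plucker_mat n l (s x) (\<mu> x) (\<delta>' x) (M' x) * N x) J +
      (if u \<in> J \<and> q \<notin> J then \<alpha> x * pminor (plucker_mat n l (s x) (\<mu> x) (\<delta>' x) (M' x) * N x) ?K else 0)"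
      using comm
    proof eventually_elim
      case (elim x)
      have Nx: "N x \<in> carrier_mat n k" by (rule built_carrier[OF add.hyps(1)])
      have "plucker_mat n l (s x) (\<mu> x) (\<delta> x) (M x) * addrow (\<epsilon> x) (Suc j) j (N x) =
          addrow (\<alpha> x * rot_sign n k q) u q (plucker_mat n l (s x) (\<mu> x) (\<delta>' x) (M' x) * N x)"
        using elim Nx unfolding coef \<delta>'_def by blast
      then show ?case
        using pminor_addrow_cyclic[OF mult_carrier_mat[OF plucker_mat_carrier Nx] J(1) qn(1) u_def qn(3)] by simp
    qed
    have "\<forall>\<^sub>F x in F. pminor (plucker_mat n l (s x) (\<mu> x) (\<delta> x) (M x) * addrow (\<epsilon> x) (Suc j) j (N x)) J = \<kappa> x * h' J x"
    proof (cases "u \<in> J \<and> q \<notin> J")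
      case True
      have KT: "?K \<subseteq> {..<n}" "card ?K = k" using K True by auto
      show ?thesis using ev conjunct2[OF conjunct2[OF h[OF J]]] conjunct2[OF conjunct2[OF h[OF KT]]]
      proof eventually_elim
        case (elim x)
        show ?case unfolding elim h'_def if_P[OF True] by (simp add: algebra_simps)
      qed
    next
      case False
      show ?thesis using ev conjunct2[OF conjunct2[OF h[OF J]]]
      proof eventually_elim
        case (elim x)
        show ?case unfolding elim h'_def if_not_P[OF False] by simp
      qed
    qed
    moreover have "pos0 (h' J) \<and> (?\<sigma> ` J \<in> R \<longrightarrow> pos (h' J)) \<and>
        (Suc j \<in> ?\<sigma> ` J \<and> j \<notin> ?\<sigma> ` J \<and> insert j (?\<sigma> ` J - {Suc j}) \<in> R \<longrightarrow> pos (h' J))"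
    proof (cases "u \<in> J \<and> q \<notin> J")
      case True
      have KT: "?K \<subseteq> {..<n}" "card ?K = k" using K True by auto
      have hJ: "pos0 (h J)" "?\<sigma> ` J \<in> R \<Longrightarrow> pos (h J)" using h[OF J] by blast+
      have hK: "pos0 (h ?K)" "insert j (?\<sigma> ` J - {Suc j}) \<in> R \<Longrightarrow> pos (h ?K)" using h[OF KT] unfolding img by blast+
      have h': "h' J = (\<lambda>x. h J x + \<alpha> x * h ?K x)" using True by (simp add: h'_def)
      have p: "pos0 (\<lambda>x. \<alpha> x * h ?K x)" by (rule pos0_mult[OF pos0I[OF \<alpha>] hK(1)])
      show ?thesis unfolding h'
        using pos0_add[OF hJ(1) p] pos_add_pos0[OF hJ(2) p] pos0_add_pos[OF hJ(1) pos_mult[OF \<alpha> hK(2)]] by blast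
    next
      case False
      have h': "h' J = h J" by (rule ext) (simp only: h'_def if_not_P[OF False] if_False add_0_right)
      show ?thesis unfolding h' using h[OF J] False mem by blast
    qed
    ultimately show ?thesis by blast
  qed
  show ?case
    by (rule exI[of _ \<kappa>], rule exI[of _ h']) (use \<kappa> main in blast)
next
  case (scale R N z p)
  define \<delta>' where "\<delta>' = (\<lambda>x. (\<delta> x)(p := \<delta> x p * z x))"
  have "pos (\<lambda>x. \<delta>' x i)" for i
    unfolding \<delta>'_def using scale.prems(2) scale.hyps(2) by (cases "i = p") (auto intro: pos_mult)
  from scale.IH[where \<delta> = \<delta>', OF scale.prems(1) this] show ?case
    unfolding \<delta>'_def plucker_mat_multrow[OF built_carrier[OF scale.hyps(1)] scale.hyps(3)] .
qed

end

section \<open>The parametrization by row operations\<close>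

lemma M_mat_carrier [simp]: "M_mat n a b z \<in> carrier_mat n n"
  by (simp add: M_mat_def)

lemma M_mat_mult_entry:
  assumes A: "A \<in> carrier_mat n k" and a: "0 < a" and ic: "i < n" "c < k"
  shows "(M_mat n a b z * A) $$ (i, c) = (if Suc i \<in> {a..b} then z (Suc i) else 1) * A $$ (i, c) +
    (if Suc i \<in> {a + 1..b} then A $$ (i - 1, c) else 0)"
proof -
  have "(M_mat n a b z * A) $$ (i, c) = (\<Sum>p<n. M_mat n a b z $$ (i, p) * A $$ (p, c))"
    using A ic by (auto simp: scalar_prod_def lessThan_atLeast0 carrier_matD[OF M_mat_carrier] intro!: sum.cong)
  also have "\<dots> = (\<Sum>p<n. (if p = i then (if Suc i \<in> {a..b} then z (Suc i) else 1) * A $$ (i, c) else 0) +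
      (if p = i - 1 then (if Suc i \<in> {a + 1..b} then A $$ (i - 1, c) else 0) else 0))"
    by (rule sum.cong) (use ic a in \<open>auto simp: M_mat_def Let_def\<close>)
  also have "\<dots> = (if Suc i \<in> {a..b} then z (Suc i) else 1) * A $$ (i, c) +
    (if Suc i \<in> {a + 1..b} then A $$ (i - 1, c) else 0)"
  proof -
    have "i - 1 < n" using ic by simp
    then show ?thesis using ic by (simp add: sum.distrib)
  qed
  finally show ?thesis .
qed

lemma M_mat_single:
  assumes "A \<in> carrier_mat n k" "0 < a" "a \<le> n"
  shows "M_mat n a a z * A = multrow (a - 1) (z a) A"
proof (rule eq_matI)
  fix i c assume "i < dim_row (multrow (a - 1) (z a) A)" "c < dim_col (multrow (a - 1) (z a) A)"
  then have ic: "i < n" "c < k" using assms by auto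
  show "(M_mat n a a z * A) $$ (i, c) = multrow (a - 1) (z a) A $$ (i, c)"
    unfolding M_mat_mult_entry[OF assms(1,2) ic] using assms ic by auto
qed (use assms in \<open>auto simp: carrier_matD[OF M_mat_carrier]\<close>)

text \<open>
  A bidiagonal matrix is a product of scalings and of additions of one row to the next, performed from
  the last row to the first.
\<close>
lemma M_mat_step:
  assumes A: "A \<in> carrier_mat n k" and ab: "0 < a" "a \<le> b" "Suc b \<le> n"
  shows "M_mat n a (Suc b) z * A = M_mat n a b z * addrow 1 b (b - 1) (multrow b (z (Suc b)) A)"
proof (rule eq_matI)
  let ?A = "addrow 1 b (b - 1) (multrow b (z (Suc b)) A)"
  have A': "?A \<in> carrier_mat n k" using A by simp
  fix i c assume "i < dim_row (M_mat n a b z * ?A)" "c < dim_col (M_mat n a b z * ?A)"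
  then have ic: "i < n" "c < k" using A by (auto simp: carrier_matD[OF M_mat_carrier])
  then show "(M_mat n a (Suc b) z * A) $$ (i, c) = (M_mat n a b z * ?A) $$ (i, c)"
    unfolding M_mat_mult_entry[OF A ab(1) ic] M_mat_mult_entry[OF A' ab(1) ic]
    using A ab by (auto simp: le_Suc_eq)
qed (use A in \<open>auto simp: carrier_matD[OF M_mat_carrier]\<close>)

text \<open>
  The first columns of the partial products of the parametrization.
\<close>
primrec stage :: "nat \<Rightarrow> nat \<Rightarrow> tpoint \<Rightarrow> nat \<Rightarrow> complex mat" where
  "stage n m a 0 = frame n (n - m)"
| "stage n m a (Suc r) = M_mat n (Suc r) (Suc r + n - m) (x_coord n m a (Suc r)) * stage n m a r"

lemma stage_carrier: "stage n m a r \<in> carrier_mat n (n - m)"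
  by (induction r) (simp_all add: mult_carrier_mat[OF M_mat_carrier])

lemma first_cols_Phi: "first_cols n (n - m) (Phi n m a) = stage n m a m"
proof -
  let ?f = "\<lambda>i. M_mat n i (i + n - m) (x_coord n m a i)"
  let ?P = "\<lambda>r. foldr (*) (map ?f (rev [1..<r + 1])) (1\<^sub>m n)"
  have P_Suc: "?P (Suc r) = ?f (Suc r) * ?P r" for r by simp
  have P: "?P r \<in> carrier_mat n n" for r
  proof (induction r)
    case (Suc r)
    then show ?case unfolding P_Suc by (rule mult_carrier_mat[OF M_mat_carrier])
  qed simp
  have "?P r * frame n (n - m) = stage n m a r" for r
  proof (induction r)
    case (Suc r)
    have "?P (Suc r) * frame n (n - m) = ?f (Suc r) * (?P r * frame n (n - m))"
      unfolding P_Suc by (rule assoc_mult_mat[OF M_mat_carrier P frame_carrier])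
    then show ?case unfolding Suc by simp
  qed (simp add: left_mult_one_mat[OF frame_carrier])
  then have "stage n m a m = Phi n m a * frame n (n - m)" by (simp add: Phi_def)
  also have "\<dots> = select_cols (Phi n m a) [0..<n - m]"
    by (rule mult_frame) (use P[of m] in \<open>auto simp: Phi_def\<close>)
  also have "\<dots> = first_cols n (n - m) (Phi n m a)"
    unfolding select_cols_def first_cols_def
    by (rule eq_matI) (use P[of m] in \<open>auto simp: Phi_def\<close>)
  finally show ?thesis by simp
qed

lemma X_ext_alt: "X_ext n m a i j =
    (if j + 1 = i then 1 else if j + m = i + n then snd a else fst a (i, j))"
  by (cases a) simp

context positive_functions
begin

text \<open>
  A family of points of the torus, all of whose coordinates are positive functions.
\<close>
definition pos_tpoint :: "nat \<Rightarrow> nat \<Rightarrow> ('x \<Rightarrow> tpoint) \<Rightarrow> bool" where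
  "pos_tpoint n m a \<longleftrightarrow> (\<forall>(i, j)\<in>RR n m. pos (\<lambda>x. fst (a x) (i, j))) \<and> pos (\<lambda>x. snd (a x))"

lemma pos_tpoint_x_coord:
  assumes a: "pos_tpoint n m a" and m: "m \<le> n" and i: "1 \<le> i" "i \<le> m" and j: "i \<le> j" "j \<le> i + n - m"
  shows "pos (\<lambda>x. x_coord n m (a x) i j)"
proof -
  have "pos (\<lambda>x. X_ext n m (a x) i j)" if j: "i \<le> j + 1" "j \<le> i + n - m" for j
  proof -
    consider "j + 1 = i" | "j + m = i + n" "j + 1 \<noteq> i" | "j + 1 \<noteq> i" "j + m \<noteq> i + n" "(i, j) \<in> RR n m"
    proof (cases "j + 1 = i")
      case False
      then have "i \<le> j" "j + m \<le> i + n" using j i m by linarith+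
      then have "j + m = i + n \<or> (i, j) \<in> RR n m" using i by (auto simp: RR_def)
      then show ?thesis using that False by blast
    qed (rule that)
    then show ?thesis
      using a by cases (auto simp: X_ext_alt pos_tpoint_def pos_one)
  qed
  from this[of j] this[of "j - 1"] show ?thesis
    unfolding x_coord_def using i j by (intro pos_divide) auto
qed

text \<open>
  A bidiagonal factor performs its additions from the bottom up, so the last row of a row set can be
  filled by shifting a whole run of consecutive rows down by one: such a chain leads from the row
  set with \<open>u - 1\<close> and without \<open>b - 1\<close> to \<open>J\<close>.
\<close>
lemma built_M_mat:
  assumes "built n k R N" and "0 < a" "a \<le> b" "b \<le> n" and "\<And>i. a \<le> i \<Longrightarrow> i \<le> b \<Longrightarrow> pos (\<lambda>x. z x i)"
  shows "\<exists>R'. built n k R' (\<lambda>x. M_mat n a b (z x) * N x) \<and> R \<subseteq> R' \<and>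
    (\<forall>J u. a \<le> u \<longrightarrow> u < b \<longrightarrow> {u..<b} \<subseteq> J \<longrightarrow> u - 1 \<notin> J \<longrightarrow> insert (u - 1) (J - {b - 1}) \<in> R \<longrightarrow> J \<in> R')"
  using assms(3,1,2,4,5)
proof (induction b arbitrary: R N rule: dec_induct)
  case base
  have "(\<lambda>x. M_mat n a a (z x) * N x) = (\<lambda>x. multrow (a - 1) (z x a) (N x))"
    by (rule ext, rule M_mat_single) (use base built_carrier in auto)
  moreover have "built n k R (\<lambda>x. multrow (a - 1) (z x a) (N x))"
    by (rule built.scale) (use base in auto)
  ultimately show ?case by (intro exI[of _ R]) auto
next
  case (step b)
  define R1 where "R1 = R \<union> {J. b \<in> J \<and> b - 1 \<notin> J \<and> insert (b - 1) (J - {b}) \<in> R}"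
  let ?N = "\<lambda>x. addrow 1 b (b - 1) (multrow b (z x (Suc b)) (N x))"
  have "built n k R (\<lambda>x. multrow b (z x (Suc b)) (N x))"
    by (rule built.scale) (use step in auto)
  then have "built n k (R \<union> {J. Suc (b - 1) \<in> J \<and> b - 1 \<notin> J \<and> insert (b - 1) (J - {Suc (b - 1)}) \<in> R})
    (\<lambda>x. addrow 1 (Suc (b - 1)) (b - 1) (multrow b (z x (Suc b)) (N x)))"
    by (rule built.add[OF _ pos_one]) (use step in auto)
  then have "built n k R1 ?N" using step.hyps step.prems(2) by (simp add: R1_def)
  then obtain R' where R': "built n k R' (\<lambda>x. M_mat n a b (z x) * ?N x)" "R1 \<subseteq> R'"
    "\<And>J u. a \<le> u \<Longrightarrow> u < b \<Longrightarrow> {u..<b} \<subseteq> J \<Longrightarrow> u - 1 \<notin> J \<Longrightarrow> insert (u - 1) (J - {b - 1}) \<in> R1 \<Longrightarrow> J \<in> R'"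
    using step.IH[of R1 ?N] step.prems by auto
  have "(\<lambda>x. M_mat n a (Suc b) (z x) * N x) = (\<lambda>x. M_mat n a b (z x) * ?N x)"
    by (rule ext, rule M_mat_step[OF built_carrier[OF step.prems(1)]]) (use step in auto)
  moreover have "J \<in> R'" if J: "a \<le> u" "u < Suc b" "{u..<Suc b} \<subseteq> J" "u - 1 \<notin> J"
    "insert (u - 1) (J - {Suc b - 1}) \<in> R" for J u
  proof (cases "u = b")
    case True
    then have "J \<in> R1" using J by (auto simp: R1_def)
    then show ?thesis using R'(2) by auto
  next
    case False
    then have u: "u < b" using J by simp
    have "insert (b - 1) (insert (u - 1) (J - {b - 1}) - {b}) = insert (u - 1) (J - {b})"
    proof -
      have "b - 1 \<in> J" by (rule subsetD[OF J(3)]) (use u in auto)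
      moreover have "u - 1 \<noteq> b" "b - 1 \<noteq> b" "u - 1 \<noteq> b - 1" using u J(1) step.prems(2) by auto
      ultimately show ?thesis by auto
    qed
    moreover have "b \<in> insert (u - 1) (J - {b - 1})" "b - 1 \<notin> insert (u - 1) (J - {b - 1})"
      using J(1,3) u step.prems(2) by auto
    ultimately have "insert (u - 1) (J - {b - 1}) \<in> R1" using J(5) by (auto simp: R1_def)
    moreover have "{u..<b} \<subseteq> J" using J(3) by auto
    ultimately show ?thesis using R'(3)[OF J(1) u _ J(4)] by blast
  qed
  ultimately show ?case using R'(1,2) by (intro exI[of _ R']) (auto simp: R1_def)
qed

text \<open>
  Every row set is reached. If \<open>J\<close> contains the newest row \<open>r + k\<close>, it contains the whole run of rows from
  some \<open>u\<close> to \<open>r + k\<close> but not \<open>u - 1\<close>. Exchanging \<open>r + k\<close> for \<open>u - 1\<close> gives a row set available before, and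
  the new bidiagonal factor leads from it to \<open>J\<close>. The run has at most \<open>k\<close> elements, so that it lies
  in the range of that factor.
\<close>
lemma stage_built:
  assumes a: "pos_tpoint n m a" and m: "m \<le> n" and r: "r \<le> m" and k: "k = n - m"
  shows "\<exists>R. built n k R (\<lambda>x. stage n m (a x) r) \<and> (\<forall>J. J \<subseteq> {..<r + k} \<longrightarrow> card J = k \<longrightarrow> J \<in> R)"
  using r
proof (induction r)
  case 0
  have "J = {..<k}" if "J \<subseteq> {..<k}" "card J = k" for J
    using that by (intro card_subset_eq) auto
  then show ?case using built.frame[of n k] k by (intro exI[of _ "{{..<k}}"]) auto
next
  case (Suc r)
  then obtain R where R: "built n k R (\<lambda>x. stage n m (a x) r)"
    "\<And>J. J \<subseteq> {..<r + k} \<Longrightarrow> card J = k \<Longrightarrow> J \<in> R" by auto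
  let ?b = "Suc r + n - m"
  have b: "?b = Suc r + k" "?b \<le> n" using k m Suc by auto
  obtain R' where R': "built n k R' (\<lambda>x. M_mat n (Suc r) ?b (x_coord n m (a x) (Suc r)) * stage n m (a x) r)" "R \<subseteq> R'"
    "\<And>J u. Suc r \<le> u \<Longrightarrow> u < ?b \<Longrightarrow> {u..<?b} \<subseteq> J \<Longrightarrow> u - 1 \<notin> J \<Longrightarrow> insert (u - 1) (J - {?b - 1}) \<in> R \<Longrightarrow> J \<in> R'"
    using built_M_mat[OF R(1), of "Suc r" ?b "\<lambda>x. x_coord n m (a x) (Suc r)"]
      pos_tpoint_x_coord[OF a m, of "Suc r"] Suc b by auto
  have "J \<in> R'" if J: "J \<subseteq> {..<Suc r + k}" "card J = k" for J
  proof (cases "r + k \<in> J")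
    case False
    have "x < r + k" if "x \<in> J" for x
    proof -
      have "x < Suc r + k" "x \<noteq> r + k" using that J False by auto
      then show ?thesis by simp
    qed
    then have "J \<in> R" using R(2)[of J] J by auto
    then show ?thesis using R' by auto
  next
    case True
    have fin: "finite J" using J finite_subset by blast
    define u where "u = (LEAST u. {u..<Suc (r + k)} \<subseteq> J)"
    have ex: "{r + k..<Suc (r + k)} \<subseteq> J" using True by auto
    have u: "{u..<Suc (r + k)} \<subseteq> J" unfolding u_def by (rule LeastI[of _ "r + k"]) (rule ex)
    have u_le: "u \<le> r + k" unfolding u_def by (rule Least_le) (rule ex)
    have "card {u..<Suc (r + k)} \<le> k" using card_mono[OF fin u] J by simp
    then have ur: "Suc r \<le> u" using u_le by simp
    have gap: "u - 1 \<notin> J"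
    proof
      assume "u - 1 \<in> J"
      moreover have "{u - 1..<Suc (r + k)} = insert (u - 1) {u..<Suc (r + k)}" using ur u_le by auto
      ultimately have "{u - 1..<Suc (r + k)} \<subseteq> J" using u by simp
      then have "u \<le> u - 1" unfolding u_def by (rule Least_le)
      then show False using ur by simp
    qed
    have "insert (u - 1) (J - {r + k}) \<in> R"
    proof (rule R(2))
      show "insert (u - 1) (J - {r + k}) \<subseteq> {..<r + k}"
      proof
        fix x assume "x \<in> insert (u - 1) (J - {r + k})"
        then have "x = u - 1 \<or> x < Suc r + k \<and> x \<noteq> r + k" using J by auto
        then show "x \<in> {..<r + k}" using u_le ur by auto
      qed
      show "card (insert (u - 1) (J - {r + k})) = k"
        using gap fin True J card_Suc_Diff1[of J "r + k"] by simp
    qed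
    moreover have "{u..<Suc r + k} \<subseteq> J" "u < Suc r + k" "Suc r + k - 1 = r + k" using u u_le by auto
    ultimately show ?thesis using R'(3)[unfolded b(1), OF ur _ _ gap] by simp
  qed
  then show ?case using R' by (intro exI[of _ R']) auto
qed

lemma stage_posmat:
  assumes "pos_tpoint n m a" "m \<le> n"
  shows "posmat n (n - m) (\<lambda>x. stage n m (a x) m)"
proof -
  obtain R where R: "built n (n - m) R (\<lambda>x. stage n m (a x) m)"
    "\<And>J. J \<subseteq> {..<m + (n - m)} \<Longrightarrow> card J = n - m \<Longrightarrow> J \<in> R"
    using stage_built[OF assms order_refl refl] by blast
  then show ?thesis
    unfolding posmat_def using built_minors[OF R(1)] stage_carrier assms(2) by auto
qed

end

section \<open>Inverting the parametrization\<close>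

text \<open>
  The row sets whose minors determine the coordinates: an interval that starts at \<open>i\<close>, completed to \<open>k\<close>
  elements by the last rows that do not vanish at stage \<open>r\<close>.
\<close>
definition coord_rows :: "nat \<Rightarrow> nat \<Rightarrow> nat \<Rightarrow> nat \<Rightarrow> nat set" where
  "coord_rows k r i j = {i..<j} \<union> {r + j - i..<r + k}"

lemma coord_rows_props:
  assumes "i \<le> r" "i \<le> j" "j \<le> i + k"
  shows "finite (coord_rows k r i j)" "card (coord_rows k r i j) = k" "coord_rows k r i j \<subseteq> {..<r + k}"
    "sorted_list_of_set (coord_rows k r i j) = [i..<j] @ [r + j - i..<r + k]"
proof -
  show "finite (coord_rows k r i j)" "coord_rows k r i j \<subseteq> {..<r + k}" using assms by (auto simp: coord_rows_def)
  show "card (coord_rows k r i j) = k"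
    unfolding coord_rows_def using assms by (subst card_Un_disjoint) auto
  show "sorted_list_of_set (coord_rows k r i j) = [i..<j] @ [r + j - i..<r + k]"
    unfolding coord_rows_def using assms
    by (subst sorted_list_of_set_append) auto
qed

lemma coord_rows_diag: "coord_rows k r r j = {r..<r + k}" if "r \<le> j" "j \<le> r + k"
  using that by (auto simp: coord_rows_def)

lemma coord_rows_empty: "coord_rows k r i i = {r..<r + k}"
  by (auto simp: coord_rows_def)

lemma pminor_coord_rows:
  assumes A: "A \<in> carrier_mat n k" and ij: "i \<le> r" "i \<le> j" "j \<le> i + k"
  shows "pminor A (coord_rows k r i j) = det (mat k k (\<lambda>(a, c). A $$ (if a < j - i then i + a else r + a, c)))"
proof -
  let ?xs = "[i..<j] @ [r + j - i..<r + k]"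
  have len: "length ?xs = k" using ij by auto
  have nth: "?xs ! a = (if a < j - i then i + a else r + a)" if "a < k" for a
    using that ij by (auto simp: nth_append)
  have "pminor A (coord_rows k r i j) = lminor A ?xs"
    unfolding pminor_def coord_rows_props[OF ij] using A by simp
  also have "\<dots> = det (mat k k (\<lambda>(a, c). A $$ (if a < j - i then i + a else r + a, c)))"
    unfolding lminor_def len by (rule arg_cong[where f = det], rule eq_matI) (auto simp: nth)
  finally show ?thesis .
qed

lemma tridiagonal_sum:
  fixes y :: "nat \<Rightarrow> 'a::comm_ring_1"
  assumes "a < k"
  shows "(\<Sum>b<k. ((if b = a then \<alpha> else 0) + (if Suc b = a then \<beta> else 0) + (if b = Suc a then \<gamma> else 0)) * y b) =
    \<alpha> * y a + (if 0 < a then \<beta> * y (a - 1) else 0) + (if Suc a < k then \<gamma> * y (Suc a) else 0)"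
proof -
  have "(\<Sum>b<k. ((if b = a then \<alpha> else 0) + (if Suc b = a then \<beta> else 0) + (if b = Suc a then \<gamma> else 0)) * y b) =
    (\<Sum>b<k. (if b = a then \<alpha> * y a else 0) + (if b = a - 1 then if 0 < a then \<beta> * y (a - 1) else 0 else 0) +
      (if b = Suc a then \<gamma> * y (Suc a) else 0))"
    by (rule sum.cong) (auto simp: distrib_right)
  moreover have "a - 1 < k" using assms by simp
  ultimately show ?thesis using assms by (simp add: sum.distrib)
qed

text \<open>
  On the rows of the first interval of \<open>coord_rows\<close> the bidiagonal matrix acts by a lower triangular
  matrix, whose diagonal entries are \<open>1\<close> before the range of the factor. On the second interval, whose rows are
  shifted by one, it acts by an upper unitriangular one, because the last row of the range is zero before
  the operation.
\<close>
lemma bidiagonal_minor: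
  fixes A :: "complex mat"
  assumes A: "A \<in> carrier_mat n k" and zero: "\<And>c. c < k \<Longrightarrow> A $$ (r + k, c) = 0"
    and r: "Suc r + k \<le> n" and ij: "i \<le> r" "i \<le> j" "j \<le> i + k"
  shows "pminor (M_mat n (Suc r) (Suc r + k) z * A) (coord_rows k (Suc r) i j) =
    (\<Prod>a<j - i. if r \<le> i + a then z (Suc (i + a)) else 1) * pminor A (coord_rows k r i j)"
proof -
  let ?d = "j - i" and ?B = "M_mat n (Suc r) (Suc r + k) z * A"
  have B: "?B \<in> carrier_mat n k" by (rule mult_carrier_mat[OF M_mat_carrier A])
  define \<alpha> where "\<alpha> = (\<lambda>a. if a < ?d then if r \<le> i + a then z (Suc (i + a)) else 1 else 1)"
  define \<beta> where "\<beta> = (\<lambda>a. if a < ?d \<and> Suc r \<le> i + a then 1 else 0 :: complex)"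
  define \<gamma> where "\<gamma> = (\<lambda>a. if a < ?d then 0 else z (Suc (Suc (r + a))))"
  define T where "T = (\<lambda>(a, b). (if b = a then \<alpha> a else 0) + (if Suc b = a then \<beta> a else 0) + (if b = Suc a then \<gamma> a else 0))"
  let ?row = "\<lambda>r a. if a < ?d then i + a else r + a"
  let ?Y = "mat k k (\<lambda>(a, c). A $$ (?row r a, c))"
  have "mat k k (\<lambda>(a, c). ?B $$ (?row (Suc r) a, c)) = mat k k T * ?Y"
  proof (rule eq_matI)
    fix a c assume "a < dim_row (mat k k T * ?Y)" "c < dim_col (mat k k T * ?Y)"
    then have ac: "a < k" "c < k" by auto
    have row: "?row (Suc r) a < n" using ac r ij by auto
    have "(mat k k T * ?Y) $$ (a, c) = (\<Sum>b<k. T (a, b) * A $$ (?row r b, c))"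
      using ac by (auto simp: scalar_prod_def lessThan_atLeast0 intro!: sum.cong)
    also have "\<dots> = \<alpha> a * A $$ (?row r a, c) + (if 0 < a then \<beta> a * A $$ (?row r (a - 1), c) else 0) +
        (if Suc a < k then \<gamma> a * A $$ (?row r (Suc a), c) else 0)"
      unfolding T_def prod.case by (rule tridiagonal_sum[OF ac(1)])
    also have "\<dots> = ?B $$ (?row (Suc r) a, c)"
    proof (cases "a < ?d")
      case True
      have "i + a \<le> r + k" using True ij by auto
      then show ?thesis using True ij ac unfolding M_mat_mult_entry[OF A zero_less_Suc row ac(2)]
        by (auto simp: \<alpha>_def \<beta>_def \<gamma>_def)
    next
      case False
      have "(if Suc a < k then \<gamma> a * A $$ (?row r (Suc a), c) else 0) = z (Suc (Suc r + a)) * A $$ (Suc r + a, c)"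
      proof (cases "Suc a < k")
        case True
        then show ?thesis using False by (simp add: \<gamma>_def)
      next
        case f: False
        then have e: "Suc r + a = r + k" using ac by simp
        show ?thesis unfolding e zero[OF ac(2)] using f by simp
      qed
      then show ?thesis using False ac unfolding M_mat_mult_entry[OF A zero_less_Suc row ac(2)]
        by (simp add: \<alpha>_def \<beta>_def)
    qed
    finally show "mat k k (\<lambda>(a, c). ?B $$ (?row (Suc r) a, c)) $$ (a, c) = (mat k k T * ?Y) $$ (a, c)"
      using ac by simp
  qed auto
  then have "pminor ?B (coord_rows k (Suc r) i j) = det (mat k k T) * det ?Y"
    using pminor_coord_rows[OF B, of i "Suc r" j] det_mult[of "mat k k T" k ?Y] ij by simp
  moreover have "det (mat k k T) = (\<Prod>a<?d. if r \<le> i + a then z (Suc (i + a)) else 1)"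
  proof -
    have k: "k = ?d + (k - ?d)" using ij by simp
    have "det (mat (?d + (k - ?d)) (?d + (k - ?d)) T) =
        det (mat ?d ?d T) * det (mat (k - ?d) (k - ?d) (\<lambda>(a, b). T (?d + a, ?d + b)))"
      by (rule det_block_upper_zero) (auto simp: T_def \<gamma>_def)
    also have "det (mat ?d ?d T) = (\<Prod>a<?d. T (a, a))"
      by (rule det_lower_triangular_fun) (auto simp: T_def \<gamma>_def)
    also have "det (mat (k - ?d) (k - ?d) (\<lambda>(a, b). T (?d + a, ?d + b))) = (\<Prod>a<k - ?d. 1)"
      by (subst det_upper_triangular_fun) (auto simp: T_def \<beta>_def \<alpha>_def)
    finally show ?thesis using k by (simp add: T_def \<alpha>_def)
  qed
  ultimately show ?thesis using pminor_coord_rows[OF A ij] by simp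
qed

lemma telescope:
  fixes Y :: "nat \<Rightarrow> complex"
  assumes "Y r = 1" "i \<le> r" "\<And>p. r \<le> p \<Longrightarrow> p \<le> i + d \<Longrightarrow> Y p \<noteq> 0"
  shows "(\<Prod>a<d. if r \<le> i + a then Y (Suc (i + a)) / Y (i + a) else 1) = (if i + d \<le> r then 1 else Y (i + d))"
  using assms
proof (induction d)
  case (Suc d)
  then have IH: "(\<Prod>a<d. if r \<le> i + a then Y (Suc (i + a)) / Y (i + a) else 1) = (if i + d \<le> r then 1 else Y (i + d))"
    by auto
  consider "i + d < r" | "i + d = r" | "r < i + d" by linarith
  then show ?case
    using IH Suc.prems(1) Suc.prems(3)[of "i + d"] by cases auto
qed auto

lemma bidiagonal_minor_telescope:
  fixes A :: "complex mat"
  assumes A: "A \<in> carrier_mat n k" and zero: "\<And>c. c < k \<Longrightarrow> A $$ (r + k, c) = 0"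
    and r: "Suc r + k \<le> n" and ij: "i \<le> r" "i \<le> j" "j \<le> i + k"
    and Y: "Y r = 1" "\<And>p. r \<le> p \<Longrightarrow> p \<le> r + k \<Longrightarrow> Y p \<noteq> 0"
    and z: "\<And>p. r < p \<Longrightarrow> p \<le> r + k \<Longrightarrow> z p = Y p / Y (p - 1)"
  shows "pminor (M_mat n (Suc r) (Suc r + k) z * A) (coord_rows k (Suc r) i j) =
    (if j \<le> r then 1 else Y j) * pminor A (coord_rows k r i j)"
proof -
  have "(\<Prod>a<j - i. if r \<le> i + a then z (Suc (i + a)) else 1) =
      (\<Prod>a<j - i. if r \<le> i + a then Y (Suc (i + a)) / Y (i + a) else 1)"
    by (rule prod.cong) (use ij z in auto)
  also have "\<dots> = (if i + (j - i) \<le> r then 1 else Y (i + (j - i)))"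
    by (rule telescope) (use Y ij in auto)
  also have "\<dots> = (if j \<le> r then 1 else Y j)" using ij by simp
  finally have *: "(\<Prod>a<j - i. if r \<le> i + a then z (Suc (i + a)) else 1) = (if j \<le> r then 1 else Y j)" .
  have "pminor (M_mat n (Suc r) (Suc r + k) z * A) (coord_rows k (Suc r) i j) =
    (\<Prod>a<j - i. if r \<le> i + a then z (Suc (i + a)) else 1) * pminor A (coord_rows k r i j)"
    by (rule bidiagonal_minor[OF A zero r ij])
  then show ?thesis unfolding * .
qed

lemma stage_zero_rows:
  assumes "m \<le> n" "r \<le> m" "r + (n - m) \<le> i" "i < n" "c < n - m"
  shows "stage n m a r $$ (i, c) = 0"
  using assms
proof (induction r arbitrary: i)
  case (Suc r)
  have "stage n m a (Suc r) $$ (i, c) = (if Suc i \<in> {Suc r..Suc r + n - m} then x_coord n m a (Suc r) (Suc i) else 1) * stage n m a r $$ (i, c) +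
    (if Suc i \<in> {Suc r + 1..Suc r + n - m} then stage n m a r $$ (i - 1, c) else 0)"
    by (simp only: stage.simps) (rule M_mat_mult_entry[OF stage_carrier], use Suc in auto)
  moreover have "stage n m a r $$ (i, c) = 0" by (rule Suc.IH) (use Suc.prems in auto)
  moreover have "stage n m a r $$ (i - 1, c) = 0" by (rule Suc.IH) (use Suc.prems in auto)
  ultimately show ?case by simp
qed (simp add: frame_def)

lemma X_ext_range:
  assumes "p \<le> r + (n - m)" "r < p" "Suc r \<le> m" "m \<le> n"
  shows "(Suc r, p) \<in> RR n m" "X_ext n m a (Suc r) p = fst a (Suc r, p)"
  using assms by (auto simp: RR_def X_ext_alt)

lemma X_ext_start: "X_ext n m a (Suc r) r = 1"
  by (simp add: X_ext_alt)

text \<open>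
  The factor of index \<open>s\<close> multiplies the minor by the product of those \<open>x\<^sub>s\<^sub>p\<close> with \<open>s \<le> p \<le> j\<close>, which
  telescopes to \<open>X\<^sub>s\<^sub>j\<close>. Two row sets with neighbouring \<open>i\<close> then have a single coordinate as their ratio.
\<close>
lemma stage_minor:
  assumes a: "\<And>s j. (s, j) \<in> RR n m \<Longrightarrow> fst a (s, j) \<noteq> 0" and m: "m \<le> n" and r: "r \<le> m"
    and ij: "i \<le> r" "i \<le> j" "j \<le> i + (n - m)"
  shows "pminor (stage n m a r) (coord_rows (n - m) r i j) = (\<Prod>s\<in>{Suc i..r}. if j < s then 1 else X_ext n m a s j)"
  using r ij
proof (induction r arbitrary: i j)
  case 0
  then have "coord_rows (n - m) 0 i j = {..<n - m}" by (auto simp: coord_rows_def)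
  moreover have "pminor (frame n (n - m) :: complex mat) {..<n - m} = 1"
  proof -
    have "pminor (frame n (n - m) :: complex mat) {0..<n - m} =
        det (mat (n - m) (n - m) (\<lambda>(i, j). frame n (n - m) $$ ([0..<n - m] ! i, j)))"
      by (simp add: pminor_def lminor_def frame_def)
    also have "\<dots> = 1"
      by (subst det_lower_triangular_fun) (auto simp: frame_def)
    finally show ?thesis by (simp add: lessThan_atLeast0)
  qed
  ultimately show ?case using 0 by simp
next
  case (Suc r)
  let ?k = "n - m"
  have b: "Suc r + n - m = Suc r + ?k" "Suc r + ?k \<le> n" using m Suc.prems by auto
  let ?Y = "X_ext n m a (Suc r)"
  have Y: "?Y r = 1" "\<And>p. r \<le> p \<Longrightarrow> p \<le> r + ?k \<Longrightarrow> ?Y p \<noteq> 0"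
  proof -
    show "?Y r = 1" by (rule X_ext_start)
    fix p assume "r \<le> p" "p \<le> r + ?k"
    then show "?Y p \<noteq> 0"
      using X_ext_start[of n m a r] X_ext_range(1)[of p r n m] X_ext_range(2)[of p r n m a] a m Suc.prems(1) by (cases "p = r") auto
  qed
  have step: "pminor (stage n m a (Suc r)) (coord_rows ?k (Suc r) i j) = (if j \<le> r then 1 else ?Y j) * pminor (stage n m a r) (coord_rows ?k r i j)"
    if "i \<le> r" "i \<le> j" "j \<le> i + ?k" for i j
    unfolding stage.simps b(1)
    by (rule bidiagonal_minor_telescope[where Y = ?Y, OF stage_carrier _ b(2) that Y])
      (use stage_zero_rows m Suc.prems in \<open>auto simp: x_coord_def\<close>)
  show ?case
  proof (cases "i \<le> r")
    case True
    have "{Suc i..Suc r} = insert (Suc r) {Suc i..r}" using True by auto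
    then show ?thesis using step[OF True Suc.prems(3,4)] Suc.IH[OF _ True Suc.prems(3,4)] Suc.prems(1)
      by (simp add: less_Suc_eq_le)
  next
    case False
    then have i: "i = Suc r" using Suc.prems by simp
    have "coord_rows ?k (Suc r) i j = coord_rows ?k (Suc r) r r"
      using coord_rows_diag[of "Suc r" j ?k] coord_rows_empty[of ?k "Suc r" r] Suc.prems i by simp
    then show ?thesis using step[of r r] Suc.IH[of r r] Suc.prems i by simp
  qed
qed

lemma stage_minor_nonzero:
  assumes a: "\<And>s j. (s, j) \<in> RR n m \<Longrightarrow> fst a (s, j) \<noteq> 0" and m: "m \<le> n"
    and ij: "i \<le> m" "i \<le> j" "j \<le> i + (n - m)"
  shows "pminor (stage n m a m) (coord_rows (n - m) m i j) \<noteq> 0"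
proof -
  have "X_ext n m a s j \<noteq> 0" if s: "s \<in> {Suc i..m}" "\<not> j < s" for s
  proof -
    obtain s' where s': "s = Suc s'" using s by (cases s) auto
    have "j \<le> s' + (n - m)" "s' < j" "Suc s' \<le> m" using s ij unfolding s' by auto
    from X_ext_range[OF this m] a show ?thesis unfolding s' by auto
  qed
  then show ?thesis using stage_minor[OF a m order_refl ij] by (auto split: if_splits)
qed

lemma coordinate_ratio:
  assumes a: "\<And>s j. (s, j) \<in> RR n m \<Longrightarrow> fst a (s, j) \<noteq> 0" and m: "m \<le> n" and sj: "(s, j) \<in> RR n m"
  shows "fst a (s, j) = pminor (stage n m a m) (coord_rows (n - m) m (s - 1) j) / pminor (stage n m a m) (coord_rows (n - m) m s j)"
proof -
  have r: "1 \<le> s" "s \<le> m" "s \<le> j" "j \<le> (s - 1) + (n - m)" using sj by (auto simp: RR_def)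
  then obtain s' where s': "s = Suc s'" by (cases s) auto
  have "{Suc (s - 1)..m} = insert s {Suc s..m}" using r by auto
  moreover have "X_ext n m a s j = fst a (s, j)" using X_ext_range(2)[of j s' n m a] r m unfolding s' by auto
  ultimately have "pminor (stage n m a m) (coord_rows (n - m) m (s - 1) j) =
      fst a (s, j) * pminor (stage n m a m) (coord_rows (n - m) m s j)"
    using stage_minor[OF a m order_refl, of "s - 1" j] stage_minor[OF a m order_refl, of s j] r by simp
  moreover have "pminor (stage n m a m) (coord_rows (n - m) m s j) \<noteq> 0"
    by (rule stage_minor_nonzero[OF a m]) (use r in auto)
  ultimately show ?thesis by simp
qed

lemma stage_cong:
  assumes "\<And>s j. s \<le> r \<Longrightarrow> (s, j) \<in> RR n m \<Longrightarrow> X (s, j) = X' (s, j)" and m: "m \<le> n" "r \<le> m"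
  shows "stage n m (X, t) r = stage n m (X', t) r"
  using assms
proof (induction r)
  case (Suc r)
  have "X_ext n m (X, t) (Suc r) p = X_ext n m (X', t) (Suc r) p" if "r \<le> p" "p \<le> Suc r + n - m" for p
  proof -
    have "p \<le> r + (n - m)" if "p + m \<noteq> Suc r + n"
      using that \<open>p \<le> Suc r + n - m\<close> m Suc.prems by linarith
    then consider "p = r" | "p + m = Suc r + n" "p \<noteq> r" | "p \<noteq> r" "p + m \<noteq> Suc r + n" "p \<le> r + (n - m)"
      by blast
    then show ?thesis
    proof cases
      case 3
      have "(Suc r, p) \<in> RR n m" using 3 that Suc.prems m X_ext_range(1)[of p r n m] by auto
      then show ?thesis using 3 Suc.prems(1)[of "Suc r" p] by simp
    qed simp_all
  qed
  then have "M_mat n (Suc r) (Suc r + n - m) (x_coord n m (X, t) (Suc r)) =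
      M_mat n (Suc r) (Suc r + n - m) (x_coord n m (X', t) (Suc r))"
  proof -
    assume xe: "\<And>p. r \<le> p \<Longrightarrow> p \<le> Suc r + n - m \<Longrightarrow> X_ext n m (X, t) (Suc r) p = X_ext n m (X', t) (Suc r) p"
    have "x_coord n m (X, t) (Suc r) p = x_coord n m (X', t) (Suc r) p" if "Suc r \<le> p" "p \<le> Suc r + n - m" for p
      unfolding x_coord_def using xe[of p] xe[of "p - 1"] that by (simp del: X_ext.simps)
    then show ?thesis unfolding M_mat_def by (intro eq_matI) (auto simp: Let_def)
  qed
  then show ?case using Suc by simp
qed simp

text \<open>
  Peeling off the last bidiagonal factor. The \<open>k + 1\<close> rows on which it acts satisfy one linear
  relation, whose coefficients are the minors used as coordinates; it says exactly that the
  last row becomes zero.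
\<close>
lemma peel_bidiagonal:
  fixes A :: "complex mat"
  assumes A: "A \<in> carrier_mat n k" and k: "0 < k" and r: "Suc r + k \<le> n"
    and zero: "\<And>i c. Suc r + k \<le> i \<Longrightarrow> i < n \<Longrightarrow> c < k \<Longrightarrow> A $$ (i, c) = 0"
    and D: "D \<noteq> 0" and Y: "\<And>e. e \<le> k \<Longrightarrow> D * Y (r + e) = pminor A (coord_rows k (Suc r) r (r + e))"
    and Y0: "\<And>p. r \<le> p \<Longrightarrow> p \<le> r + k \<Longrightarrow> Y p \<noteq> 0"
    and z: "\<And>p. r < p \<Longrightarrow> p \<le> r + k \<Longrightarrow> z p = Y p / Y (p - 1)" and Yr: "Y r = 1"
  obtains B where "B \<in> carrier_mat n k" "\<And>i c. r + k \<le> i \<Longrightarrow> i < n \<Longrightarrow> c < k \<Longrightarrow> B $$ (i, c) = 0"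
    "A = M_mat n (Suc r) (Suc r + k) z * B"
proof -
  \<comment> \<open>Up to normalization, \<open>W\<close> solves the bidiagonal system from the top row downwards;
    what is left over at the end is the linear relation.\<close>
  define W where "W = (\<lambda>e c. \<Sum>u<Suc e. (-1) ^ u * Y (r + u) * A $$ (r + u, c))"
  have W0: "W 0 c = A $$ (r, c)" for c by (simp add: W_def Yr)
  have WS: "W (Suc e) c = W e c - (-1) ^ e * Y (Suc (r + e)) * A $$ (Suc (r + e), c)" for e c
    by (simp add: W_def)
  have Wk: "W k c = 0" if c: "c < k" for c
  proof -
    let ?xs = "[r..<Suc (r + k)]"
    have l: "lminor A (take i ?xs @ drop (Suc i) ?xs) = D * Y (r + i)" if i: "i < Suc k" for i
    proof -
      have "take i ?xs @ drop (Suc i) ?xs = [r..<r + i] @ [Suc (r + i)..<Suc r + k]"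
        using i by (simp add: take_upt del: upt_Suc)
      moreover have "pminor A (coord_rows k (Suc r) r (r + i)) = lminor A ([r..<r + i] @ [Suc (r + i)..<Suc r + k])"
        unfolding pminor_def using coord_rows_props[of r "Suc r" "r + i" k] i A by simp
      ultimately show ?thesis using Y[of i] i by simp
    qed
    have "(\<Sum>i<Suc k. (-1) ^ i * lminor A (take i ?xs @ drop (Suc i) ?xs) * A $$ (?xs ! i, c)) = 0"
      by (rule cramer_relation) (use c in \<open>simp_all del: upt_Suc\<close>)
    also have "(\<Sum>i<Suc k. (-1) ^ i * lminor A (take i ?xs @ drop (Suc i) ?xs) * A $$ (?xs ! i, c)) = D * W k c"
      unfolding W_def sum_distrib_left
    proof (rule sum.cong[OF refl])
      fix i assume "i \<in> {..<Suc k}"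
      then have i: "i < Suc k" by simp
      then have xi: "?xs ! i = r + i" by (simp del: upt_Suc)
      show "(-1) ^ i * lminor A (take i ?xs @ drop (Suc i) ?xs) * A $$ (?xs ! i, c) = D * ((-1) ^ i * Y (r + i) * A $$ (r + i, c))"
        unfolding l[OF i] xi by (simp add: mult_ac)
    qed
    finally show ?thesis using D by simp
  qed
  define B where "B = mat n k (\<lambda>(p, c). if p < r then A $$ (p, c)
    else if p < r + k then (-1) ^ (p - r) * W (p - r) c / Y (Suc p) else 0)"
  have B: "B \<in> carrier_mat n k" by (simp add: B_def)
  have sq: "(-1) ^ e * ((-1) ^ e * x) = x" for e and x :: complex
    by (simp flip: mult.assoc power_mult_distrib)
  have "M_mat n (Suc r) (Suc r + k) z * B = A"
  proof (rule eq_matI)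
    fix p c assume "p < dim_row A" "c < dim_col A"
    then have pc: "p < n" "c < k" using A by auto
    consider "p < r" | "p = r" | e where "p = Suc (r + e)" "Suc e < k" | e where "p = Suc (r + e)" "Suc e = k" | "Suc r + k \<le> p"
    proof -
      assume "p < r \<Longrightarrow> thesis" "p = r \<Longrightarrow> thesis" "Suc r + k \<le> p \<Longrightarrow> thesis"
        and *: "\<And>e. p = Suc (r + e) \<Longrightarrow> Suc e < k \<Longrightarrow> thesis" "\<And>e. p = Suc (r + e) \<Longrightarrow> Suc e = k \<Longrightarrow> thesis"
      moreover have "p = Suc (r + (p - Suc r))" if "r < p" using that by simp
      moreover have "Suc (p - Suc r) \<le> k" if "p < Suc r + k" using that k by linarith
      ultimately show thesis using *[of "p - Suc r"] by (metis le_eq_less_or_eq linorder_le_less_linear linorder_neqE_nat)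
    qed
    then show "(M_mat n (Suc r) (Suc r + k) z * B) $$ (p, c) = A $$ (p, c)"
    proof cases
      case 1
      then show ?thesis unfolding M_mat_mult_entry[OF B zero_less_Suc pc] using pc by (simp add: B_def)
    next
      case 2
      have "z (Suc r) = Y (Suc r)" "Y (Suc r) \<noteq> 0" using z[of "Suc r"] Y0[of "Suc r"] Yr k by auto
      moreover have "B $$ (r, c) = A $$ (r, c) / Y (Suc r)" using 2 pc k by (simp add: B_def W0)
      ultimately show ?thesis unfolding M_mat_mult_entry[OF B zero_less_Suc pc] using 2 by simp
    next
      case (3 e)
      have "z (Suc p) = Y (Suc p) / Y p" "Y p \<noteq> 0" "Y (Suc p) \<noteq> 0"
        using z[of "Suc p"] Y0[of p] Y0[of "Suc p"] 3 by auto
      moreover have "B $$ (p, c) = (-1) ^ Suc e * W (Suc e) c / Y (Suc p)" "B $$ (p - 1, c) = (-1) ^ e * W e c / Y p"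
        using 3 pc by (simp_all add: B_def)
      moreover have "(M_mat n (Suc r) (Suc r + k) z * B) $$ (p, c) = z (Suc p) * B $$ (p, c) + B $$ (p - 1, c)"
        unfolding M_mat_mult_entry[OF B zero_less_Suc pc] using 3 by simp
      moreover from calculation have "z (Suc p) * B $$ (p, c) = (-1) ^ Suc e * W (Suc e) c / Y p" by simp
      ultimately have "(M_mat n (Suc r) (Suc r + k) z * B) $$ (p, c) = (-1) ^ Suc e * W (Suc e) c / Y p + (-1) ^ e * W e c / Y p"
        by simp
      also have "\<dots> = (-1) ^ e * (W e c - W (Suc e) c) / Y p"
        by (simp add: right_diff_distrib diff_divide_distrib)
      finally have "(M_mat n (Suc r) (Suc r + k) z * B) $$ (p, c) = (-1) ^ e * (W e c - W (Suc e) c) / Y p" .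
      also have "\<dots> = (-1) ^ e * ((-1) ^ e * (Y p * A $$ (p, c))) / Y p"
        unfolding WS 3(1) by (simp add: mult.assoc)
      also have "\<dots> = A $$ (p, c)" unfolding sq using \<open>Y p \<noteq> 0\<close> by simp
      finally show ?thesis .
    next
      case (4 e)
      have Yp: "Y p \<noteq> 0" using Y0[of p] 4 by auto
      have "W e c = (-1) ^ e * (Y p * A $$ (p, c))" using Wk[OF pc(2)] WS[of e c] 4 by simp
      moreover have "B $$ (p, c) = 0" "B $$ (p - 1, c) = (-1) ^ e * W e c / Y p"
        using 4 pc by (simp_all add: B_def)
      ultimately have "B $$ (p - 1, c) = A $$ (p, c)" using Yp by (simp add: sq)
      then show ?thesis unfolding M_mat_mult_entry[OF B zero_less_Suc pc] using 4 \<open>B $$ (p, c) = 0\<close> by simp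
    next
      case 5
      then show ?thesis unfolding M_mat_mult_entry[OF B zero_less_Suc pc] using pc zero by (simp add: B_def)
    qed
  qed (use A B in \<open>auto simp: carrier_matD[OF M_mat_carrier]\<close>)
  then show ?thesis using that[OF B] by (auto simp: B_def)
qed

text \<open>
  The minors at \<open>coord_rows\<close> survive the peeling, being multiplied by nonzero factors.
  After the last factor only the first \<open>n - m\<close> rows are left, which are a multiple of the frame.
\<close>
lemma exists_stage:
  fixes A :: "complex mat"
  assumes m: "m < n" and t: "t \<noteq> 0"
  shows "r \<le> m \<Longrightarrow> A \<in> carrier_mat n (n - m) \<Longrightarrow>
    (\<And>i c. r + (n - m) \<le> i \<Longrightarrow> i < n \<Longrightarrow> c < n - m \<Longrightarrow> A $$ (i, c) = 0) \<Longrightarrow>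
    (\<And>i j. i \<le> r \<Longrightarrow> i \<le> j \<Longrightarrow> j \<le> i + (n - m) \<Longrightarrow> pminor A (coord_rows (n - m) r i j) \<noteq> 0) \<Longrightarrow>
    \<exists>X C. (\<forall>(s, j)\<in>RR n m. X (s, j) \<noteq> 0) \<and> C \<in> carrier_mat (n - m) (n - m) \<and> det C \<noteq> 0 \<and>
      A = stage n m (X, t) r * C"
proof (induction r arbitrary: A)
  case 0
  let ?k = "n - m"
  define C where "C = mat ?k ?k (\<lambda>(i, c). A $$ (i, c))"
  have "A = frame n ?k * C"
  proof (rule eq_matI)
    fix i c assume "i < dim_row (frame n ?k * C)" "c < dim_col (frame n ?k * C)"
    then have ic: "i < n" "c < ?k" by (auto simp: C_def frame_def)
    have "(frame n ?k * C) $$ (i, c) = (\<Sum>b<?k. (if i = b then 1 else 0) * C $$ (b, c))"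
      using ic by (auto simp: scalar_prod_def C_def frame_def lessThan_atLeast0)
    also have "\<dots> = (if i < ?k then C $$ (i, c) else 0)"
      by (simp add: if_distrib[of "\<lambda>x. x * _"] cong: if_cong)
    finally have "(frame n ?k * C) $$ (i, c) = (if i < ?k then C $$ (i, c) else 0)" .
    then show "A $$ (i, c) = (frame n ?k * C) $$ (i, c)"
      using ic 0(3)[of i c] by (simp add: C_def)
  qed (use 0 in \<open>auto simp: C_def frame_def\<close>)
  moreover have "det C \<noteq> 0"
    using 0(4)[of 0 0] pminor_coord_rows[OF 0(2), of 0 0 0] by (simp add: C_def)
  ultimately show ?case
    by (intro exI[of _ "\<lambda>_. 1"] exI[of _ C]) (auto simp: C_def)
next
  case (Suc r)
  let ?k = "n - m"
  have k: "0 < ?k" "Suc r + ?k \<le> n" "Suc r + n - m = Suc r + ?k" using m Suc.prems(1) by auto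
  define D where "D = pminor A (coord_rows ?k (Suc r) r r)"
  define Y where "Y = (\<lambda>j. pminor A (coord_rows ?k (Suc r) r j) / D)"
  have D: "D \<noteq> 0" unfolding D_def by (rule Suc.prems(4)) auto
  have Yr: "Y r = 1" using D by (simp add: Y_def D_def)
  have Y0: "Y p \<noteq> 0" if "r \<le> p" "p \<le> r + ?k" for p
    unfolding Y_def using Suc.prems(4)[of r p] that D by simp
  have DY: "D * Y j = pminor A (coord_rows ?k (Suc r) r j)" for j using D by (simp add: Y_def)
  \<comment> \<open>The last entry multiplies a zero row; it involves \<open>t\<close> so as to agree with \<open>x_coord\<close>.\<close>
  define z where "z = (\<lambda>p. (if p + m = Suc r + n then t else Y p) / Y (p - 1))"
  have z: "z p = Y p / Y (p - 1)" if "r < p" "p \<le> r + ?k" for p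
    using that k m by (auto simp: z_def)
  obtain B where B: "B \<in> carrier_mat n ?k" "\<And>i c. r + ?k \<le> i \<Longrightarrow> i < n \<Longrightarrow> c < ?k \<Longrightarrow> B $$ (i, c) = 0"
    "A = M_mat n (Suc r) (Suc r + ?k) z * B"
    by (rule peel_bidiagonal[OF Suc.prems(2) k(1,2) Suc.prems(3) D DY Y0 z Yr]) (assumption | rule that)+
  have Bmin: "pminor B (coord_rows ?k r i j) \<noteq> 0" if ij: "i \<le> r" "i \<le> j" "j \<le> i + ?k" for i j
  proof -
    have "pminor A (coord_rows ?k (Suc r) i j) = (if j \<le> r then 1 else Y j) * pminor B (coord_rows ?k r i j)"
      unfolding B(3) by (rule bidiagonal_minor_telescope[OF B(1) _ k(2) ij Yr Y0 z]) (use B(2) k in auto)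
    moreover have "pminor A (coord_rows ?k (Suc r) i j) \<noteq> 0" by (rule Suc.prems(4)) (use ij in auto)
    ultimately show ?thesis by auto
  qed
  obtain X C where X: "\<forall>(s, j)\<in>RR n m. X (s, j) \<noteq> 0" and C: "C \<in> carrier_mat ?k ?k" "det C \<noteq> 0"
    and BX: "B = stage n m (X, t) r * C"
    using Suc.IH[OF _ B(1,2) Bmin] Suc.prems(1) by auto
  define X' where "X' = (\<lambda>(s, j). if s = Suc r then Y j else X (s, j))"
  have st: "stage n m (X', t) r = stage n m (X, t) r"
    by (rule stage_cong) (use m Suc.prems(1) in \<open>auto simp: X'_def\<close>)
  have xe: "X_ext n m (X', t) (Suc r) p = (if p + m = Suc r + n then t else Y p)" if "r \<le> p" for p
    using that Yr m by (auto simp: X'_def)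
  have "M_mat n (Suc r) (Suc r + ?k) z = M_mat n (Suc r) (Suc r + ?k) (x_coord n m (X', t) (Suc r))"
  proof -
    have "x_coord n m (X', t) (Suc r) p = z p" if "r < p" "p \<le> Suc r + ?k" for p
    proof -
      have "(p - 1) + m \<noteq> Suc r + n" using that m by auto
      then show ?thesis unfolding x_coord_def z_def using xe[of p] xe[of "p - 1"] that by simp
    qed
    then show ?thesis unfolding M_mat_def by (intro eq_matI) (auto simp: Let_def)
  qed
  then have "A = M_mat n (Suc r) (Suc r + ?k) (x_coord n m (X', t) (Suc r)) * (stage n m (X', t) r * C)"
    using B(3) BX st by simp
  also have "\<dots> = stage n m (X', t) (Suc r) * C"
    unfolding stage.simps k(3) by (rule assoc_mult_mat[OF M_mat_carrier stage_carrier C(1), symmetric])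
  finally have AX: "A = stage n m (X', t) (Suc r) * C" .
  have "X' (s, j) \<noteq> 0" if "(s, j) \<in> RR n m" for s j
  proof (cases "s = Suc r")
    case True
    then have "r \<le> j" "j \<le> r + ?k" using that m Suc.prems(1) by (auto simp: RR_def)
    then show ?thesis using Y0[of j] True by (simp add: X'_def)
  qed (use X that in \<open>auto simp: X'_def\<close>)
  then show ?case using AX C by (intro exI[of _ X'] exI[of _ C]) auto
qed

context positive_functions
begin

text \<open>
  A matrix whose minors at \<open>coord_rows\<close> are positive up to a common factor represents a point of the
  torus with positive coordinates, since the coordinates are ratios of these minors.
\<close>
lemma pos_tpoint_of_minors:
  assumes m: "m < n" and N: "\<And>x. N x \<in> carrier_mat n (n - m)" and t: "pos t"
    and H: "\<And>i j. i \<le> m \<Longrightarrow> i \<le> j \<Longrightarrow> j \<le> i + (n - m) \<Longrightarrow> pos (H i j)"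
    and \<kappa>: "\<forall>\<^sub>F x in F. \<kappa> x \<noteq> 0"
    and min: "\<And>i j. i \<le> m \<Longrightarrow> i \<le> j \<Longrightarrow> j \<le> i + (n - m) \<Longrightarrow>
      \<forall>\<^sub>F x in F. pminor (N x) (coord_rows (n - m) m i j) = \<kappa> x * H i j x"
  obtains a where "pos_tpoint n m a" "\<And>x. snd (a x) = t x"
    "\<forall>\<^sub>F x in F. a x \<in> TT n m \<and> (\<exists>C\<in>carrier_mat (n - m) (n - m). det C \<noteq> 0 \<and> N x = stage n m (a x) m * C)"
proof -
  let ?k = "n - m"
  define a where "a = (\<lambda>x. (restrict (\<lambda>(s, j). H (s - 1) j x / H s j x) (RR n m), t x))"
  have "pos_tpoint n m a"
    unfolding pos_tpoint_def
  proof (intro conjI ballI)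
    fix sj assume "sj \<in> RR n m"
    then obtain s j where sj: "sj = (s, j)" "(s, j) \<in> RR n m" by (cases sj) auto
    have "pos (\<lambda>x. H (s - 1) j x / H s j x)"
      by (intro pos_divide H) (use sj in \<open>auto simp: RR_def\<close>)
    then show "case sj of (i, j) \<Rightarrow> pos (\<lambda>x. fst (a x) (i, j))" using sj by (simp add: a_def)
  qed (use t in \<open>simp add: a_def\<close>)
  moreover have "\<forall>\<^sub>F x in F. \<forall>(i, j)\<in>{(i, j). i \<le> m \<and> i \<le> j \<and> j \<le> i + ?k}.
      pminor (N x) (coord_rows ?k m i j) = \<kappa> x * H i j x \<and> H i j x \<noteq> 0"
  proof (rule eventually_ball_finite)
    have "{(i, j). i \<le> m \<and> i \<le> j \<and> j \<le> i + ?k} \<subseteq> {..m} \<times> {..m + ?k}" by auto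
    then show "finite {(i, j). i \<le> m \<and> i \<le> j \<and> j \<le> i + ?k}" by (rule finite_subset) simp
    show "\<forall>ij\<in>{(i, j). i \<le> m \<and> i \<le> j \<and> j \<le> i + ?k}. \<forall>\<^sub>F x in F. case ij of (i, j) \<Rightarrow>
        pminor (N x) (coord_rows ?k m i j) = \<kappa> x * H i j x \<and> H i j x \<noteq> 0"
      using eventually_conj[OF min pos_nonzero[OF H]] by auto
  qed
  then have "\<forall>\<^sub>F x in F. a x \<in> TT n m \<and> (\<exists>C\<in>carrier_mat ?k ?k. det C \<noteq> 0 \<and> N x = stage n m (a x) m * C)"
    using \<kappa> pos_nonzero[OF t]
  proof eventually_elim
    case (elim x)
    have e: "pminor (N x) (coord_rows ?k m i j) = \<kappa> x * H i j x" "H i j x \<noteq> 0"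
      if "i \<le> m" "i \<le> j" "j \<le> i + ?k" for i j using elim(1) that by auto
    obtain X C where X: "\<forall>(s, j)\<in>RR n m. X (s, j) \<noteq> 0" and C: "C \<in> carrier_mat ?k ?k" "det C \<noteq> 0"
      and NX: "N x = stage n m (X, t x) m * C"
      using exists_stage[OF m elim(3) order_refl N, of x] e elim(2) by auto
    have X': "\<And>s j. (s, j) \<in> RR n m \<Longrightarrow> fst (X, t x) (s, j) \<noteq> 0" using X by auto
    have ratio: "X (s, j) = H (s - 1) j x / H s j x" if sj: "(s, j) \<in> RR n m" for s j
    proof -
      have r: "s - 1 \<le> m" "s - 1 \<le> j" "j \<le> s - 1 + ?k" "s \<le> m" "s \<le> j" "j \<le> s + ?k"
        using sj by (auto simp: RR_def)
      have p: "pminor (stage n m (X, t x) m) (coord_rows ?k m i j) * det C = \<kappa> x * H i j x"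
        if "i \<le> m" "i \<le> j" "j \<le> i + ?k" for i
        using e(1)[OF that] pminor_mult[OF stage_carrier C(1), of "coord_rows ?k m i j"] coord_rows_props(3)[OF that] m
        by (simp add: NX)
      have "X (s, j) = pminor (stage n m (X, t x) m) (coord_rows ?k m (s - 1) j) / pminor (stage n m (X, t x) m) (coord_rows ?k m s j)"
        using coordinate_ratio[OF X' _ sj] m by simp
      also have "\<dots> = (pminor (stage n m (X, t x) m) (coord_rows ?k m (s - 1) j) * det C) / (pminor (stage n m (X, t x) m) (coord_rows ?k m s j) * det C)"
        using C by simp
      also have "\<dots> = H (s - 1) j x / H s j x" unfolding p[OF r(1-3)] p[OF r(4-6)] using elim(2) by simp
      finally show ?thesis .
    qed
    have "a x \<in> TT n m" using X elim(3) ratio unfolding a_def TT_def by (auto simp: PiE_iff)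
    moreover have "stage n m (a x) m = stage n m (X, t x) m"
      unfolding a_def by (rule stage_cong) (use m ratio in auto)
    ultimately show ?case using C NX by auto
  qed
  moreover have "snd (a x) = t x" for x by (simp add: a_def)
  ultimately show ?thesis using that by blast
qed

end

section \<open>The involution\<close>

text \<open>
  Minors with selected columns, for use with matrices that have more columns than their rank.
\<close>
definition minor2 :: "'a::comm_ring_1 mat \<Rightarrow> nat list \<Rightarrow> nat list \<Rightarrow> 'a" where
  "minor2 A xs cs = det (mat (length xs) (length xs) (\<lambda>(r, c). A $$ (xs ! r, cs ! c)))"

lemma minor2_append_upper_zero:
  fixes A :: "'a::idom mat"
  assumes "length xs = length cs" "length ys = length ds"
    and "\<And>i j. i \<in> set xs \<Longrightarrow> j \<in> set ds \<Longrightarrow> A $$ (i, j) = 0"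
  shows "minor2 A (xs @ ys) (cs @ ds) = minor2 A xs cs * minor2 A ys ds"
proof -
  let ?f = "\<lambda>(r, c). A $$ ((xs @ ys) ! r, (cs @ ds) ! c)"
  have "minor2 A (xs @ ys) (cs @ ds) = det (mat (length xs) (length xs) ?f) *
      det (mat (length ys) (length ys) (\<lambda>(i, j). ?f (length xs + i, length xs + j)))"
    unfolding minor2_def length_append
    by (rule det_block_upper_zero) (use assms in \<open>auto simp: nth_append\<close>)
  also have "mat (length xs) (length xs) ?f = mat (length xs) (length xs) (\<lambda>(r, c). A $$ (xs ! r, cs ! c))"
    by (rule eq_matI) (use assms(1) in \<open>auto simp: nth_append\<close>)
  also have "mat (length ys) (length ys) (\<lambda>(i, j). ?f (length xs + i, length xs + j)) =
      mat (length ys) (length ys) (\<lambda>(r, c). A $$ (ys ! r, ds ! c))"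
    by (rule eq_matI) (use assms(1) in \<open>auto simp: nth_append\<close>)
  finally show ?thesis by (simp add: minor2_def)
qed

lemma minor2_append_lower_zero:
  fixes A :: "'a::idom mat"
  assumes "length xs = length cs" "length ys = length ds"
    and "\<And>i j. i \<in> set ys \<Longrightarrow> j \<in> set cs \<Longrightarrow> A $$ (i, j) = 0"
  shows "minor2 A (xs @ ys) (cs @ ds) = minor2 A xs cs * minor2 A ys ds"
proof -
  let ?f = "\<lambda>(r, c). A $$ ((xs @ ys) ! r, (cs @ ds) ! c)"
  have "minor2 A (xs @ ys) (cs @ ds) = det (mat (length xs) (length xs) ?f) *
      det (mat (length ys) (length ys) (\<lambda>(i, j). ?f (length xs + i, length xs + j)))"
    unfolding minor2_def length_append
    by (rule det_block_lower_zero) (use assms in \<open>auto simp: nth_append\<close>)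
  also have "mat (length xs) (length xs) ?f = mat (length xs) (length xs) (\<lambda>(r, c). A $$ (xs ! r, cs ! c))"
    by (rule eq_matI) (use assms(1) in \<open>auto simp: nth_append\<close>)
  also have "mat (length ys) (length ys) (\<lambda>(i, j). ?f (length xs + i, length xs + j)) =
      mat (length ys) (length ys) (\<lambda>(r, c). A $$ (ys ! r, ds ! c))"
    by (rule eq_matI) (use assms(1) in \<open>auto simp: nth_append\<close>)
  finally show ?thesis by (simp add: minor2_def)
qed

lemma minor2_triangular:
  assumes "\<And>i j. s \<le> i \<Longrightarrow> i < j \<Longrightarrow> j < s + d \<Longrightarrow> A $$ (i, j) = 0"
  shows "minor2 A [s..<s + d] [s..<s + d] = (\<Prod>j<d. A $$ (s + j, s + j))"
proof -
  have "minor2 A [s..<s + d] [s..<s + d] = det (mat d d (\<lambda>(r, c). A $$ ([s..<s + d] ! r, [s..<s + d] ! c)))"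
    by (simp add: minor2_def)
  also have "\<dots> = (\<Prod>j<d. A $$ (s + j, s + j))"
    by (subst det_lower_triangular_fun) (auto intro!: assms)
  finally show ?thesis .
qed

lemma minor2_low_rank_mat:
  assumes N: "N \<in> carrier_mat n k" and J: "J \<subseteq> {..<n}" "card J = k" and cs: "length cs = k" "set cs \<subseteq> {..<n}"
  shows "minor2 (low_rank_mat n k N) (sorted_list_of_set J) cs = pminor N J * det (select_cols (window_cofactors n k N) cs)"
proof -
  have fin: "finite J" using J finite_subset by blast
  have "pminor (select_cols (low_rank_mat n k N) cs) J = minor2 (low_rank_mat n k N) (sorted_list_of_set J) cs"
  proof -
    have "mat k k (\<lambda>(r, c). select_cols (low_rank_mat n k N) cs $$ (sorted_list_of_set J ! r, c)) =
      mat k k (\<lambda>(r, c). low_rank_mat n k N $$ (sorted_list_of_set J ! r, cs ! c))"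
    proof (rule eq_matI)
      fix r c assume "r < dim_row (mat k k (\<lambda>(r, c). low_rank_mat n k N $$ (sorted_list_of_set J ! r, cs ! c)))"
        "c < dim_col (mat k k (\<lambda>(r, c). low_rank_mat n k N $$ (sorted_list_of_set J ! r, cs ! c)))"
      then have rc: "r < k" "c < k" by auto
      then have "sorted_list_of_set J ! r \<in> J"
        using fin J nth_mem[of r "sorted_list_of_set J"] by simp
      then have "sorted_list_of_set J ! r < n" using J by auto
      then show "mat k k (\<lambda>(r, c). select_cols (low_rank_mat n k N) cs $$ (sorted_list_of_set J ! r, c)) $$ (r, c) =
        mat k k (\<lambda>(r, c). low_rank_mat n k N $$ (sorted_list_of_set J ! r, cs ! c)) $$ (r, c)"
        using rc cs low_rank_mat_carrier[OF N] by (simp add: select_cols_def)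
    qed auto
    then show ?thesis using J cs by (simp add: pminor_def lminor_def minor2_def select_cols_def)
  qed
  then show ?thesis using pminor_low_rank_mat[OF N cs J(1)] by simp
qed

lemma sorted_list_of_two_intervals:
  assumes "b \<le> c"
  shows "sorted_list_of_set ({a..<b} \<union> {c..<d}) = [a..<b] @ [c..<d]"
  by (subst sorted_list_of_set_append) (use assms in auto)

text \<open>
  The columns selected here are combinations of the \<open>k = b + d\<close> columns of \<open>N\<close>, so that minors with different
  row sets are proportional to minors of \<open>N\<close>, and one row set suffices. At the rows
  \<open>{c - b..<c} \<union> {n - d..<n}\<close> the minor is block triangular. Each of its two diagonal blocks is found by
  comparing two minors that differ in that block only, one of which has a triangular matrix in its place.
\<close>
lemma twisted_minor:
  fixes N :: "'a::field mat"
  assumes N: "N \<in> carrier_mat n k" and k: "0 < k" "k < n" "k = b + d" and c: "b \<le> c" "c + d \<le> n"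
    and nz: "\<And>J. J \<subseteq> {..<n} \<Longrightarrow> card J = k \<Longrightarrow> pminor N J \<noteq> 0"
    and R: "R \<subseteq> {..<n}" "card R = k"
  shows "minor2 (low_rank_mat n k N) (sorted_list_of_set R) ([0..<b] @ [c..<c + d]) =
    pminor N R * (\<Prod>j<b. pminor N (insert j (window n k j))) * (\<Prod>j<d. pminor N (insert (c + j) (window n k (c + j)))) *
    pminor N ({c - b..<c} \<union> {n - d..<n}) / (pminor N ({0..<b} \<union> {n - d..<n}) * pminor N {c - b..<c + d})"
proof -
  let ?B = "low_rank_mat n k N" and ?F = "window_cofactors n k N"
  have kn: "k \<le> n" using k by simp
  have zero: "?B $$ (i, j) = 0" if "i < n" "j < n" "0 < cyclic_dist n i j" "cyclic_dist n i j < k" for i j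
    by (rule low_rank_mat_zero[OF N k(1) kn that(1,2)]) (use that in \<open>auto simp: window_def\<close>)
  have diag: "?B $$ (j, j) = pminor N (insert j (window n k j))" if "j < n" for j
    using low_rank_mat_entry[OF N k(1) kn that that] by simp
  have diag_nz: "?B $$ (j, j) \<noteq> 0" if "j < n" for j
  proof -
    have "j \<notin> window n k j" by (simp add: window_def cyclic_dist_def)
    then have "card (insert j (window n k j)) = k" using card_window[of k n j] that k by simp
    then show ?thesis unfolding diag[OF that] by (intro nz) (use that window_subset in auto)
  qed
  define K where "K = {c - b..<c} \<union> {n - d..<n}"
  define T0 where "T0 = {0..<b} \<union> {n - d..<n}"
  define V where "V = {c - b..<c + d}"
  have K: "K \<subseteq> {..<n}" "card K = k" "sorted_list_of_set K = [c - b..<c] @ [n - d..<n]"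
    unfolding K_def using k c by (auto simp: sorted_list_of_two_intervals card_Un_disjoint)
  have T0: "T0 \<subseteq> {..<n}" "card T0 = k" "sorted_list_of_set T0 = [0..<b] @ [n - d..<n]"
    unfolding T0_def using k c by (auto simp: sorted_list_of_two_intervals card_Un_disjoint)
  have "[c - b..<c + d] = [c - b..<c] @ [c..<c + d]"
    using upt_add_eq_append[of "c - b" c d] by simp
  then have V: "V \<subseteq> {..<n}" "card V = k" "sorted_list_of_set V = [c - b..<c] @ [c..<c + d]"
    unfolding V_def using k c by auto
  \<comment> \<open>\<open>X\<close> and \<open>Y\<close> are the diagonal blocks, \<open>D0\<close> and \<open>D2\<close> their triangular counterparts.\<close>
  define X where "X = minor2 ?B [c - b..<c] [0..<b]"
  define Y where "Y = minor2 ?B [n - d..<n] [c..<c + d]"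
  define Y0 where "Y0 = minor2 ?B [n - d..<n] [b..<b + d]"
  define D0 where "D0 = (\<Prod>j<b. ?B $$ (j, j))"
  define D1 where "D1 = (\<Prod>j<b. ?B $$ (c - b + j, c - b + j))"
  define D2 where "D2 = (\<Prod>j<d. ?B $$ (c + j, c + j))"
  have D: "D0 \<noteq> 0" "D1 \<noteq> 0" "D2 \<noteq> 0" unfolding D0_def D1_def D2_def using diag_nz k c by auto
  have tri0: "minor2 ?B [0..<b] [0..<b] = D0"
    using minor2_triangular[of 0 b ?B] zero k by (auto simp: D0_def cyclic_dist_if)
  have tri1: "minor2 ?B [c - b..<c] [c - b..<c] = D1"
    using minor2_triangular[of "c - b" b ?B] zero k c by (auto simp: D1_def cyclic_dist_if)
  have tri2: "minor2 ?B [c..<c + d] [c..<c + d] = D2"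
    using minor2_triangular[of c d ?B] zero k c by (auto simp: D2_def cyclic_dist_if)
  have low: "?B $$ (i, j) = 0" if "i \<in> set [n - d..<n]" "j \<in> set [0..<b]" for i j
    by (rule zero) (use that k in \<open>auto simp: cyclic_dist_if\<close>)
  have up: "?B $$ (i, j) = 0" if "i \<in> set [c - b..<c]" "j \<in> set [c..<c + d]" for i j
    by (rule zero) (use that k c in \<open>auto simp: cyclic_dist_if\<close>)
  have app: "[0..<k] = [0..<b] @ [b..<b + d]" unfolding k(3) using upt_add_eq_append[of 0 b d] by simp
  define f0 where "f0 = det (select_cols ?F [0..<k])"
  define f1 where "f1 = det (select_cols ?F ([c - b..<c] @ [c..<c + d]))"
  define f where "f = det (select_cols ?F ([0..<b] @ [c..<c + d]))"
  have set0: "length [0..<k] = k" "set [0..<k] \<subseteq> {..<n}" using k by auto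
  have set1: "length ([c - b..<c] @ [c..<c + d]) = k" "set ([c - b..<c] @ [c..<c + d]) \<subseteq> {..<n}" using k c by auto
  have set2: "length ([0..<b] @ [c..<c + d]) = k" "set ([0..<b] @ [c..<c + d]) \<subseteq> {..<n}" using k c by auto
  have lens: "length [c - b..<c] = length [0..<b]" "length [n - d..<n] = length [b..<b + d]"
    "length [n - d..<n] = length [c..<c + d]" "length [0..<b] = length [0..<b]"
    "length [c - b..<c] = length [c - b..<c]" "length [c..<c + d] = length [c..<c + d]" using k c by auto
  have e1: "X * Y0 = pminor N K * f0"
    using minor2_low_rank_mat[OF N K(1,2) set0] minor2_append_lower_zero[OF lens(1,2) low]
    unfolding K(3) app f0_def X_def Y0_def by simp
  have e2: "D0 * Y0 = pminor N T0 * f0"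
    using minor2_low_rank_mat[OF N T0(1,2) set0] minor2_append_lower_zero[OF lens(4,2) low]
    unfolding T0(3) app f0_def tri0[symmetric] Y0_def by simp
  have e3: "D1 * Y = pminor N K * f1"
    using minor2_low_rank_mat[OF N K(1,2) set1] minor2_append_upper_zero[OF lens(5,3) up]
    unfolding K(3) f1_def tri1[symmetric] Y_def by simp
  have e4: "D1 * D2 = pminor N V * f1"
    using minor2_low_rank_mat[OF N V(1,2) set1] minor2_append_upper_zero[OF lens(5,6) up]
    unfolding V(3) f1_def tri1[symmetric] tri2[symmetric] by simp
  have e5: "X * Y = pminor N K * f"
    using minor2_low_rank_mat[OF N K(1,2) set2] minor2_append_lower_zero[OF lens(1,3) low]
    unfolding K(3) f_def X_def Y_def by simp
  have P: "pminor N K \<noteq> 0" "pminor N T0 \<noteq> 0" "pminor N V \<noteq> 0" using nz K T0 V by auto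
  have "f0 \<noteq> 0" unfolding f0_def
    by (rule det_window_cofactors_first_nonzero[OF N k(1) kn]) (use diag diag_nz in auto)
  then have Y0: "Y0 \<noteq> 0" using e2 P(2) by auto
  have "X * pminor N T0 * f0 = X * (D0 * Y0)" unfolding e2 by simp
  also have "\<dots> = D0 * pminor N K * f0" using e1 by (simp add: mult_ac)
  finally have X: "X = D0 * pminor N K / pminor N T0" using \<open>f0 \<noteq> 0\<close> P by (simp add: field_simps)
  have f1: "f1 = D1 * D2 / pminor N V" using e4 P by (simp add: field_simps)
  have "D1 * Y = D1 * (D2 * pminor N K / pminor N V)" unfolding e3 f1 by simp
  then have Y: "Y = D2 * pminor N K / pminor N V" unfolding mult_left_cancel[OF D(2)] .
  have "f = X * Y / pminor N K" using e5 P by (simp add: field_simps)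
  also have "\<dots> = D0 * D2 * pminor N K / (pminor N T0 * pminor N V)" unfolding X Y using P by (simp add: field_simps)
  finally have f: "f = D0 * D2 * pminor N K / (pminor N T0 * pminor N V)" .
  have "minor2 ?B (sorted_list_of_set R) ([0..<b] @ [c..<c + d]) = pminor N R * f"
    unfolding f_def by (rule minor2_low_rank_mat[OF N R set2])
  moreover have "D0 = (\<Prod>j<b. pminor N (insert j (window n k j)))" "D2 = (\<Prod>j<d. pminor N (insert (c + j) (window n k (c + j))))"
    unfolding D0_def D2_def using diag k c by auto
  ultimately show ?thesis unfolding f K_def T0_def V_def by (simp add: mult.assoc)
qed

text \<open>
  The flip is a transposition together with a reversal of rows and of columns, whose signs cancel.
\<close>
lemma det_transpose_reverse:
  fixes f :: "nat \<Rightarrow> nat \<Rightarrow> 'a::comm_ring_1"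
  shows "det (mat k k (\<lambda>(a, c). f (k - 1 - c) (k - 1 - a))) = det (mat k k (\<lambda>(a, c). f a c))"
proof -
  let ?p = "\<lambda>i. if i < k then k - 1 - i else i"
  have p: "?p permutes {0..<k}"
    by (rule bij_imp_permutes) (auto intro!: bij_betwI[where g = ?p])
  have rev_rows: "det (mat k k (\<lambda>(i, j). A $$ (?p i, j))) = signof ?p * det A"
    if "A \<in> carrier_mat k k" for A :: "'a mat"
    by (rule det_permute_rows[OF that p])
  let ?A = "mat k k (\<lambda>(a, c). f a c)"
  let ?B = "mat k k (\<lambda>(i, j). ?A $$ (?p i, j))"
  let ?C = "mat k k (\<lambda>(i, j). ?B\<^sup>T $$ (?p i, j))"
  have "mat k k (\<lambda>(a, c). f (k - 1 - c) (k - 1 - a)) = ?C"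
    by (rule eq_matI) auto
  then have "det (mat k k (\<lambda>(a, c). f (k - 1 - c) (k - 1 - a))) = det ?C" by simp
  also have "\<dots> = signof ?p * det ?B\<^sup>T" by (rule rev_rows) simp
  also have "det ?B\<^sup>T = det ?B" by (rule det_transpose[of _ k]) simp
  also have "\<dots> = signof ?p * det ?A" by (rule rev_rows) simp
  finally show ?thesis by (simp add: sign_def flip: mult.assoc)
qed

text \<open>
  The rows of the flip are columns of \<open>plucker_mat\<close>. At a parameter where the latter has rank \<open>k\<close>, this reduces
  the minors of the flip that matter for the coordinates to those of \<open>twisted_minor\<close>.
\<close>
lemma flip_minor:
  fixes N :: "complex mat"
  assumes N: "N \<in> carrier_mat n k" and k: "0 < k" "k < n" and \<mu>: "\<mu> * (-1) ^ (k - 1) = t"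
    and ij: "i \<le> n - k" "i \<le> j" "j \<le> i + k"
    and Fl: "Fl \<in> carrier_mat n k" "\<And>a c. a < n \<Longrightarrow> c < k \<Longrightarrow> Fl $$ (a, c) = plucker_mat n k t \<mu> \<delta> N $$ (n - 1 - c, n - 1 - a)"
  defines "ix \<equiv> \<lambda>a. if a < j - i then i + a else n - k + a"
  shows "pminor Fl (coord_rows k (n - k) i j) = (\<Prod>a<k. t * \<delta> (n - 1 - ix a)) *
    minor2 (low_rank_mat n k N) (sorted_list_of_set {n - k..<n})
      ([0..<k - (j - i)] @ [n - i - (j - i)..<n - i - (j - i) + (j - i)])"
proof -
  let ?B = "low_rank_mat n k N" and ?d = "j - i" and ?cs = "[0..<k - (j - i)] @ [n - i - (j - i)..<n - i - (j - i) + (j - i)]"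
  have kn: "k \<le> n" using k by simp
  have ix: "ix a < n" if "a < k" for a using that ij k by (auto simp: ix_def)
  have cs: "?cs ! c = n - 1 - ix (k - 1 - c)" if "c < k" for c
    using that ij k by (auto simp: ix_def nth_append)
  have "pminor Fl (coord_rows k (n - k) i j) = det (mat k k (\<lambda>(a, c). Fl $$ (ix a, c)))"
    unfolding ix_def by (rule pminor_coord_rows[OF Fl(1) ij])
  also have "mat k k (\<lambda>(a, c). Fl $$ (ix a, c)) =
      diagm k (\<lambda>a. t * \<delta> (n - 1 - ix a)) * mat k k (\<lambda>(a, c). ?B $$ (n - 1 - c, n - 1 - ix a))"
    (is "_ = ?D * ?M")
  proof (rule eq_matI)
    fix a c assume "a < dim_row (?D * ?M)" "c < dim_col (?D * ?M)"
    then have ac: "a < k" "c < k" by (auto simp: diagm_def)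
    have "(?D * ?M) $$ (a, c) = (\<Sum>p<k. (if a = p then t * \<delta> (n - 1 - ix p) else 0) * ?M $$ (p, c))"
      using ac by (auto simp: scalar_prod_def diagm_def lessThan_atLeast0 diff_diff_left intro!: sum.cong)
    also have "\<dots> = t * \<delta> (n - 1 - ix a) * ?B $$ (n - 1 - c, n - 1 - ix a)"
      using ac by (simp add: if_distrib[of "\<lambda>x. x * _"] cong: if_cong)
    also have "\<dots> = plucker_mat n k t \<mu> \<delta> N $$ (n - 1 - c, n - 1 - ix a)"
      by (subst plucker_mat_low_rank_mat[OF N k(1) kn]) (use ac k ix \<mu> in auto)
    finally show "mat k k (\<lambda>(a, c). Fl $$ (ix a, c)) $$ (a, c) = (?D * ?M) $$ (a, c)"
      using ac Fl(2) ix by simp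
  qed (auto simp: diagm_def)
  also have "det (?D * ?M) = det ?D * det ?M" by (rule det_mult[of _ k]) auto
  also have "det ?D = (\<Prod>a<k. t * \<delta> (n - 1 - ix a))" by (rule det_diagm)
  also have "det ?M = det (mat k k (\<lambda>(a, c). (\<lambda>r s. ?B $$ (n - k + r, ?cs ! s)) (k - 1 - c) (k - 1 - a)))"
  proof (rule arg_cong[where f = det], rule eq_matI)
    fix a c assume "a < dim_row (mat k k (\<lambda>(a, c). (\<lambda>r s. ?B $$ (n - k + r, ?cs ! s)) (k - 1 - c) (k - 1 - a)))"
      "c < dim_col (mat k k (\<lambda>(a, c). (\<lambda>r s. ?B $$ (n - k + r, ?cs ! s)) (k - 1 - c) (k - 1 - a)))"
    then have ac: "a < k" "c < k" by auto
    have "k - 1 - (k - 1 - a) = a" "n - k + (k - 1 - c) = n - 1 - c" "k - 1 - a < k" using ac k by auto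
    then show "?M $$ (a, c) = mat k k (\<lambda>(a, c). (\<lambda>r s. ?B $$ (n - k + r, ?cs ! s)) (k - 1 - c) (k - 1 - a)) $$ (a, c)"
      using ac cs[of "k - 1 - a"] by simp
  qed auto
  also have "\<dots> = det (mat k k (\<lambda>(r, s). ?B $$ (n - k + r, ?cs ! s)))"
    by (rule det_transpose_reverse)
  also have "\<dots> = minor2 ?B (sorted_list_of_set {n - k..<n}) ?cs"
    unfolding minor2_def using k
    by (simp, intro arg_cong[where f = det] eq_matI) auto
  finally show ?thesis .
qed

section \<open>Subspaces, representing matrices and Pluecker coordinates\<close>

lemma col_space_iff:
  fixes A :: "complex mat"
  assumes "A \<in> carrier_mat n k"
  shows "v \<in> vec_space.col_space n A \<longleftrightarrow> (\<exists>x\<in>carrier_vec k. A *\<^sub>v x = v)"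
  using assms by (subst vec_space.col_space_eq[OF assms]) auto

lemma col_space_mult:
  fixes A :: "complex mat"
  assumes A: "A \<in> carrier_mat n k" and C: "C \<in> carrier_mat k k" "det C \<noteq> 0"
  shows "vec_space.col_space n (A * C) = vec_space.col_space n A"
proof -
  obtain D where D: "D \<in> carrier_mat k k" "C * D = 1\<^sub>m k"
    using det_non_zero_imp_unit[OF C] by (auto simp: Units_def ring_mat_def)
  have AC: "A * C \<in> carrier_mat n k" using A C by simp
  have "(\<exists>x\<in>carrier_vec k. (A * C) *\<^sub>v x = v) \<longleftrightarrow> (\<exists>x\<in>carrier_vec k. A *\<^sub>v x = v)" for v
  proof
    assume "\<exists>x\<in>carrier_vec k. (A * C) *\<^sub>v x = v"
    then obtain x where x: "x \<in> carrier_vec k" "(A * C) *\<^sub>v x = v" by blast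
    then have "A *\<^sub>v (C *\<^sub>v x) = v" using A C by (simp add: assoc_mult_mat_vec[OF A C(1)])
    moreover have "C *\<^sub>v x \<in> carrier_vec k" using C x by simp
    ultimately show "\<exists>x\<in>carrier_vec k. A *\<^sub>v x = v" by blast
  next
    assume "\<exists>x\<in>carrier_vec k. A *\<^sub>v x = v"
    then obtain x where x: "x \<in> carrier_vec k" "A *\<^sub>v x = v" by blast
    have "C *\<^sub>v (D *\<^sub>v x) = (C * D) *\<^sub>v x" by (rule assoc_mult_mat_vec[OF C(1) D(1) x(1), symmetric])
    also have "\<dots> = x" using D x by simp
    finally have CD: "C *\<^sub>v (D *\<^sub>v x) = x" .
    have Dx: "D *\<^sub>v x \<in> carrier_vec k" using D x by simp
    have "(A * C) *\<^sub>v (D *\<^sub>v x) = A *\<^sub>v (C *\<^sub>v (D *\<^sub>v x))" by (rule assoc_mult_mat_vec[OF A C(1) Dx])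
    then show "\<exists>x\<in>carrier_vec k. (A * C) *\<^sub>v x = v" using Dx CD x by auto
  qed
  then show ?thesis using col_space_iff[OF A] col_space_iff[OF AC] by blast
qed

lemma col_space_factor:
  fixes A B :: "complex mat"
  assumes A: "A \<in> carrier_mat n k" and B: "B \<in> carrier_mat n k"
    and eq: "vec_space.col_space n A = vec_space.col_space n B"
  obtains C where "C \<in> carrier_mat k k" "A = B * C"
proof -
  have "\<exists>x\<in>carrier_vec k. B *\<^sub>v x = col A j" if j: "j < k" for j
  proof -
    have "A *\<^sub>v unit_vec k j = col A j" using A j by (intro eq_vecI) auto
    then have "col A j \<in> vec_space.col_space n A"
      using col_space_iff[OF A, of "col A j"] unit_vec_carrier by blast
    then show ?thesis using eq col_space_iff[OF B] by blast
  qed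
  then obtain x where x: "\<And>j. j < k \<Longrightarrow> x j \<in> carrier_vec k \<and> B *\<^sub>v x j = col A j" by metis
  define C where "C = mat k k (\<lambda>(i, j). x j $ i)"
  have C: "C \<in> carrier_mat k k" by (simp add: C_def)
  moreover have "A = B * C"
  proof (rule eq_matI)
    fix i j assume "i < dim_row (B * C)" "j < dim_col (B * C)"
    then have ij: "i < n" "j < k" using B C by auto
    have "col C j = x j" using ij x[of j] by (intro eq_vecI) (auto simp: C_def)
    moreover have "(B *\<^sub>v x j) $ i = A $$ (i, j)" using x[of j] ij A by simp
    ultimately show "A $$ (i, j) = (B * C) $$ (i, j)" using ij B C by simp
  qed (use A B C in auto)
  ultimately show ?thesis using that by blast
qed

lemma full_rank_of_minor:
  fixes A :: "complex mat"
  assumes A: "A \<in> carrier_mat n k" and J: "J \<subseteq> {..<n}" "card J = k" "pminor A J \<noteq> 0"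
  shows "A \<in> full_rank_mats n k"
proof -
  have "det (submatrix A J UNIV) \<noteq> 0" using det_submatrix_eq_pminor[OF A J(1,2)] J by simp
  from vec_space.rank_gt_minor[OF A this] have "k \<le> vec_space.rank n A" by simp
  moreover have "vec_space.rank n A \<le> k" by (rule vec_space.rank_le_nc[OF A])
  ultimately show ?thesis using A by (simp add: full_rank_mats_def)
qed

text \<open>
  Whatever representative of a subspace is chosen, its minors differ from those of \<open>A\<close> by a common factor.
\<close>
lemma rep_mat_factor:
  fixes A :: "complex mat"
  assumes A: "A \<in> carrier_mat n k" and J: "J \<subseteq> {..<n}" "card J = k" "pminor A J \<noteq> 0"
  obtains c where "c \<noteq> 0"
    "\<And>I. I \<subseteq> {..<n} \<Longrightarrow> pminor (rep_mat n k (vec_space.col_space n A)) I = c * pminor A I"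
    "rep_mat n k (vec_space.col_space n A) \<in> carrier_mat n k"
proof -
  let ?R = "rep_mat n k (vec_space.col_space n A)"
  have "?R \<in> full_rank_mats n k \<and> vec_space.col_space n ?R = vec_space.col_space n A"
    unfolding rep_mat_def by (rule someI[of _ A]) (use full_rank_of_minor[OF assms] in simp)
  then have R: "?R \<in> carrier_mat n k" "vec_space.col_space n ?R = vec_space.col_space n A"
    by (auto simp: full_rank_mats_def)
  obtain C where C: "C \<in> carrier_mat k k" "?R = A * C" by (rule col_space_factor[OF R(1) A R(2)])
  obtain D where D: "D \<in> carrier_mat k k" "A = ?R * D" by (rule col_space_factor[OF A R(1) R(2)[symmetric]])
  have RI: "pminor ?R I = pminor A I * det C" if "I \<subseteq> {..<n}" for I
    unfolding C(2) by (rule pminor_mult[OF A C(1) that])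
  have "pminor A J = pminor ?R J * det D"
    by (subst D(2)) (rule pminor_mult[OF R(1) D(1) J(1)])
  then have "det C \<noteq> 0" using J RI[OF J(1)] by auto
  then show ?thesis using that[of "det C"] RI R(1) by (simp add: mult.commute)
qed

lemma reduce_interval:
  assumes j: "j < n" and l: "l < n"
  shows "reduce n {int (Suc j) - int l..int (Suc j) - 1} = window n (Suc l) j"
    and "reduce n ({int (Suc j) - int l + 1..int (Suc j) - 1} \<union> {int (Suc i)}) =
      insert (i mod n) (window n l j)"
proof -
  have main: "reduce n {int (Suc j) - int l + 1..int (Suc j) - 1} = window n l j" if l: "l \<le> n" for l
  proof
    show "reduce n {int (Suc j) - int l + 1..int (Suc j) - 1} \<subseteq> window n l j"
    proof
      fix x assume "x \<in> reduce n {int (Suc j) - int l + 1..int (Suc j) - 1}"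
      then obtain m where "m \<in> {int (Suc j) - int l + 1..int (Suc j) - 1}" and x: "x = nat ((m - 1) mod int n)"
        by (auto simp: reduce_def)
      then have m: "int j - int l + 1 < m" "m \<le> int j" by auto
      show "x \<in> window n l j"
      proof (cases "1 \<le> m")
        case True
        then have "(m - 1) mod int n = m - 1" using m j by (intro mod_pos_pos_trivial) auto
        then show ?thesis using m x True j l by (auto simp: window_def cyclic_dist_if)
      next
        case False
        have "(m - 1) mod int n = (m - 1 + int n) mod int n" by simp
        also have "\<dots> = m - 1 + int n" using m j l False by (intro mod_pos_pos_trivial) auto
        finally have "x = nat (m - 1 + int n)" using x by simp
        then show ?thesis using m False j l by (auto simp: window_def cyclic_dist_if)
      qed
    qed
    show "window n l j \<subseteq> reduce n {int (Suc j) - int l + 1..int (Suc j) - 1}"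
    proof
      fix x assume x: "x \<in> window n l j"
      then have xn: "x < n" by (simp add: window_def)
      show "x \<in> reduce n {int (Suc j) - int l + 1..int (Suc j) - 1}"
      proof (cases "x \<le> j")
        case True
        have "x = nat ((int x + 1 - 1) mod int n)" using xn by simp
        moreover have "int x + 1 \<in> {int (Suc j) - int l + 1..int (Suc j) - 1}"
          using x True xn j by (auto simp: window_def cyclic_dist_if)
        ultimately show ?thesis unfolding reduce_def by (rule image_eqI)
      next
        case False
        have "(int x + 1 - int n - 1) mod int n = (int x - int n + int n) mod int n" by (simp only: mod_add_self2) simp
        then have "x = nat ((int x + 1 - int n - 1) mod int n)" using xn by simp
        moreover have "int x + 1 - int n \<in> {int (Suc j) - int l + 1..int (Suc j) - 1}"
          using x False xn j by (auto simp: window_def cyclic_dist_if)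
        ultimately show ?thesis unfolding reduce_def by (rule image_eqI)
      qed
    qed
  qed
  show "reduce n {int (Suc j) - int l..int (Suc j) - 1} = window n (Suc l) j"
  proof -
    have e: "int (Suc j) - int l = int (Suc j) - int (Suc l) + 1" by simp
    show ?thesis unfolding e by (rule main) (use l in simp)
  qed
  have "reduce n ({int (Suc j) - int l + 1..int (Suc j) - 1} \<union> {int (Suc i)}) =
      insert (nat (int i mod int n)) (reduce n {int (Suc j) - int l + 1..int (Suc j) - 1})"
    by (simp add: reduce_def)
  then show "reduce n ({int (Suc j) - int l + 1..int (Suc j) - 1} \<union> {int (Suc i)}) = insert (i mod n) (window n l j)"
    using main[of l] l by (simp flip: zmod_int)
qed

section \<open>Evaluating the maps on matrices\<close>

text \<open>
  The factor \<open>1 / s\<close> accounts for the entries in the first \<open>l\<close> columns of \<open>g\<close>, which carry no \<open>s\<close>. The value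
  \<open>1\<close> outside the range makes the factors positive for all indices.
\<close>
definition column_scale :: "nat \<Rightarrow> nat \<Rightarrow> complex \<Rightarrow> complex mat \<Rightarrow> nat \<Rightarrow> complex" where
  "column_scale n l s A j = (if j < n then (if j < l then 1 / s else 1) / pminor A (window n (Suc l) j) else 1)"

text \<open>
  In the first \<open>l\<close> columns the entries of \<open>g\<close> above the diagonal vanish because \<open>i\<close> lies in the window, so that
  the coefficient \<open>\<mu>\<close> may be put there.
\<close>
lemma g_mat_eval:
  fixes A :: "complex mat"
  assumes A: "A \<in> carrier_mat n l" and l: "0 < l" "l < n" and s: "s \<noteq> 0"
    and nz: "\<And>j. j < n \<Longrightarrow> pminor A (window n (Suc l) j) \<noteq> 0"
  obtains G where "g_mat n l (vec_space.col_space n A, s) = Some G" "G \<in> carrier_mat n n"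
    "\<And>\<mu> i j. i < n \<Longrightarrow> j < n \<Longrightarrow> poly (G $$ (i, j)) \<mu> = plucker_mat n l s \<mu> (column_scale n l s A) A $$ (i, j)"
proof -
  let ?N = "vec_space.col_space n A" and ?P = "plucker n l (vec_space.col_space n A)"
  have cV: "card (window n (Suc l) j) = l" if "j < n" for j using card_window[of "Suc l" n j] l that by simp
  have n0: "0 < n" using l by simp
  note V0 = window_subset[of n "Suc l" 0] cV[OF n0] nz[OF n0]
  obtain c where c: "c \<noteq> 0" "\<And>I. I \<subseteq> {..<n} \<Longrightarrow> pminor (rep_mat n l ?N) I = c * pminor A I"
    and R: "rep_mat n l ?N \<in> carrier_mat n l"
    by (rule rep_mat_factor[OF A V0]) (rule that)
  have P: "?P J = c * pminor A (reduce n J)" if "reduce n J \<subseteq> {..<n}" for J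
  proof (cases "card (reduce n J) = l")
    case True
    then show ?thesis
      using c(2)[OF that] det_submatrix_eq_pminor[OF R that True] by (simp add: plucker_def)
  next
    case False
    then show ?thesis using A by (simp add: plucker_def pminor_def)
  qed
  have PV: "?P {int (Suc j) - int l..int (Suc j) - 1} = c * pminor A (window n (Suc l) j)" if "j < n" for j
    using P[of "{int (Suc j) - int l..int (Suc j) - 1}"] reduce_interval(1)[OF that l(2)] window_subset by simp
  have PI: "?P ({int (Suc j) - int l + 1..int (Suc j) - 1} \<union> {int (Suc i)}) = c * pminor A (insert i (window n l j))"
    if "i < n" "j < n" for i j
    using P[of "{int (Suc j) - int l + 1..int (Suc j) - 1} \<union> {int (Suc i)}"]
      reduce_interval(2)[OF that(2) l(2), of i] window_subset[of n l j] that by simp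
  have XX: "(?N, s) \<in> XX n l"
    using full_rank_of_minor[OF A V0] s by (simp add: XX_def Gr_def)
  have PV': "?P {int j - int l..int j - 1} \<noteq> 0" if jn: "j \<in> {1..n}" for j
  proof -
    obtain j' where "j = Suc j'" "j' < n" using jn by (cases j) auto
    then show ?thesis using PV[of j'] nz[of j'] c by simp
  qed
  define G where "G = mat n n (\<lambda>(i0, j0). let i = i0 + 1; j = j0 + 1 in
        Polynomial.smult (?P ({int j - int l + 1..int j - 1} \<union> {int i}) / ?P {int j - int l..int j - 1})
          (c_coeff l s i j))"
  have "g_mat n l (?N, s) = Some G" unfolding g_mat.simps G_def using XX PV' by simp
  moreover have "G \<in> carrier_mat n n" by (simp add: G_def)
  moreover have "poly (G $$ (i, j)) \<mu> = plucker_mat n l s \<mu> (column_scale n l s A) A $$ (i, j)" if ij: "i < n" "j < n" for \<mu> i j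
  proof -
    have "G $$ (i, j) = Polynomial.smult (pminor A (insert i (window n l j)) / pminor A (window n (Suc l) j)) (c_coeff l s (Suc i) (Suc j))"
      using ij PV[OF ij(2)] PI[OF ij] c(1) by (simp add: G_def Let_def)
    then have G: "poly (G $$ (i, j)) \<mu> = pminor A (insert i (window n l j)) / pminor A (window n (Suc l) j) *
        (if j < l then 1 else if j \<le> i then s else \<mu>)"
      by (simp add: c_coeff_def)
    show ?thesis
    proof (cases "j < l \<and> i < j")
      case True
      then have "i \<in> window n l j" using ij by (auto simp: window_def cyclic_dist_if)
      moreover have "dim_col A = Suc (card (window n l j))" using A card_window[of l n j] l ij by simp
      ultimately have "pminor A (insert i (window n l j)) = 0" by (rule pminor_mem)
      then show ?thesis using G ij by (simp add: plucker_mat_def)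
    next
      case False
      then show ?thesis using G ij s by (auto simp: plucker_mat_def column_scale_def)
    qed
  qed
  ultimately show ?thesis using that by blast
qed

text \<open>
  The first \<open>k\<close> columns of \<open>g(N|t)\<close> span \<open>N\<close>, so in \<open>Psi\<close> the second factor acts only through \<open>N\<close>.
\<close>
lemma first_cols_special:
  fixes N :: "complex mat"
  assumes N: "N \<in> carrier_mat n k" and k: "0 < k" "k < n" and \<mu>: "\<mu> * (-1) ^ (k - 1) = t" and t: "t \<noteq> 0"
    and nz: "\<And>j. j < n \<Longrightarrow> pminor N (insert j (window n k j)) \<noteq> 0" and \<delta>: "\<And>j. j < n \<Longrightarrow> \<delta> j \<noteq> 0"
  obtains C where "C \<in> carrier_mat k k" "det C \<noteq> 0" "select_cols (plucker_mat n k t \<mu> \<delta> N) [0..<k] = N * C"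
proof -
  have kn: "k \<le> n" using k by simp
  let ?F = "select_cols (window_cofactors n k N) [0..<k]"
  let ?C = "?F * diagm k (\<lambda>j. t * \<delta> j)"
  have F: "?F \<in> carrier_mat k k" by (simp add: select_cols_def window_cofactors_def)
  have C: "?C \<in> carrier_mat k k" by (rule mult_carrier_mat[OF F diagm_carrier])
  have "det ?C = det ?F * (\<Prod>j<k. t * \<delta> j)"
    using det_mult[OF F diagm_carrier] by (simp add: det_diagm)
  moreover have "det ?F \<noteq> 0" by (rule det_window_cofactors_first_nonzero[OF N k(1) kn nz])
  ultimately have "det ?C \<noteq> 0" using t \<delta> k by auto
  moreover have "select_cols (plucker_mat n k t \<mu> \<delta> N) [0..<k] = N * ?C"
  proof -
    have "N * ?F = select_cols (low_rank_mat n k N) [0..<k]"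
      unfolding low_rank_mat_def by (rule select_cols_mult[OF N window_cofactors_carrier, symmetric]) (use k in auto)
    then have NC: "N * ?C = select_cols (low_rank_mat n k N) [0..<k] * diagm k (\<lambda>j. t * \<delta> j)"
      using assoc_mult_mat[OF N F diagm_carrier] by simp
    have E: "select_cols (low_rank_mat n k N) [0..<k] \<in> carrier_mat n k"
      using low_rank_mat_carrier[OF N] by (simp add: select_cols_def)
    show ?thesis
      unfolding NC
    proof (rule eq_matI)
      fix i j assume "i < dim_row (select_cols (low_rank_mat n k N) [0..<k] * diagm k (\<lambda>j. t * \<delta> j))"
        "j < dim_col (select_cols (low_rank_mat n k N) [0..<k] * diagm k (\<lambda>j. t * \<delta> j))"
      then have ij: "i < n" "j < k" "j < n" using E k by (auto simp: diagm_def)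
      have "select_cols (plucker_mat n k t \<mu> \<delta> N) [0..<k] $$ (i, j) = plucker_mat n k t \<mu> \<delta> N $$ (i, j)"
        using ij by (simp add: select_cols_def carrier_matD[OF plucker_mat_carrier])
      also have "\<dots> = t * low_rank_mat n k N $$ (i, j) * \<delta> j"
        unfolding plucker_mat_low_rank_mat[OF N k(1) kn ij(1,3)] \<mu> by simp
      also have "\<dots> = select_cols (low_rank_mat n k N) [0..<k] $$ (i, j) * (t * \<delta> j)"
        using ij low_rank_mat_carrier[OF N] by (simp add: select_cols_def)
      finally show "select_cols (plucker_mat n k t \<mu> \<delta> N) [0..<k] $$ (i, j) =
          (select_cols (low_rank_mat n k N) [0..<k] * diagm k (\<lambda>j. t * \<delta> j)) $$ (i, j)"
        unfolding mult_diagm[OF E ij(1,2)] .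
    qed (use E in \<open>auto simp: select_cols_def diagm_def carrier_matD[OF plucker_mat_carrier] low_rank_mat_carrier[OF N]\<close>)
  qed
  ultimately show ?thesis using that C by blast
qed

lemma proj_eval:
  fixes B :: "complex mat"
  assumes "z \<noteq> 0" and B: "B \<in> carrier_mat n k" and J: "J \<subseteq> {..<n}" "card J = k" "pminor B J \<noteq> 0"
    and G: "G \<in> carrier_mat n n" "k \<le> n"
    and eq: "\<And>i c. i < n \<Longrightarrow> c < k \<Longrightarrow> poly (G $$ (i, c)) ((-1) ^ (k - 1) * z) = B $$ (i, c)"
  shows "proj n k z G = Some (vec_space.col_space n B, z)"
proof -
  have "first_cols n k (map_mat (\<lambda>p. poly p ((-1) ^ (k - 1) * z)) G) = B"
    unfolding first_cols_def by (rule eq_matI) (use B G eq in auto)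
  then show ?thesis using full_rank_of_minor[OF B J] assms(1) by (simp add: proj_def)
qed

lemma Psi_eval:
  fixes A B :: "complex mat"
  assumes A: "A \<in> carrier_mat n l" and B: "B \<in> carrier_mat n k" and l: "0 < l" "l < n" and k: "0 < k" "k < n"
    and s: "s \<noteq> 0" and t: "t \<noteq> 0"
    and nzA: "\<And>J. J \<subseteq> {..<n} \<Longrightarrow> card J = l \<Longrightarrow> pminor A J \<noteq> 0"
    and nzB: "\<And>J. J \<subseteq> {..<n} \<Longrightarrow> card J = k \<Longrightarrow> pminor B J \<noteq> 0"
    and J: "J \<subseteq> {..<n}" "card J = k"
      "pminor (plucker_mat n l s ((-1) ^ (k - 1) * t) (column_scale n l s A) A * B) J \<noteq> 0"
  shows "Psi n k l ((vec_space.col_space n A, s), (vec_space.col_space n B, t)) =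
    Some (vec_space.col_space n (plucker_mat n l s ((-1) ^ (k - 1) * t) (column_scale n l s A) A * B), t)"
proof -
  let ?\<mu> = "(-1) ^ (k - 1) * t"
  let ?A = "plucker_mat n l s ?\<mu> (column_scale n l s A) A" and ?B = "plucker_mat n k t ?\<mu> (column_scale n k t B) B"
  have window: "card (window n (Suc r) j) = r" "card (insert j (window n r j)) = r" "insert j (window n r j) \<subseteq> {..<n}"
    if "j < n" "0 < r" "r < n" for j r
  proof -
    show "card (window n (Suc r) j) = r" using card_window[of "Suc r" n j] that by simp
    have "j \<notin> window n r j" by (simp add: window_def cyclic_dist_def)
    then show "card (insert j (window n r j)) = r" using card_window[of r n j] that by simp
    show "insert j (window n r j) \<subseteq> {..<n}" using that window_subset by auto
  qed
  have VA: "pminor A (window n (Suc l) j) \<noteq> 0" if "j < n" for j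
    by (rule nzA[OF window_subset window(1)[OF that l]])
  have VB: "pminor B (window n (Suc k) j) \<noteq> 0" "pminor B (insert j (window n k j)) \<noteq> 0" if "j < n" for j
    using nzB[OF window_subset window(1)[OF that k]] nzB[OF window(3,2)[OF that k]] by auto
  obtain G where G: "g_mat n l (vec_space.col_space n A, s) = Some G" "G \<in> carrier_mat n n"
    "\<And>\<mu> i j. i < n \<Longrightarrow> j < n \<Longrightarrow> poly (G $$ (i, j)) \<mu> = plucker_mat n l s \<mu> (column_scale n l s A) A $$ (i, j)"
    by (rule g_mat_eval[OF A l s VA]) (assumption | rule that)+
  obtain H where H: "g_mat n k (vec_space.col_space n B, t) = Some H" "H \<in> carrier_mat n n"
    "\<And>\<mu> i j. i < n \<Longrightarrow> j < n \<Longrightarrow> poly (H $$ (i, j)) \<mu> = plucker_mat n k t \<mu> (column_scale n k t B) B $$ (i, j)"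
    by (rule g_mat_eval[OF B k t VB(1)]) (assumption | rule that)+
  have "((-1) ^ (k - 1) * (-1) ^ (k - 1) :: complex) = 1" by (simp flip: power_mult_distrib)
  then have \<mu>: "?\<mu> * (-1) ^ (k - 1) = t" by (simp add: mult.commute mult.left_commute)
  have \<delta>: "column_scale n k t B j \<noteq> 0" if "j < n" for j using that VB(1)[OF that] t by (simp add: column_scale_def)
  obtain C where C: "C \<in> carrier_mat k k" "det C \<noteq> 0" "select_cols ?B [0..<k] = B * C"
    by (rule first_cols_special[OF B k \<mu> t VB(2) \<delta>]) (assumption | rule that)+
  have AB: "?A * B \<in> carrier_mat n k" by (rule mult_carrier_mat[OF plucker_mat_carrier B])
  have ABC: "?A * B * C = ?A * select_cols ?B [0..<k]"
    unfolding C(3) by (rule assoc_mult_mat[OF plucker_mat_carrier B C(1)])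
  have "proj n k t (G * H) = Some (vec_space.col_space n (?A * B * C), t)"
  proof (rule proj_eval[OF t _ J(1,2)])
    show "?A * B * C \<in> carrier_mat n k" by (rule mult_carrier_mat[OF AB C(1)])
    show "pminor (?A * B * C) J \<noteq> 0" using pminor_mult[OF AB C(1) J(1)] J(3) C(2) by simp
    show "G * H \<in> carrier_mat n n" by (rule mult_carrier_mat[OF G(2) H(2)])
    fix i c assume ic: "i < n" "c < k"
    have "poly ((G * H) $$ (i, c)) ?\<mu> = (\<Sum>p<n. ?A $$ (i, p) * ?B $$ (p, c))"
      using ic k G(2,3) H(2,3) by (simp add: scalar_prod_def poly_sum lessThan_atLeast0)
    also have "\<dots> = (\<Sum>p<n. ?A $$ (i, p) * select_cols ?B [0..<k] $$ (p, c))"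
      by (rule sum.cong) (use ic in \<open>auto simp: select_cols_def carrier_matD[OF plucker_mat_carrier]\<close>)
    also have "\<dots> = (?A * select_cols ?B [0..<k]) $$ (i, c)"
      using ic by (simp add: scalar_prod_def lessThan_atLeast0 carrier_matD[OF plucker_mat_carrier] select_cols_def)
    finally show "poly ((G * H) $$ (i, c)) ((-1) ^ (k - 1) * t) = (?A * B * C) $$ (i, c)"
      unfolding ABC .
  qed (use k in simp)
  then show ?thesis using G(1) H(1) col_space_mult[OF AB C(1,2)] by simp
qed

lemma Theta_stage:
  assumes "k < n"
  shows "Theta n k a = (vec_space.col_space n (stage n (n - k) a (n - k)), snd a)"
proof -
  have "n - (n - k) = k" using assms by simp
  then show ?thesis using first_cols_Phi[of n "n - k" a] by (simp add: Theta_def)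
qed

text \<open>
  The coordinates are ratios of minors of the same matrix, which do not depend on the choice of a basis.
\<close>
lemma Theta_inj:
  assumes k: "0 < k" "k < n" and a: "a \<in> TT n (n - k)" "b \<in> TT n (n - k)" and eq: "Theta n k a = Theta n k b"
  shows "a = b"
proof -
  let ?m = "n - k" and ?S = "\<lambda>a. stage n (n - k) a (n - k)"
  have nk: "n - ?m = k" using k by simp
  have nz: "fst c (s, j) \<noteq> 0" if "c \<in> TT n ?m" "(s, j) \<in> RR n ?m" for c s j
    using that by (auto simp: TT_def PiE_iff)
  have S: "?S c \<in> carrier_mat n k" for c using stage_carrier[of n ?m c ?m] nk by simp
  have e: "vec_space.col_space n (?S a) = vec_space.col_space n (?S b)" "snd a = snd b"
    using eq unfolding Theta_stage[OF k(2)] by auto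
  obtain C where C: "C \<in> carrier_mat k k" "?S a = ?S b * C" by (rule col_space_factor[OF S S e(1)])
  have p: "pminor (?S a) (coord_rows k ?m i j) = pminor (?S b) (coord_rows k ?m i j) * det C" if "i \<le> ?m" "i \<le> j" "j \<le> i + k" for i j
    unfolding C(2) by (rule pminor_mult[OF S C(1)]) (use coord_rows_props(3)[OF that] k in simp)
  have mn: "?m \<le> n" by simp
  have "fst a (s, j) = fst b (s, j)" if sj: "(s, j) \<in> RR n ?m" for s j
  proof -
    have r: "s - 1 \<le> ?m" "s - 1 \<le> j" "j \<le> s - 1 + k" "s \<le> ?m" "s \<le> j" "j \<le> s + k"
      using sj k by (auto simp: RR_def)
    have "pminor (?S a) (coord_rows k ?m s j) \<noteq> 0"
      using stage_minor_nonzero[OF nz[OF a(1)] mn, of s j] r nk by simp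
    then have "det C \<noteq> 0" using p[OF r(4-6)] by auto
    then show ?thesis
      using coordinate_ratio[OF nz[OF a(1)] mn sj] coordinate_ratio[OF nz[OF a(2)] mn sj]
        p[OF r(1-3)] p[OF r(4-6)] nk by simp
  qed
  then have "fst a = fst b"
    using a by (intro PiE_ext[of _ "RR n ?m" "\<lambda>_. UNIV - {0}"]) (auto simp: TT_def)
  then show ?thesis using e(2) by (simp add: prod_eq_iff)
qed

lemma Theta_inv_Theta:
  assumes "0 < k" "k < n" "a \<in> TT n (n - k)"
  shows "Theta_inv n k (Theta n k a) = Some a"
proof -
  have "b = a" if "b \<in> TT n (n - k)" "Theta n k b = Theta n k a" for b
    by (rule Theta_inj[OF assms(1,2) that(1) assms(3) that(2)])
  then have *: "b \<in> TT n (n - k) \<and> Theta n k b = Theta n k a \<longleftrightarrow> b = a" for b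
    using assms(3) by blast
  show ?thesis unfolding Theta_inv_def * by simp
qed

context positive_functions
begin

lemma eventually_all_minors:
  assumes "posmat n l M"
  shows "\<forall>\<^sub>F x in F. \<forall>J. J \<subseteq> {..<n} \<longrightarrow> card J = l \<longrightarrow> pminor (M x) J \<noteq> 0"
proof -
  have "\<forall>\<^sub>F x in F. \<forall>J\<in>{J. J \<subseteq> {..<n} \<and> card J = l}. pminor (M x) J \<noteq> 0"
    by (rule eventually_ball_finite) (use pos_nonzero[OF posmat_pos[OF assms]] in auto)
  then show ?thesis by eventually_elim auto
qed

lemma pos_column_scale:
  assumes M: "posmat n l M" and l: "0 < l" "l < n" and s: "pos s"
  shows "pos (\<lambda>x. column_scale n l (s x) (M x) i)"
proof (cases "i < n")
  case True
  have "pos (\<lambda>x. pminor (M x) (window n (Suc l) i))"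
    by (rule posmat_pos[OF M window_subset]) (use card_window[of "Suc l" n i] l True in simp)
  moreover have "pos (\<lambda>x. if i < l then 1 / s x else 1)"
    using pos_divide[OF pos_one s] pos_one by (cases "i < l") auto
  ultimately show ?thesis using pos_divide True by (simp add: column_scale_def)
qed (simp add: column_scale_def pos_one)

lemma pos_tpoint_snd: "pos_tpoint n m a \<Longrightarrow> pos (\<lambda>x. snd (a x))"
  by (simp add: pos_tpoint_def)

text \<open>
  All row sets are reached in \<open>N\<close>, and the shift by \<open>l\<close> permutes the row sets; so all minors of the image of
  \<open>N\<close> are positive up to a common factor.
\<close>
lemma pos_tpoint_Psi:
  assumes a: "pos_tpoint n (n - l) a" and b: "pos_tpoint n (n - k) b" and l: "0 < l" "l < n" and k: "0 < k" "k < n"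
    and st: "\<forall>\<^sub>F x in F. snd (b x) \<noteq> snd (a x) \<and> snd (b x) \<noteq> - snd (a x)"
  obtains c where "pos_tpoint n (n - k) c" "\<And>x. snd (c x) = snd (b x)"
    "\<forall>\<^sub>F x in F. c x \<in> TT n (n - k) \<and> Psi n k l (Theta n l (a x), Theta n k (b x)) = Some (Theta n k (c x))"
proof -
  have nk: "n - (n - k) = k" "n - (n - l) = l" using k l by auto
  define M where "M = (\<lambda>x. stage n (n - l) (a x) (n - l))"
  define N where "N = (\<lambda>x. stage n (n - k) (b x) (n - k))"
  define s where "s = (\<lambda>x. snd (a x))"
  define t where "t = (\<lambda>x. snd (b x))"
  define \<mu> where "\<mu> = (\<lambda>x. (-1) ^ (k - 1) * t x)"
  define \<delta> where "\<delta> = (\<lambda>x. column_scale n l (s x) (M x))"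
  have M: "posmat n l M" unfolding M_def using stage_posmat[OF a] nk by simp
  have N: "posmat n k N" unfolding N_def using stage_posmat[OF b] nk by simp
  have s: "pos s" and t: "pos t" unfolding s_def t_def using pos_tpoint_snd[OF a] pos_tpoint_snd[OF b] by auto
  obtain R where R: "built n k R N" "\<And>J. J \<subseteq> {..<n} \<Longrightarrow> card J = k \<Longrightarrow> J \<in> R"
    using stage_built[OF b _ order_refl, of k] k nk unfolding N_def by auto
  have \<delta>: "pos (\<lambda>x. \<delta> x i)" for i unfolding \<delta>_def by (rule pos_column_scale[OF M l s])
  \<comment> \<open>The rank of \<open>g(M|s)\<close> drops only if \<open>t\<close> is \<open>s\<close> or \<open>-s\<close>, according to the parity of \<open>k + l\<close>.\<close>
  have \<nu>: "\<forall>\<^sub>F x in F. \<mu> x * (-1) ^ (l - 1) - s x \<noteq> 0"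
    using st
  proof eventually_elim
    case (elim x)
    have "\<mu> x * (-1) ^ (l - 1) = t x \<or> \<mu> x * (-1) ^ (l - 1) = - t x"
      unfolding \<mu>_def by (cases "even (k - 1)"; cases "even (l - 1)") simp_all
    moreover have "t x \<noteq> s x" "- t x \<noteq> s x"
      using elim minus_equation_iff[of "snd (b x)" "snd (a x)"] by (auto simp: s_def t_def)
    ultimately show ?case by auto
  qed
  define Z where "Z = (\<lambda>x. plucker_mat n l (s x) (\<mu> x) (\<delta> x) (M x) * N x)"
  have Z: "Z x \<in> carrier_mat n k" for x
    unfolding Z_def by (rule mult_carrier_mat[OF plucker_mat_carrier posmat_carrier[OF N]])
  have "k \<le> n" using k by simp
  from plucker_mat_built[where \<delta> = \<delta>, OF R(1) this l s t \<mu>_def[THEN fun_cong] \<nu> M \<delta>]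
  obtain \<kappa> h where \<kappa>h: "(\<forall>\<^sub>F x in F. \<kappa> x \<noteq> 0) \<and>
    (\<forall>J. J \<subseteq> {..<n} \<longrightarrow> card J = k \<longrightarrow>
      pos0 (h J) \<and> ((\<lambda>i. (i + l) mod n) ` J \<in> R \<longrightarrow> pos (h J)) \<and>
      (\<forall>\<^sub>F x in F. pminor (plucker_mat n l (s x) (\<mu> x) (\<delta> x) (M x) * N x) J = \<kappa> x * h J x))"
    by (elim exE) (rule that)
  note \<kappa> = conjunct1[OF \<kappa>h] and h = conjunct2[OF \<kappa>h, rule_format]
  have inj: "inj_on (\<lambda>i. (i + l) mod n) {..<n}"
  proof (rule inj_onI)
    fix i i' assume "i \<in> {..<n}" "i' \<in> {..<n}" "(i + l) mod n = (i' + l) mod n"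
    moreover have "(i + l) mod n = (if i + l < n then i + l else i + l - n)" if "i < n" for i
      using that l by (simp add: le_mod_geq)
    ultimately show "i = i'" by (simp split: if_splits)
  qed
  have pos_h: "pos (h J)" if J: "J \<subseteq> {..<n}" "card J = k" for J
  proof -
    have "(\<lambda>i. (i + l) mod n) ` J \<in> R"
      using card_image[OF inj_on_subset[OF inj J(1)]] l J by (intro R(2)) auto
    then show ?thesis using h[OF J] by blast
  qed
  have coord_rows: "coord_rows k (n - k) i j \<subseteq> {..<n}" "card (coord_rows k (n - k) i j) = k"
    if "i \<le> n - k" "i \<le> j" "j \<le> i + k" for i j
    using coord_rows_props[OF that] k by auto
  have mn: "n - k < n" using k by simp
  obtain c where c: "pos_tpoint n (n - k) c" "\<And>x. snd (c x) = t x"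
    "\<forall>\<^sub>F x in F. c x \<in> TT n (n - k) \<and>
      (\<exists>C\<in>carrier_mat (n - (n - k)) (n - (n - k)). det C \<noteq> 0 \<and> Z x = stage n (n - k) (c x) (n - k) * C)"
  proof (rule pos_tpoint_of_minors[OF mn, of Z t "\<lambda>i j. h (coord_rows k (n - k) i j)" \<kappa>, unfolded nk, OF Z t _ \<kappa>])
    fix i j assume ij: "i \<le> n - k" "i \<le> j" "j \<le> i + k"
    show "pos (h (coord_rows k (n - k) i j))" by (rule pos_h[OF coord_rows[OF ij]])
    show "\<forall>\<^sub>F x in F. pminor (Z x) (coord_rows k (n - k) i j) = \<kappa> x * h (coord_rows k (n - k) i j) x"
      using h[OF coord_rows[OF ij]] unfolding Z_def by blast
  qed (use that nk in auto)
  have J0: "0 \<le> n - k" "(0::nat) \<le> 0" "0 \<le> 0 + k" by auto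
  have "\<forall>\<^sub>F x in F. c x \<in> TT n (n - k) \<and> Psi n k l (Theta n l (a x), Theta n k (b x)) = Some (Theta n k (c x))"
    using c(3) eventually_all_minors[OF M] eventually_all_minors[OF N] pos_nonzero[OF s] pos_nonzero[OF t]
      pos_nonzero[OF pos_h[OF coord_rows[OF J0]]] \<kappa> conjunct2[OF conjunct2[OF h[OF coord_rows[OF J0]]]]
  proof eventually_elim
    case (elim x)
    obtain C where C: "C \<in> carrier_mat k k" "det C \<noteq> 0" "Z x = stage n (n - k) (c x) (n - k) * C"
      using elim(1) nk by auto
    have "Psi n k l ((vec_space.col_space n (M x), s x), (vec_space.col_space n (N x), t x)) =
      Some (vec_space.col_space n (plucker_mat n l (s x) ((-1) ^ (k - 1) * t x) (column_scale n l (s x) (M x)) (M x) * N x), t x)"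
      by (rule Psi_eval[OF posmat_carrier[OF M] posmat_carrier[OF N] l k elim(4,5) _ _ coord_rows[OF J0]])
        (use elim in \<open>auto simp: \<mu>_def \<delta>_def\<close>)
    then have "Psi n k l (Theta n l (a x), Theta n k (b x)) = Some (vec_space.col_space n (Z x), t x)"
      unfolding Theta_stage[OF l(2)] Theta_stage[OF k(2)] Z_def \<mu>_def \<delta>_def M_def N_def s_def t_def .
    moreover have "vec_space.col_space n (Z x) = vec_space.col_space n (stage n (n - k) (c x) (n - k))"
      unfolding C(3) by (rule col_space_mult[OF _ C(1,2)]) (use stage_carrier[of n "n - k"] nk in auto)
    ultimately show ?case using elim(1) c(2) unfolding Theta_stage[OF k(2)] by simp
  qed
  then show ?thesis using that[OF c(1)] c(2) by (auto simp: t_def)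
qed

text \<open>
  The minors of the flip at \<open>coord_rows\<close> are Laurent monomials in minors of \<open>N\<close>, in \<open>t\<close> and in the column
  factors of \<open>g\<close>, without any sign.
\<close>
lemma pos_tpoint_S1:
  assumes b: "pos_tpoint n (n - k) b" and k: "0 < k" "k < n"
  obtains c where "pos_tpoint n (n - k) c" "\<And>x. snd (c x) = snd (b x)"
    "\<forall>\<^sub>F x in F. c x \<in> TT n (n - k) \<and> S1 n k (Theta n k (b x)) = Some (Theta n k (c x))"
proof -
  have nk: "n - (n - k) = k" using k by simp
  define N where "N = (\<lambda>x. stage n (n - k) (b x) (n - k))"
  define t where "t = (\<lambda>x. snd (b x))"
  define \<mu> where "\<mu> = (\<lambda>x. (-1) ^ (k - 1) * t x)"
  define \<delta> where "\<delta> = (\<lambda>x. column_scale n k (t x) (N x))"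
  define Fl where "Fl = (\<lambda>x. mat n k (\<lambda>(i, c). plucker_mat n k (t x) (\<mu> x) (\<delta> x) (N x) $$ (n - 1 - c, n - 1 - i)))"
  have N: "posmat n k N" unfolding N_def using stage_posmat[OF b] nk by simp
  have t: "pos t" unfolding t_def by (rule pos_tpoint_snd[OF b])
  have \<delta>: "pos (\<lambda>x. \<delta> x i)" for i unfolding \<delta>_def by (rule pos_column_scale[OF N k t])
  have "((-1) ^ (k - 1) * (-1) ^ (k - 1) :: complex) = 1" by (simp flip: power_mult_distrib)
  then have \<mu>: "\<mu> x * (-1) ^ (k - 1) = t x" for x unfolding \<mu>_def by (simp add: mult.commute mult.left_commute)
  have Fl: "Fl x \<in> carrier_mat n k" for x by (simp add: Fl_def)
  have Fle: "Fl x $$ (a, c) = plucker_mat n k (t x) (\<mu> x) (\<delta> x) (N x) $$ (n - 1 - c, n - 1 - a)" if "a < n" "c < k" for x a c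
    using that by (simp add: Fl_def)
  define ix where "ix = (\<lambda>i j a. if a < j - i then i + a else n - k + a)"
  define H where "H = (\<lambda>i j x. (\<Prod>a<k. t x * \<delta> x (n - 1 - ix i j a)) *
    (pminor (N x) {n - k..<n} * (\<Prod>p<k - (j - i). pminor (N x) (insert p (window n k p))) *
      (\<Prod>p<j - i. pminor (N x) (insert (n - i - (j - i) + p) (window n k (n - i - (j - i) + p)))) *
      pminor (N x) ({n - i - (j - i) - (k - (j - i))..<n - i - (j - i)} \<union> {n - (j - i)..<n}) /
      (pminor (N x) ({0..<k - (j - i)} \<union> {n - (j - i)..<n}) *
       pminor (N x) {n - i - (j - i) - (k - (j - i))..<n - i - (j - i) + (j - i)})))"
  have diag: "pos (\<lambda>x. pminor (N x) (insert p (window n k p)))" if "p < n" for p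
  proof (rule posmat_pos[OF N])
    have "p \<notin> window n k p" by (simp add: window_def cyclic_dist_def)
    then show "card (insert p (window n k p)) = k" using card_window[of k n p] that k by simp
  qed (use that window_subset in auto)
  have H: "pos (H i j)" if ij: "i \<le> n - k" "i \<le> j" "j \<le> i + k" for i j
  proof -
    have c: "card ({n - i - (j - i) - (k - (j - i))..<n - i - (j - i)} \<union> {n - (j - i)..<n}) = k"
      "card ({0..<k - (j - i)} \<union> {n - (j - i)..<n}) = k"
      by (subst card_Un_disjoint; use ij k in auto)+
    show ?thesis unfolding H_def
      by (intro pos_mult pos_divide pos_prod t \<delta> diag posmat_pos[OF N]) (use c ij k in auto)
  qed
  have min: "\<forall>\<^sub>F x in F. pminor (Fl x) (coord_rows k (n - k) i j) = 1 * H i j x"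
    if ij: "i \<le> n - k" "i \<le> j" "j \<le> i + k" for i j
    using eventually_all_minors[OF N]
  proof eventually_elim
    case (elim x)
    have "pminor (Fl x) (coord_rows k (n - k) i j) = (\<Prod>a<k. t x * \<delta> x (n - 1 - ix i j a)) *
      minor2 (low_rank_mat n k (N x)) (sorted_list_of_set {n - k..<n})
        ([0..<k - (j - i)] @ [n - i - (j - i)..<n - i - (j - i) + (j - i)])"
      unfolding ix_def
      by (rule flip_minor[OF posmat_carrier[OF N] k \<mu> ij Fl Fle])
    also have "minor2 (low_rank_mat n k (N x)) (sorted_list_of_set {n - k..<n})
        ([0..<k - (j - i)] @ [n - i - (j - i)..<n - i - (j - i) + (j - i)]) =
      pminor (N x) {n - k..<n} * (\<Prod>p<k - (j - i). pminor (N x) (insert p (window n k p))) *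
      (\<Prod>p<j - i. pminor (N x) (insert (n - i - (j - i) + p) (window n k (n - i - (j - i) + p)))) *
      pminor (N x) ({n - i - (j - i) - (k - (j - i))..<n - i - (j - i)} \<union> {n - (j - i)..<n}) /
      (pminor (N x) ({0..<k - (j - i)} \<union> {n - (j - i)..<n}) *
       pminor (N x) {n - i - (j - i) - (k - (j - i))..<n - i - (j - i) + (j - i)})"
      by (rule twisted_minor[OF posmat_carrier[OF N] k]) (use ij k elim in auto)
    finally show ?case unfolding H_def by simp
  qed
  have mn: "n - k < n" using k by simp
  obtain c where c: "pos_tpoint n (n - k) c" "\<And>x. snd (c x) = t x"
    "\<forall>\<^sub>F x in F. c x \<in> TT n (n - k) \<and>
      (\<exists>C\<in>carrier_mat (n - (n - k)) (n - (n - k)). det C \<noteq> 0 \<and> Fl x = stage n (n - k) (c x) (n - k) * C)"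
    by (rule pos_tpoint_of_minors[OF mn, of Fl t H "\<lambda>x. 1", unfolded nk, OF Fl t H _ min])
      (use that nk in auto)
  have J0: "0 \<le> n - k" "(0::nat) \<le> 0" "0 \<le> 0 + k" by auto
  have coord_rows0: "coord_rows k (n - k) 0 0 \<subseteq> {..<n}" "card (coord_rows k (n - k) 0 0) = k" using coord_rows_props[OF J0] k by auto
  have "\<forall>\<^sub>F x in F. c x \<in> TT n (n - k) \<and> S1 n k (Theta n k (b x)) = Some (Theta n k (c x))"
    using c(3) eventually_all_minors[OF N] pos_nonzero[OF t] pos_nonzero[OF H[OF J0]] min[OF J0]
  proof eventually_elim
    case (elim x)
    obtain C where C: "C \<in> carrier_mat k k" "det C \<noteq> 0" "Fl x = stage n (n - k) (c x) (n - k) * C"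
      using elim(1) nk by auto
    have V: "pminor (N x) (window n (Suc k) j) \<noteq> 0" if "j < n" for j
      using elim(2) window_subset card_window[of "Suc k" n j] k that by simp
    obtain G where G: "g_mat n k (vec_space.col_space n (N x), t x) = Some G" "G \<in> carrier_mat n n"
      "\<And>\<mu> i j. i < n \<Longrightarrow> j < n \<Longrightarrow> poly (G $$ (i, j)) \<mu> = plucker_mat n k (t x) \<mu> (column_scale n k (t x) (N x)) (N x) $$ (i, j)"
      by (rule g_mat_eval[OF posmat_carrier[OF N] k elim(3) V]) (assumption | rule that)+
    have "proj n k (t x) (flip_mat n G) = Some (vec_space.col_space n (Fl x), t x)"
    proof (rule proj_eval[OF elim(3) Fl coord_rows0])
      show "pminor (Fl x) (coord_rows k (n - k) 0 0) \<noteq> 0" using elim(4,5) by simp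
      show "flip_mat n G \<in> carrier_mat n n" by (simp add: flip_mat_def)
      fix i c assume ic: "i < n" "c < k"
      then show "poly (flip_mat n G $$ (i, c)) ((-1) ^ (k - 1) * t x) = Fl x $$ (i, c)"
        using G(3)[of "n - 1 - c" "n - 1 - i"] k by (simp add: flip_mat_def Fl_def \<mu>_def \<delta>_def)
    qed (use k in simp)
    moreover have "vec_space.col_space n (Fl x) = vec_space.col_space n (stage n (n - k) (c x) (n - k))"
      unfolding C(3) by (rule col_space_mult[OF _ C(1,2)]) (use stage_carrier[of n "n - k"] nk in auto)
    moreover have "Theta n k (b x) = (vec_space.col_space n (N x), t x)"
      unfolding Theta_stage[OF k(2)] N_def t_def ..
    ultimately show ?case using elim(1) c(2) G(1) unfolding Theta_stage[OF k(2)] by (simp add: S1_def)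
  qed
  then show ?thesis using that[OF c(1)] c(2) by (auto simp: t_def)
qed

text \<open>
  Each of the maps that make up \<open>R\<close> preserves positivity and the spectral parameters; the latter ensures
  that the second \<open>\<Psi>\<close> is as nondegenerate as the first.
\<close>
lemma pos_tpoint_R_torus:
  assumes a: "pos_tpoint n (n - l) a" and b: "pos_tpoint n (n - k) b" and l: "0 < l" "l < n" and k: "0 < k" "k < n"
    and st: "\<forall>\<^sub>F x in F. snd (b x) \<noteq> snd (a x) \<and> snd (b x) \<noteq> - snd (a x)"
  obtains c d where "pos_tpoint n (n - k) c" "pos_tpoint n (n - l) d"
    "\<forall>\<^sub>F x in F. R_torus n l k (a x, b x) = Some (c x, d x)"
proof -
  obtain c where c: "pos_tpoint n (n - k) c" "\<forall>\<^sub>F x in F. c x \<in> TT n (n - k) \<and>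
      Psi n k l (Theta n l (a x), Theta n k (b x)) = Some (Theta n k (c x))"
    by (rule pos_tpoint_Psi[OF a b l k st]) (rule that)
  obtain a' where a': "pos_tpoint n (n - l) a'" "\<And>x. snd (a' x) = snd (a x)"
      "\<forall>\<^sub>F x in F. a' x \<in> TT n (n - l) \<and> S1 n l (Theta n l (a x)) = Some (Theta n l (a' x))"
    by (rule pos_tpoint_S1[OF a l]) (rule that)
  obtain b' where b': "pos_tpoint n (n - k) b'" "\<And>x. snd (b' x) = snd (b x)"
      "\<forall>\<^sub>F x in F. b' x \<in> TT n (n - k) \<and> S1 n k (Theta n k (b x)) = Some (Theta n k (b' x))"
    by (rule pos_tpoint_S1[OF b k]) (rule that)
  have st': "\<forall>\<^sub>F x in F. snd (a' x) \<noteq> snd (b' x) \<and> snd (a' x) \<noteq> - snd (b' x)"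
    using st
  proof eventually_elim
    case (elim x)
    then show ?case unfolding a'(2) b'(2) by (metis minus_minus)
  qed
  obtain e where e: "pos_tpoint n (n - l) e" "\<forall>\<^sub>F x in F. e x \<in> TT n (n - l) \<and>
      Psi n l k (Theta n k (b' x), Theta n l (a' x)) = Some (Theta n l (e x))"
    by (rule pos_tpoint_Psi[OF b'(1) a'(1) k l st']) (rule that)
  obtain d where d: "pos_tpoint n (n - l) d"
      "\<forall>\<^sub>F x in F. d x \<in> TT n (n - l) \<and> S1 n l (Theta n l (e x)) = Some (Theta n l (d x))"
    by (rule pos_tpoint_S1[OF e(1) l]) (rule that)
  have "\<forall>\<^sub>F x in F. R_torus n l k (a x, b x) = Some (c x, d x)"
    using c(2) a'(3) b'(3) e(2) d(2)
  proof eventually_elim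
    case (elim x)
    have "geomR n l k (Theta n l (a x), Theta n k (b x)) = Some (Theta n k (c x), Theta n l (d x))"
      using elim by (simp add: geomR_def map_comp_def)
    then show ?case
      using Theta_inv_Theta[OF k, of "c x"] Theta_inv_Theta[OF l, of "d x"] elim
      by (simp add: R_torus_def map_comp_def)
  qed
  then show ?thesis by (rule that[OF c(1) d(1)])
qed

end

section \<open>Positive polynomials\<close>

definition mon_val :: "('v \<Rightarrow>\<^sub>0 nat) \<Rightarrow> ('v \<Rightarrow> complex) \<Rightarrow> complex" where
  "mon_val m x = (\<Prod>v\<in>Poly_Mapping.keys m. x v ^ Poly_Mapping.lookup m v)"

lemma mon_val_superset:
  assumes "finite S" "Poly_Mapping.keys m \<subseteq> S"
  shows "mon_val m x = (\<Prod>v\<in>S. x v ^ Poly_Mapping.lookup m v)"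
  unfolding mon_val_def
  by (rule prod.mono_neutral_left) (use assms in \<open>auto simp: in_keys_iff\<close>)

lemma mon_val_add: "mon_val (m + m') x = mon_val m x * mon_val m' x"
proof -
  let ?S = "Poly_Mapping.keys m \<union> Poly_Mapping.keys m'"
  have "mon_val (m + m') x = (\<Prod>v\<in>?S. x v ^ Poly_Mapping.lookup (m + m') v)"
    by (rule mon_val_superset) (auto dest: set_mp[OF Poly_Mapping.keys_add])
  also have "\<dots> = (\<Prod>v\<in>?S. x v ^ Poly_Mapping.lookup m v) * (\<Prod>v\<in>?S. x v ^ Poly_Mapping.lookup m' v)"
    by (simp add: lookup_add power_add prod.distrib)
  also have "\<dots> = mon_val m x * mon_val m' x"
    using mon_val_superset[of ?S m x] mon_val_superset[of ?S m' x] by simp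
  finally show ?thesis .
qed

lemma eval_poly_superset:
  assumes "finite S" "Poly_Mapping.keys p \<subseteq> S"
  shows "eval_poly p x = (\<Sum>m\<in>S. Poly_Mapping.lookup p m * mon_val m x)"
  unfolding eval_poly_def mon_val_def[symmetric]
  by (rule sum.mono_neutral_left) (use assms in \<open>auto simp: in_keys_iff\<close>)

lemma eval_poly_add: "eval_poly (p + q) x = eval_poly p x + eval_poly q x"
proof -
  let ?S = "Poly_Mapping.keys p \<union> Poly_Mapping.keys q"
  have "eval_poly (p + q) x = (\<Sum>m\<in>?S. Poly_Mapping.lookup (p + q) m * mon_val m x)"
    by (rule eval_poly_superset) (auto dest: set_mp[OF Poly_Mapping.keys_add])
  also have "\<dots> = (\<Sum>m\<in>?S. Poly_Mapping.lookup p m * mon_val m x) + (\<Sum>m\<in>?S. Poly_Mapping.lookup q m * mon_val m x)"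
    by (simp add: lookup_add distrib_right sum.distrib)
  also have "\<dots> = eval_poly p x + eval_poly q x"
    using eval_poly_superset[of ?S p x] eval_poly_superset[of ?S q x] by simp
  finally show ?thesis .
qed

lemma eval_poly_zero: "eval_poly 0 x = 0"
  by (simp add: eval_poly_def)

lemma eval_poly_sum: "eval_poly (\<Sum>i\<in>A. f i) x = (\<Sum>i\<in>A. eval_poly (f i) x)"
  by (induction A rule: infinite_finite_induct) (simp_all add: eval_poly_add eval_poly_zero)

lemma eval_poly_single: "eval_poly (Poly_Mapping.single m c) x = c * mon_val m x"
  by (cases "c = 0") (simp_all add: eval_poly_def mon_val_def)

lemma eval_poly_diff: "eval_poly (p - q) x = eval_poly p x - eval_poly q x"
  using eval_poly_add[of "p - q" q x] by simp

lemma poly_mapping_sum_monomials: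
  fixes p :: "'a \<Rightarrow>\<^sub>0 'b :: comm_monoid_add"
  shows "(\<Sum>m\<in>Poly_Mapping.keys p. Poly_Mapping.single m (Poly_Mapping.lookup p m)) = p"
proof (rule poly_mapping_eqI)
  fix m
  have "(\<Sum>a\<in>Poly_Mapping.keys p. if a = m then Poly_Mapping.lookup p a else 0) = Poly_Mapping.lookup p m"
    by (simp add: sum.delta in_keys_iff)
  then show "Poly_Mapping.lookup (\<Sum>a\<in>Poly_Mapping.keys p. Poly_Mapping.single a (Poly_Mapping.lookup p a)) m
      = Poly_Mapping.lookup p m"
    by (simp add: lookup_sum lookup_single when_def)
qed

lemma eval_poly_mult: "eval_poly (p * q) x = eval_poly p x * eval_poly q x"
proof -
  let ?P = "Poly_Mapping.keys p" and ?Q = "Poly_Mapping.keys q"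
  have pq: "p = (\<Sum>m\<in>?P. Poly_Mapping.single m (Poly_Mapping.lookup p m))"
    "q = (\<Sum>m\<in>?Q. Poly_Mapping.single m (Poly_Mapping.lookup q m))"
    by (simp_all add: poly_mapping_sum_monomials)
  have "p * q = (\<Sum>m\<in>?P. \<Sum>m'\<in>?Q. Poly_Mapping.single (m + m') (Poly_Mapping.lookup p m * Poly_Mapping.lookup q m'))"
    by (subst pq(1), subst pq(2)) (simp add: sum_product Poly_Mapping.mult_single)
  then have "eval_poly (p * q) x = (\<Sum>m\<in>?P. \<Sum>m'\<in>?Q. (Poly_Mapping.lookup p m * mon_val m x) * (Poly_Mapping.lookup q m' * mon_val m' x))"
    by (simp add: eval_poly_sum eval_poly_single mon_val_add mult_ac)
  also have "\<dots> = eval_poly p x * eval_poly q x"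
    by (simp add: sum_product eval_poly_superset[of ?P p] eval_poly_superset[of ?Q q])
  finally show ?thesis .
qed

lemma polys_in_add: "p \<in> polys_in V \<Longrightarrow> q \<in> polys_in V \<Longrightarrow> p + q \<in> polys_in V"
  using Poly_Mapping.keys_add[of p q] by (auto simp: polys_in_def)

lemma polys_in_diff: "p \<in> polys_in V \<Longrightarrow> q \<in> polys_in V \<Longrightarrow> p - q \<in> polys_in V"
  using keys_diff[of p q] by (auto simp: polys_in_def)

lemma polys_in_mult:
  assumes "p \<in> polys_in V" "q \<in> polys_in V"
  shows "p * q \<in> polys_in V"
  unfolding polys_in_def
proof (intro CollectI ballI)
  fix m assume "m \<in> Poly_Mapping.keys (p * q)"
  then obtain a b where "m = a + b" "a \<in> Poly_Mapping.keys p" "b \<in> Poly_Mapping.keys q"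
    using keys_mult[of p q] by blast
  then show "Poly_Mapping.keys m \<subseteq> V"
    using assms Poly_Mapping.keys_add[of a b] unfolding polys_in_def by blast
qed

definition pvar :: "'v \<Rightarrow> 'v cpoly" where
  "pvar v = Poly_Mapping.single (Poly_Mapping.single v 1) 1"

lemma eval_pvar: "eval_poly (pvar v) x = x v"
  by (simp add: pvar_def eval_poly_single mon_val_def)

lemma pvar_polys_in: "v \<in> V \<Longrightarrow> pvar v \<in> polys_in V"
  by (simp add: pvar_def polys_in_def)

lemma eval_one: "eval_poly 1 x = 1"
  by (simp add: eval_poly_single mon_val_def flip: single_one)

text \<open>
  Evaluation at positive points shows that sums and products of positive polynomials are not zero.
\<close>
lemma positive_eval:
  assumes p: "p \<in> positive_polys_in V" and r: "\<And>v. r v > (0::real)"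
  shows "\<exists>y>0. eval_poly p (\<lambda>v. complex_of_real (r v)) = complex_of_real y"
proof -
  have coef: "\<exists>a>0. Poly_Mapping.lookup p m = complex_of_real a" if "m \<in> Poly_Mapping.keys p" for m
  proof -
    have "Poly_Mapping.lookup p m \<in> \<nat> - {0}" using p that by (simp add: positive_polys_in_def)
    then obtain k where "Poly_Mapping.lookup p m = of_nat k" "k \<noteq> 0" by (auto elim!: Nats_cases)
    then show ?thesis by (intro exI[of _ "real k"]) auto
  qed
  then obtain a where a: "\<And>m. m \<in> Poly_Mapping.keys p \<Longrightarrow> a m > 0 \<and> Poly_Mapping.lookup p m = complex_of_real (a m)"
    by metis
  let ?y = "\<Sum>m\<in>Poly_Mapping.keys p. a m * (\<Prod>v\<in>Poly_Mapping.keys m. r v ^ Poly_Mapping.lookup m v)"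
  have "eval_poly p (\<lambda>v. complex_of_real (r v)) = complex_of_real ?y"
    unfolding eval_poly_def using a by simp
  moreover have "?y > 0"
    by (rule sum_pos) (use p a r in \<open>auto simp: positive_polys_in_def intro!: mult_pos_pos prod_pos\<close>)
  ultimately show ?thesis by blast
qed

lemma positive_polys_inI:
  assumes "p \<in> polys_in V" "\<And>m. Poly_Mapping.lookup p m \<in> \<nat>" "eval_poly p (\<lambda>_. 1) \<noteq> 0"
  shows "p \<in> positive_polys_in V"
proof -
  have "p \<noteq> 0" using assms(3) eval_poly_zero by auto
  then show ?thesis using assms by (auto simp: positive_polys_in_def in_keys_iff)
qed

lemma positive_lookup: "p \<in> positive_polys_in V \<Longrightarrow> Poly_Mapping.lookup p m \<in> \<nat>"
  by (cases "m \<in> Poly_Mapping.keys p") (auto simp: positive_polys_in_def in_keys_iff)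

lemma positive_in: "p \<in> positive_polys_in V \<Longrightarrow> p \<in> polys_in V"
  by (simp add: positive_polys_in_def)

lemma positive_eval_one:
  assumes "p \<in> positive_polys_in V"
  shows "\<exists>y>0. eval_poly p (\<lambda>_. 1) = complex_of_real y"
  using positive_eval[OF assms, of "\<lambda>_. 1"] by simp

lemma positive_add:
  assumes "p \<in> positive_polys_in V" "q \<in> positive_polys_in V"
  shows "p + q \<in> positive_polys_in V"
proof (rule positive_polys_inI)
  show "p + q \<in> polys_in V" using assms by (intro polys_in_add positive_in)
  show "Poly_Mapping.lookup (p + q) m \<in> \<nat>" for m
    using positive_lookup[OF assms(1)] positive_lookup[OF assms(2)] by (simp add: lookup_add)
  obtain y z where "y > 0" "z > 0" "eval_poly p (\<lambda>_. 1) = complex_of_real y" "eval_poly q (\<lambda>_. 1) = complex_of_real z"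
    using positive_eval_one[OF assms(1)] positive_eval_one[OF assms(2)] by blast
  then show "eval_poly (p + q) (\<lambda>_. 1) \<noteq> 0" by (simp add: eval_poly_add flip: of_real_add)
qed

lemma Nats_sum: "(\<And>i. i \<in> A \<Longrightarrow> f i \<in> \<nat>) \<Longrightarrow> (\<Sum>i\<in>A. f i) \<in> \<nat>"
  by (induction A rule: infinite_finite_induct) auto

lemma positive_mult:
  assumes "p \<in> positive_polys_in V" "q \<in> positive_polys_in V"
  shows "p * q \<in> positive_polys_in V"
proof (rule positive_polys_inI)
  show "p * q \<in> polys_in V" using assms by (intro polys_in_mult positive_in)
  show "Poly_Mapping.lookup (p * q) m \<in> \<nat>" for m
  proof -
    have pq: "p = (\<Sum>m\<in>Poly_Mapping.keys p. Poly_Mapping.single m (Poly_Mapping.lookup p m))"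
      "q = (\<Sum>m\<in>Poly_Mapping.keys q. Poly_Mapping.single m (Poly_Mapping.lookup q m))"
      by (simp_all add: poly_mapping_sum_monomials)
    have "p * q = (\<Sum>a\<in>Poly_Mapping.keys p. \<Sum>b\<in>Poly_Mapping.keys q.
        Poly_Mapping.single (a + b) (Poly_Mapping.lookup p a * Poly_Mapping.lookup q b))"
      by (subst pq(1), subst pq(2)) (simp add: sum_product Poly_Mapping.mult_single)
    then have "Poly_Mapping.lookup (p * q) m = (\<Sum>a\<in>Poly_Mapping.keys p. \<Sum>b\<in>Poly_Mapping.keys q.
        if a + b = m then Poly_Mapping.lookup p a * Poly_Mapping.lookup q b else 0)"
      by (simp add: lookup_sum lookup_single when_def)
    also have "\<dots> \<in> \<nat>"
      using positive_lookup[OF assms(1)] positive_lookup[OF assms(2)]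
      by (intro Nats_sum) (auto intro: Nats_mult)
    finally show ?thesis .
  qed
  obtain y z where "y > 0" "z > 0" "eval_poly p (\<lambda>_. 1) = complex_of_real y" "eval_poly q (\<lambda>_. 1) = complex_of_real z"
    using positive_eval_one[OF assms(1)] positive_eval_one[OF assms(2)] by blast
  then show "eval_poly (p * q) (\<lambda>_. 1) \<noteq> 0" by (simp add: eval_poly_mult)
qed

lemma positive_one: "1 \<in> positive_polys_in V"
  by (rule positive_polys_inI) (auto simp: polys_in_def eval_one lookup_one when_def)

lemma positive_pvar: "v \<in> V \<Longrightarrow> pvar v \<in> positive_polys_in V"
  by (rule positive_polys_inI) (auto simp: pvar_polys_in eval_pvar, simp add: pvar_def lookup_single when_def)

section \<open>Generic validity as a filter\<close>

text \<open>
  Membership certifies that a polynomial is not zero, in a form that is inherited by products. Positive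
  polynomials belong here, and so does the difference of the two spectral parameters, whose
  vanishing has to be excluded.
\<close>
definition good_polys :: "(tvar + tvar) set \<Rightarrow> (tvar + tvar) cpoly set" where
  "good_polys V = {D \<in> polys_in V. \<forall>r. (\<forall>v. r v > (0::real)) \<longrightarrow> r (Inl TVar) > r (Inr TVar) \<longrightarrow>
     eval_poly D (\<lambda>v. complex_of_real (r v)) \<noteq> 0}"

lemma good_mult: "D \<in> good_polys V \<Longrightarrow> E \<in> good_polys V \<Longrightarrow> D * E \<in> good_polys V"
  by (simp add: good_polys_def polys_in_mult eval_poly_mult)

lemma positive_good: "D \<in> positive_polys_in V \<Longrightarrow> D \<in> good_polys V"
  unfolding good_polys_def
proof (intro CollectI conjI allI impI)
  fix r :: "tvar + tvar \<Rightarrow> real"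
  assume D: "D \<in> positive_polys_in V" and "\<forall>v. r v > 0"
  then show "eval_poly D (\<lambda>v. complex_of_real (r v)) \<noteq> 0" using positive_eval[OF D, of r] by auto
qed (rule positive_in)

lemma good_nonzero: "D \<in> good_polys V \<Longrightarrow> D \<noteq> 0"
proof
  assume D: "D \<in> good_polys V" "D = 0"
  let ?r = "\<lambda>v. if v = Inl TVar then 2 else 1 :: real"
  have "eval_poly D (\<lambda>v. complex_of_real (?r v)) \<noteq> 0" using D(1) by (simp add: good_polys_def)
  then show False using D(2) by (simp add: eval_poly_zero)
qed

definition generic :: "nat \<Rightarrow> nat \<Rightarrow> nat \<Rightarrow> (tpoint \<times> tpoint) filter" where
  "generic n m m' = Abs_filter (\<lambda>P. \<exists>D\<in>good_polys (tvars n m <+> tvars n m').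
     \<forall>p\<in>TT n m \<times> TT n m'. eval_poly D (tcoord2 p) \<noteq> 0 \<longrightarrow> P p)"

lemma eventually_generic: "eventually P (generic n m m') \<longleftrightarrow>
  (\<exists>D\<in>good_polys (tvars n m <+> tvars n m'). \<forall>p\<in>TT n m \<times> TT n m'. eval_poly D (tcoord2 p) \<noteq> 0 \<longrightarrow> P p)"
  unfolding generic_def
proof (rule eventually_Abs_filter, rule is_filter.intro)
  let ?V = "tvars n m <+> tvars n m'" and ?T = "TT n m \<times> TT n m'"
  show "\<exists>D\<in>good_polys ?V. \<forall>p\<in>?T. eval_poly D (tcoord2 p) \<noteq> 0 \<longrightarrow> True"
    using positive_good[OF positive_one] by blast
  fix P Q
  assume "\<exists>D\<in>good_polys ?V. \<forall>p\<in>?T. eval_poly D (tcoord2 p) \<noteq> 0 \<longrightarrow> P p"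
    "\<exists>D\<in>good_polys ?V. \<forall>p\<in>?T. eval_poly D (tcoord2 p) \<noteq> 0 \<longrightarrow> Q p"
  then obtain D E where DE: "D \<in> good_polys ?V" "E \<in> good_polys ?V"
    "\<And>p. p \<in> ?T \<Longrightarrow> eval_poly D (tcoord2 p) \<noteq> 0 \<Longrightarrow> P p" "\<And>p. p \<in> ?T \<Longrightarrow> eval_poly E (tcoord2 p) \<noteq> 0 \<Longrightarrow> Q p"
    by blast
  then show "\<exists>D\<in>good_polys ?V. \<forall>p\<in>?T. eval_poly D (tcoord2 p) \<noteq> 0 \<longrightarrow> P p \<and> Q p"
    by (intro bexI[of _ "D * E"] good_mult) (auto simp: eval_poly_mult)
next
  let ?V = "tvars n m <+> tvars n m'" and ?T = "TT n m \<times> TT n m'"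
  fix P Q :: "tpoint \<times> tpoint \<Rightarrow> bool"
  assume PQ: "\<forall>p. P p \<longrightarrow> Q p" and "\<exists>D\<in>good_polys ?V. \<forall>p\<in>?T. eval_poly D (tcoord2 p) \<noteq> 0 \<longrightarrow> P p"
  then obtain D where "D \<in> good_polys ?V" "\<forall>p\<in>?T. eval_poly D (tcoord2 p) \<noteq> 0 \<longrightarrow> P p" by blast
  then show "\<exists>D\<in>good_polys ?V. \<forall>p\<in>?T. eval_poly D (tcoord2 p) \<noteq> 0 \<longrightarrow> Q p"
    using PQ by (intro bexI[of _ D]) auto
qed

lemma generically_generic: "eventually P (generic n m m') \<Longrightarrow> generically n m m' P"
  unfolding eventually_generic generically_def
  using good_nonzero by (fastforce simp: good_polys_def)

lemma eventually_eval_nonzero: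
  "D \<in> good_polys (tvars n m <+> tvars n m') \<Longrightarrow> \<forall>\<^sub>F p in generic n m m'. eval_poly D (tcoord2 p) \<noteq> 0"
  unfolding eventually_generic by blast

text \<open>
  Positive rational functions, identified when they agree at generic points.
\<close>
definition posfun :: "nat \<Rightarrow> nat \<Rightarrow> nat \<Rightarrow> (tpoint \<times> tpoint \<Rightarrow> complex) \<Rightarrow> bool" where
  "posfun n m m' f \<longleftrightarrow> (\<exists>P\<in>positive_polys_in (tvars n m <+> tvars n m').
     \<exists>Q\<in>positive_polys_in (tvars n m <+> tvars n m').
       \<forall>\<^sub>F p in generic n m m'. f p = eval_poly P (tcoord2 p) / eval_poly Q (tcoord2 p))"

lemma eventually_positive_nonzero:
  "P \<in> positive_polys_in (tvars n m <+> tvars n m') \<Longrightarrow> \<forall>\<^sub>F p in generic n m m'. eval_poly P (tcoord2 p) \<noteq> 0"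
  by (rule eventually_eval_nonzero[OF positive_good])

interpretation torus: positive_functions "generic n m m'" "posfun n m m'" for n m m'
proof
  let ?V = "tvars n m <+> tvars n m'" and ?F = "generic n m m'"
  let ?e = "\<lambda>P p. eval_poly P (tcoord2 p)"
  show "posfun n m m' (\<lambda>x. 1)"
    unfolding posfun_def by (intro bexI[OF _ positive_one] always_eventually allI) (simp add: eval_one)
  fix f g
  assume f: "posfun n m m' f"
  then obtain P Q where PQ: "P \<in> positive_polys_in ?V" "Q \<in> positive_polys_in ?V" "\<forall>\<^sub>F p in ?F. f p = ?e P p / ?e Q p"
    unfolding posfun_def by blast
  show "posfun n m m' (\<lambda>x. inverse (f x))"
    unfolding posfun_def
  proof (rule bexI[OF _ PQ(2)], rule bexI[OF _ PQ(1)])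
    show "\<forall>\<^sub>F p in ?F. inverse (f p) = ?e Q p / ?e P p"
      using PQ(3) by eventually_elim simp
  qed
  show "\<forall>\<^sub>F x in ?F. f x \<noteq> 0"
    using PQ(3) eventually_positive_nonzero[OF PQ(1)] eventually_positive_nonzero[OF PQ(2)]
    by eventually_elim simp
  show "posfun n m m' g" if "\<forall>\<^sub>F x in ?F. g x = f x"
    unfolding posfun_def
  proof (rule bexI[OF _ PQ(1)], rule bexI[OF _ PQ(2)])
    show "\<forall>\<^sub>F p in ?F. g p = ?e P p / ?e Q p" using PQ(3) that by eventually_elim simp
  qed
  assume "posfun n m m' g"
  then obtain R S where RS: "R \<in> positive_polys_in ?V" "S \<in> positive_polys_in ?V" "\<forall>\<^sub>F p in ?F. g p = ?e R p / ?e S p"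
    unfolding posfun_def by blast
  show "posfun n m m' (\<lambda>x. f x + g x)"
    unfolding posfun_def
  proof (rule bexI[of _ "P * S + R * Q"], rule bexI[of _ "Q * S"])
    show "P * S + R * Q \<in> positive_polys_in ?V" "Q * S \<in> positive_polys_in ?V"
      using PQ RS by (auto intro: positive_add positive_mult)
    show "\<forall>\<^sub>F p in ?F. f p + g p = ?e (P * S + R * Q) p / ?e (Q * S) p"
      using PQ(3) RS(3) eventually_positive_nonzero[OF PQ(2)] eventually_positive_nonzero[OF RS(2)]
      by eventually_elim (simp add: eval_poly_add eval_poly_mult add_frac_eq)
  qed
  show "posfun n m m' (\<lambda>x. f x * g x)"
    unfolding posfun_def
  proof (rule bexI[of _ "P * R"], rule bexI[of _ "Q * S"])
    show "P * R \<in> positive_polys_in ?V" "Q * S \<in> positive_polys_in ?V"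
      using PQ RS by (auto intro: positive_mult)
    show "\<forall>\<^sub>F p in ?F. f p * g p = ?e (P * R) p / ?e (Q * S) p"
      using PQ(3) RS(3) by eventually_elim (simp add: eval_poly_mult)
  qed
qed

lemma posfun_coordinate:
  assumes "w \<in> tvars n m <+> tvars n m'"
  shows "posfun n m m' (\<lambda>p. tcoord2 p w)"
  unfolding posfun_def
  by (rule bexI[OF _ positive_pvar[OF assms]], rule bexI[OF _ positive_one], rule always_eventually)
    (simp add: eval_pvar eval_one)

lemma tcoord_alt: "tcoord a (XVar i j) = fst a (i, j)" "tcoord a TVar = snd a"
  by (cases a; simp)+

lemma tcoord2_alt: "tcoord2 p (Inl v) = tcoord (fst p) v" "tcoord2 p (Inr v) = tcoord (snd p) v"
  by (cases p; simp)+

theorem theorem5p3: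
  fixes n l k :: nat
  assumes "n \<ge> 2" and "l \<in> {1..n - 1}" and "k \<in> {1..n - 1}"
  shows "generically n (n - l) (n - k) (\<lambda>p. R_torus n l k p \<noteq> None) \<and>
    (\<forall>w\<in>tvars n (n - k) <+> tvars n (n - l).
       positive_rational_function n (n - l) (n - k)
         (\<lambda>p. map_option (\<lambda>q. tcoord2 q w) (R_torus n l k p)))"
proof -
  have l: "0 < l" "l < n" and k: "0 < k" "k < n" using assms by auto
  let ?F = "generic n (n - l) (n - k)" and ?pos = "posfun n (n - l) (n - k)"
  let ?V = "tvars n (n - l) <+> tvars n (n - k)"
  let ?s = "Inl TVar :: tvar + tvar" and ?t = "Inr TVar :: tvar + tvar"
  have st_V: "?s \<in> ?V" "?t \<in> ?V" by (auto simp: tvars_def)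
  have coord: "?pos (\<lambda>p. tcoord (fst p) v)" if "v \<in> tvars n (n - l)" for v
    using posfun_coordinate[of "Inl v" n "n - l" "n - k"] that by (simp add: tcoord2_alt InlI)
  have coord': "?pos (\<lambda>p. tcoord (snd p) v)" if "v \<in> tvars n (n - k)" for v
    using posfun_coordinate[of "Inr v" n "n - l" "n - k"] that by (simp add: tcoord2_alt InrI)
  have a: "torus.pos_tpoint n (n - l) (n - k) n (n - l) fst"
    unfolding torus.pos_tpoint_def
  proof (intro conjI ballI)
    fix ij assume "ij \<in> RR n (n - l)"
    then obtain i j where ij: "ij = (i, j)" "XVar i j \<in> tvars n (n - l)" by (cases ij) (auto simp: tvars_def)
    show "case ij of (i, j) \<Rightarrow> ?pos (\<lambda>p. fst (fst p) (i, j))"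
      using coord[OF ij(2)] ij(1) by (simp add: tcoord_alt)
  qed (use coord[of TVar] in \<open>simp add: tvars_def tcoord_alt\<close>)
  have b: "torus.pos_tpoint n (n - l) (n - k) n (n - k) snd"
    unfolding torus.pos_tpoint_def
  proof (intro conjI ballI)
    fix ij assume "ij \<in> RR n (n - k)"
    then obtain i j where ij: "ij = (i, j)" "XVar i j \<in> tvars n (n - k)" by (cases ij) (auto simp: tvars_def)
    show "case ij of (i, j) \<Rightarrow> ?pos (\<lambda>p. fst (snd p) (i, j))"
      using coord'[OF ij(2)] ij(1) by (simp add: tcoord_alt)
  qed (use coord'[of TVar] in \<open>simp add: tvars_def tcoord_alt\<close>)
  \<comment> \<open>The loci \<open>s = t\<close> and \<open>s = -t\<close> are avoided.\<close>
  have "pvar ?s - pvar ?t \<in> good_polys ?V"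
    using st_V by (auto simp: good_polys_def polys_in_diff pvar_polys_in eval_poly_diff eval_pvar)
  then have "\<forall>\<^sub>F p in ?F. eval_poly (pvar ?s - pvar ?t) (tcoord2 p) \<noteq> 0" by (rule eventually_eval_nonzero)
  moreover have "\<forall>\<^sub>F p in ?F. eval_poly (pvar ?s + pvar ?t) (tcoord2 p) \<noteq> 0"
    by (rule eventually_positive_nonzero[OF positive_add[OF positive_pvar positive_pvar]]) (rule st_V)+
  ultimately have st: "\<forall>\<^sub>F p in ?F. snd (snd p) \<noteq> snd (fst p) \<and> snd (snd p) \<noteq> - snd (fst p)"
    by eventually_elim (auto simp: eval_poly_diff eval_poly_add eval_pvar tcoord2_alt tcoord_alt)
  obtain c d where c: "torus.pos_tpoint n (n - l) (n - k) n (n - k) c" and d: "torus.pos_tpoint n (n - l) (n - k) n (n - l) d"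
    and R: "\<forall>\<^sub>F p in ?F. R_torus n l k (fst p, snd p) = Some (c p, d p)"
    by (rule torus.pos_tpoint_R_torus[OF a b l k st]) (rule that)
  have R': "\<forall>\<^sub>F p in ?F. R_torus n l k p = Some (c p, d p)" using R by simp
  have "generically n (n - l) (n - k) (\<lambda>p. R_torus n l k p \<noteq> None)"
    by (rule generically_generic) (use R' in \<open>auto elim: eventually_mono\<close>)
  moreover have "positive_rational_function n (n - l) (n - k) (\<lambda>p. map_option (\<lambda>q. tcoord2 q w) (R_torus n l k p))"
    if w: "w \<in> tvars n (n - k) <+> tvars n (n - l)" for w
  proof -
    have "?pos (\<lambda>p. tcoord2 (c p, d p) w)"
      using w c d by (auto simp: tvars_def tcoord_alt torus.pos_tpoint_def)
    then obtain P Q where PQ: "P \<in> positive_polys_in ?V" "Q \<in> positive_polys_in ?V"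
      "\<forall>\<^sub>F p in ?F. tcoord2 (c p, d p) w = eval_poly P (tcoord2 p) / eval_poly Q (tcoord2 p)"
      unfolding posfun_def by blast
    have "generically n (n - l) (n - k) (\<lambda>p. eval_poly Q (tcoord2 p) \<noteq> 0 \<and>
        map_option (\<lambda>q. tcoord2 q w) (R_torus n l k p) = Some (eval_poly P (tcoord2 p) / eval_poly Q (tcoord2 p)))"
    proof (rule generically_generic)
      show "\<forall>\<^sub>F p in ?F. eval_poly Q (tcoord2 p) \<noteq> 0 \<and>
          map_option (\<lambda>q. tcoord2 q w) (R_torus n l k p) = Some (eval_poly P (tcoord2 p) / eval_poly Q (tcoord2 p))"
        using eventually_positive_nonzero[OF PQ(2)] R' PQ(3) by eventually_elim simp
    qed
    then show ?thesis unfolding positive_rational_function_def using PQ(1,2) by blast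
  qed
  ultimately show ?thesis by blast
qed

end
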